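(* Up to equivalence, there is a unique regular normal extension from $(O(p+2,q),O(p,q))$ (with $c=1$) or $(O(p+1,q+1),O(p,q))$ (with $c=-1$) to contact projective structures, given by $$\left(\begin{array}{ccc}0&a&-X_1^TI \\ -ca&0&-cX_2^TI \\ X_1&X_2&A\end{array}\right)\mapsto\left(\begin{array}{cccc}0&\frac{-n}{2(n+1)}X_1^TI&\frac{-cn}{2(n+1)}X_2^T&\frac{-2cn^2}{4(n+1)^2}a \\ X_1&A&\frac{c}{n+1}aI&\frac{-cn}{2(n+1)}X_2 \\ IX_2&\frac{-1}{n+1}aI&IAI&\frac{n}{2(n+1)}IX_1 \\ 2a&X_2^TI&-X_1^T&0\end{array}\right)$$ with curvature $$\kappa\left(\left(\begin{array}{ccc}0&a&-X_1^TI \\ -ca&0&-cX_2^TI \\ X_1&X_2&A\end{array}\right),\left(\begin{array}{ccc}0&b&-Y_1^TI \\ -cb&0&-cY_2^TI \\ Y_1&Y_2&B\end{array}\right)\right)=\left(\begin{array}{cccc}0&0&0&0 \\ 0&R_1&-cR_3I-cR_2I&0 \\ 0&IR_3+IR_2&IR_1I&0 \\ 0&0&0&0\end{array}\right),$$ where $$R_1=\frac{n+2}{2(n+1)}(X_1Y_1^T-Y_1X_1^T+cX_2Y_2^T-cY_2X_2^T)I,$$ $$R_2=\frac{1}{n+1}(X_2^TIY_1-X_1^TIY_2),$$ $$R_3=\frac{n}{2(n+1)}(X_1Y_2^T+Y_2X_1^T-X_2Y_1^T-Y_1X_2^T)I.$$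
   Context: $n=p+q$; $I$ is the diagonal $n\times n$ matrix with $p$ entries $1$ and $q$ entries $-1$; $E$ denotes identity matrices; $X_1,X_2,Y_1,Y_2\in\mathbb R^n$ are columns, $a,b\in\mathbb R$, $A,B\in\mathfrak{so}(p,q)$ ($R_2$ is a scalar). The Lie algebra $\mathfrak g$ of $G=O(p+2,q)$ ($c=1$) resp. $G=O(p+1,q+1)$ ($c=-1$) consists of the matrices $\left(\begin{array}{ccc}0&a&-X_1^TI \\ -ca&0&-cX_2^TI \\ X_1&X_2&A\end{array}\right)$. The underlying symmetric space is $G/H$ with $H=O(p,q)\times O(2)$ resp. $O(p,q)\times O(1,1)$, symmetry $h=\mathrm{diag}(E,-E)$ (block sizes $(2,n)$), and $K=\{\mathrm{diag}(E,A):A\in O(p,q)\}\cong O(p,q)$. Contact projective structures are parabolic contact geometries of type $(L,P)$, here $L=PSp(2n+2,\mathbb R)$, $\mathfrak l=\mathfrak{sp}(2n+2,\mathbb R)$ realized with respect to the symplectic form $x_0y_{2n+1}-x_{2n+1}y_0+\sum_{i=1}^n(x_iy_{n+i}-x_{n+i}y_i)$, graded by block sizes $(1,2n,1)$ with block $(i,j)$ of degree $j-i$ (above, the $2n$-block is split as $n+n$); $\mathfrak p=\mathfrak l_0+\mathfrak l_1+\mathfrak l_2$. A Cartan geometry of type $(L,P)$ is a $P$-principal bundle with a $P$-equivariant $\mathfrak l$-valued 1-form $\omega$ reproducing generators of fundamental vector fields and isomorphic on each tangent space. Extension: a homomorphism $i:K\to P$, here fixed as $\mathrm{diag}(E,A)\mapsto\mathrm{diag}(1,A,IAI,1)$,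 and a linear map $\alpha:\mathfrak g\to\mathfrak l$ with $\alpha\circ\mathrm{Ad}(k)=\mathrm{Ad}(i(k))\circ\alpha$ ($k\in K$), $\alpha|_{\mathfrak k}=i'$, $\alpha:\mathfrak g/\mathfrak k\to\mathfrak l/\mathfrak p$ an isomorphism. It yields the Cartan geometry $(G\times_iP\to G/K,\omega_\alpha)$ of type $(L,P)$, $\omega_\alpha$ extending $\alpha\circ\omega_G$ ($\omega_G$ the Maurer–Cartan form), with curvature $\kappa(X,Y)=[\alpha(X),\alpha(Y)]-\alpha([X,Y])$ on $\mathfrak g$. Regular: $\kappa$, viewed on $\mathfrak l/\mathfrak p$, satisfies $\kappa(\mathfrak l_i,\mathfrak l_j)\subset\bigoplus_{l\ge i+j+1}\mathfrak l_l$ for $i,j<0$. Normal: $\sum_i\kappa([Z_i,X],X_i)=2\sum_i[Z_i,\kappa(X,X_i)]$ for all $X\in\mathfrak l/\mathfrak p$ ($X_i$ a basis of $\mathfrak l/\mathfrak p$, $Z_i$ the dual basis of $\mathfrak l_1+\mathfrak l_2$), the standard Kostant-codifferential condition. Two extensions are equivalent if there is a principal bundle morphism $\Phi$ of $G\times_iP$ with $\Phi^*\omega_{\alpha'}=\omega_\alpha$. *)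

theory Defs
  imports "HOL-Analysis.Analysis"
begin

text \<open>The index type of \<open>\<real>\<^sup>n\<close> is \<open>'n\<close>, with \<open>n = CARD('n) \<ge> 1\<close>; block matrices are indexed by sums of
  index types. Throughout, \<open>I\<close> is the diagonal sign matrix and \<open>c = \<plusminus>1\<close>.\<close>

type_synonym 'n gix = "unit + unit + 'n"
type_synonym 'n lix = "unit + 'n + 'n + unit"
type_synonym 'n gmat = "real^('n gix)^('n gix)"
type_synonym 'n lmat = "real^('n lix)^('n lix)"

definition sign_matrix :: "nat \<Rightarrow> nat \<Rightarrow> real^'n^'n \<Rightarrow> bool" where
  "sign_matrix p q I \<longleftrightarrow>
     (\<forall>i j. i \<noteq> j \<longrightarrow> I $ i $ j = 0) \<and> (\<forall>i. I $ i $ i = 1 \<or> I $ i $ i = -1) \<and>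
     card {i. I $ i $ i = 1} = p \<and> card {i. I $ i $ i = -1} = q"

definition g_block ::
  "real \<Rightarrow> real \<Rightarrow> real^'n \<Rightarrow>
   real \<Rightarrow> real \<Rightarrow> real^'n \<Rightarrow>
   real^'n \<Rightarrow> real^'n \<Rightarrow> real^'n^'n \<Rightarrow> 'n gmat" where
  "g_block m00 m01 r02
           m10 m11 r12
           v20 v21 A22 =
   (\<chi> r s. case r of
       Inl _ \<Rightarrow> (case s of Inl _ \<Rightarrow> m00 | Inr (Inl _) \<Rightarrow> m01 | Inr (Inr j) \<Rightarrow> r02 $ j)
     | Inr (Inl _) \<Rightarrow> (case s of Inl _ \<Rightarrow> m10 | Inr (Inl _) \<Rightarrow> m11 | Inr (Inr j) \<Rightarrow> r12 $ j)
     | Inr (Inr i) \<Rightarrow> (case s of Inl _ \<Rightarrow> v20 $ i | Inr (Inl _) \<Rightarrow> v21 $ i | Inr (Inr j) \<Rightarrow> A22 $ i $ j))"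

definition l_block ::
  "real \<Rightarrow> real^'n \<Rightarrow> real^'n \<Rightarrow> real \<Rightarrow>
   real^'n \<Rightarrow> real^'n^'n \<Rightarrow> real^'n^'n \<Rightarrow> real^'n \<Rightarrow>
   real^'n \<Rightarrow> real^'n^'n \<Rightarrow> real^'n^'n \<Rightarrow> real^'n \<Rightarrow>
   real \<Rightarrow> real^'n \<Rightarrow> real^'n \<Rightarrow> real \<Rightarrow> 'n lmat" where
  "l_block m00 r01 r02 m03
           v10 A11 A12 v13
           v20 A21 A22 v23
           m30 r31 r32 m33 =
   (\<chi> r s. case r of
       Inl _ \<Rightarrow> (case s of Inl _ \<Rightarrow> m00 | Inr (Inl j) \<Rightarrow> r01 $ j
                       | Inr (Inr (Inl j)) \<Rightarrow> r02 $ j | Inr (Inr (Inr _)) \<Rightarrow> m03)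
     | Inr (Inl i) \<Rightarrow> (case s of Inl _ \<Rightarrow> v10 $ i | Inr (Inl j) \<Rightarrow> A11 $ i $ j
                       | Inr (Inr (Inl j)) \<Rightarrow> A12 $ i $ j | Inr (Inr (Inr _)) \<Rightarrow> v13 $ i)
     | Inr (Inr (Inl i)) \<Rightarrow> (case s of Inl _ \<Rightarrow> v20 $ i | Inr (Inl j) \<Rightarrow> A21 $ i $ j
                       | Inr (Inr (Inl j)) \<Rightarrow> A22 $ i $ j | Inr (Inr (Inr _)) \<Rightarrow> v23 $ i)
     | Inr (Inr (Inr _)) \<Rightarrow> (case s of Inl _ \<Rightarrow> m30 | Inr (Inl j) \<Rightarrow> r31 $ j
                       | Inr (Inr (Inl j)) \<Rightarrow> r32 $ j | Inr (Inr (Inr _)) \<Rightarrow> m33))"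

definition bracket :: "real^'m^'m \<Rightarrow> real^'m^'m \<Rightarrow> real^'m^'m" where
  "bracket X Y = X ** Y - Y ** X"

definition Ad :: "real^'m^'m \<Rightarrow> real^'m^'m \<Rightarrow> real^'m^'m" where
  "Ad g X = g ** X ** matrix_inv g"

text \<open>The group, and its Lie algebra, of linear maps preserving the bilinear form with Gram matrix
  \<open>J\<close> (symmetric for the orthogonal groups, antisymmetric for the symplectic one).\<close>

definition form_group :: "real^'m^'m \<Rightarrow> (real^'m^'m) set" where
  "form_group J = {M. transpose M ** J ** M = J}"

definition form_algebra :: "real^'m^'m \<Rightarrow> (real^'m^'m) set" where
  "form_algebra J = {M. transpose M ** J + J ** M = 0}"

text \<open>\<open>G = O(p+2,q)\<close> for \<open>c = 1\<close> and \<open>G = O(p+1,q+1)\<close> for \<open>c = -1\<close>: the isometries of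
  \<open>diag(1, c, I)\<close>, whose Lie algebra consists of the matrices \<open>g_elt\<close>.\<close>

definition G_grp :: "real \<Rightarrow> real^'n^'n \<Rightarrow> 'n gmat set" where
  "G_grp c I = form_group (g_block 1 0 0  0 c 0  0 0 I)"

definition g_elt :: "real \<Rightarrow> real^'n^'n \<Rightarrow> real \<Rightarrow> real^'n \<Rightarrow> real^'n \<Rightarrow> real^'n^'n \<Rightarrow> 'n gmat" where
  "g_elt c I a X1 X2 A =
     g_block 0        a   (- (X1 v* I))
             (- c*a)  0   (- c *\<^sub>R (X2 v* I))
             X1       X2  A"

definition g_alg :: "real \<Rightarrow> real^'n^'n \<Rightarrow> 'n gmat set" where
  "g_alg c I = {g_elt c I a X1 X2 A | a X1 X2 A. A \<in> form_algebra I}"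

definition k_alg :: "real \<Rightarrow> real^'n^'n \<Rightarrow> 'n gmat set" where
  "k_alg c I = {g_elt c I 0 0 0 A | A. A \<in> form_algebra I}"

text \<open>The element \<open>diag(E, A)\<close> of \<open>K\<close>, for \<open>A \<in> O(p,q) = form_group I\<close>, and its image under \<open>i\<close>.\<close>

definition k_elt :: "real^'n^'n \<Rightarrow> 'n gmat" where
  "k_elt A = g_block 1 0 0  0 1 0  0 0 A"

definition i_hom :: "real^'n^'n \<Rightarrow> real^'n^'n \<Rightarrow> 'n lmat" where
  "i_hom I A = l_block 1 0 0 0
                       0 A 0 0
                       0 0 (I ** A ** I) 0
                       0 0 0 1"

text \<open>The derivative of \<open>i_hom I\<close>, which is affine in \<open>A\<close>.\<close>

definition i_deriv :: "real^'n^'n \<Rightarrow> real^'n^'n \<Rightarrow> 'n lmat" where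
  "i_deriv I A = l_block 0 0 0 0
                         0 A 0 0
                         0 0 (I ** A ** I) 0
                         0 0 0 0"

definition symp_form :: "'n::finite lmat" where
  "symp_form = l_block 0 0 0 1
                       0 0 (mat 1) 0
                       0 (- mat 1) 0 0
                       (-1) 0 0 0"

definition l_alg :: "'n::finite lmat set" where
  "l_alg = form_algebra symp_form"

text \<open>Position of an index among the blocks of sizes \<open>(1, 2n, 1)\<close>; the entry \<open>(r, s)\<close> has degree
  \<open>block_pos s - block_pos r\<close>.\<close>

definition block_pos :: "'n lix \<Rightarrow> int" where
  "block_pos r = (case r of Inl _ \<Rightarrow> 0 | Inr (Inl _) \<Rightarrow> 1 | Inr (Inr (Inl _)) \<Rightarrow> 1 | Inr (Inr (Inr _)) \<Rightarrow> 2)"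

definition l_deg :: "int \<Rightarrow> 'n::finite lmat set" where
  "l_deg k = {M \<in> l_alg. \<forall>r s. M $ r $ s \<noteq> 0 \<longrightarrow> block_pos s - block_pos r = k}"

text \<open>\<open>l_filt k\<close> is the sum of the \<open>l_deg l\<close> with \<open>l \<ge> k\<close>; so \<open>\<pp> = l_filt 0\<close> and
  \<open>\<ll>\<^sub>1 + \<ll>\<^sub>2 = l_filt 1\<close>.\<close>

definition l_filt :: "int \<Rightarrow> 'n::finite lmat set" where
  "l_filt k = {M \<in> l_alg. \<forall>r s. M $ r $ s \<noteq> 0 \<longrightarrow> block_pos s - block_pos r \<ge> k}"

abbreviation p_alg :: "'n::finite lmat set" where
  "p_alg \<equiv> l_filt 0"

text \<open>The preimage in \<open>Sp(2n+2,\<real>)\<close> of the parabolic subgroup \<open>P\<close> of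
  \<open>PSp(2n+2,\<real>) = Sp(2n+2,\<real>)/{\<plusminus>1}\<close>: the block upper triangular matrices. An element of \<open>P\<close>
  is a pair \<open>{M, -M}\<close> of elements of \<open>P_lift\<close>; the adjoint action does not see the sign.\<close>

definition P_lift :: "'n::finite lmat set" where
  "P_lift = {M \<in> form_group symp_form. \<forall>r s. block_pos s < block_pos r \<longrightarrow> M $ r $ s = 0}"


section \<open>Extensions\<close>

text \<open>\<open>\<alpha>\<close> is a total function on matrices, of which only the values on \<open>g_alg\<close> are meaningful.\<close>

definition extension :: "real \<Rightarrow> real^'n^'n \<Rightarrow> ('n gmat \<Rightarrow> 'n lmat) \<Rightarrow> bool" where
  "extension c I \<alpha> \<longleftrightarrow>
     (\<forall>x\<in>g_alg c I. \<alpha> x \<in> l_alg) \<and>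
     (\<forall>x\<in>g_alg c I. \<forall>y\<in>g_alg c I. \<alpha> (x + y) = \<alpha> x + \<alpha> y) \<and>
     (\<forall>t. \<forall>x\<in>g_alg c I. \<alpha> (t *\<^sub>R x) = t *\<^sub>R \<alpha> x) \<and>
     (\<forall>A\<in>form_group I. \<forall>x\<in>g_alg c I. \<alpha> (Ad (k_elt A) x) = Ad (i_hom I A) (\<alpha> x)) \<and>
     (\<forall>A\<in>form_algebra I. \<alpha> (g_elt c I 0 0 0 A) = i_deriv I A) \<and>
     \<comment> \<open>the induced map of the quotients by \<open>\<kk>\<close> and \<open>\<pp>\<close> is injective and surjective\<close>
     (\<forall>x\<in>g_alg c I. \<alpha> x \<in> p_alg \<longrightarrow> x \<in> k_alg c I) \<and>
     (\<forall>Y\<in>l_alg. \<exists>x\<in>g_alg c I. \<alpha> x - Y \<in> p_alg)"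

definition curvature :: "('n gmat \<Rightarrow> 'n::finite lmat) \<Rightarrow> 'n gmat \<Rightarrow> 'n gmat \<Rightarrow> 'n lmat" where
  "curvature \<alpha> x y = bracket (\<alpha> x) (\<alpha> y) - \<alpha> (bracket x y)"

text \<open>The curvature viewed on \<open>\<ll>/\<pp>\<close>, classes being given by representatives: for an extension,
  \<open>lift c I \<alpha> X\<close> is determined by \<open>X\<close> modulo \<open>\<pp>\<close> up to \<open>\<kk>\<close>, on which the curvature vanishes.\<close>

definition lift :: "real \<Rightarrow> real^'n^'n \<Rightarrow> ('n gmat \<Rightarrow> 'n lmat) \<Rightarrow> 'n lmat \<Rightarrow> 'n gmat" where
  "lift c I \<alpha> X = (SOME x. x \<in> g_alg c I \<and> \<alpha> x - X \<in> p_alg)"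

definition curv_lp ::
  "real \<Rightarrow> real^'n^'n \<Rightarrow> ('n gmat \<Rightarrow> 'n lmat) \<Rightarrow> 'n lmat \<Rightarrow> 'n lmat \<Rightarrow> 'n lmat" where
  "curv_lp c I \<alpha> X Y = curvature \<alpha> (lift c I \<alpha> X) (lift c I \<alpha> Y)"

definition regular :: "real \<Rightarrow> real^'n^'n \<Rightarrow> ('n gmat \<Rightarrow> 'n lmat) \<Rightarrow> bool" where
  "regular c I \<alpha> \<longleftrightarrow>
     (\<forall>i j. i < 0 \<and> j < 0 \<longrightarrow>
        (\<forall>X\<in>l_deg i. \<forall>Y\<in>l_deg j. curv_lp c I \<alpha> X Y \<in> l_filt (i + j + 1)))"

text \<open>\<open>B\<close> represents a basis of \<open>\<ll>/\<pp>\<close> and \<open>Z\<close> is the dual basis of \<open>\<ll>\<^sub>1 + \<ll>\<^sub>2\<close>. Duality is with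
  respect to the trace form, a constant multiple of the Killing form of \<open>\<ll>\<close>; rescaling the form
  rescales all of \<open>Z\<close>, in which the normality condition is homogeneous.\<close>

definition dual_bases :: "'n::finite lmat set \<Rightarrow> ('n lmat \<Rightarrow> 'n lmat) \<Rightarrow> bool" where
  "dual_bases B Z \<longleftrightarrow>
     finite B \<and> B \<subseteq> l_alg \<and>
     (\<forall>Y\<in>l_alg. \<exists>u. Y - (\<Sum>b\<in>B. u b *\<^sub>R b) \<in> p_alg) \<and>
     (\<forall>u. (\<Sum>b\<in>B. u b *\<^sub>R b) \<in> p_alg \<longrightarrow> (\<forall>b\<in>B. u b = 0)) \<and>
     (\<forall>b\<in>B. Z b \<in> l_filt 1) \<and>
     (\<forall>b\<in>B. \<forall>b'\<in>B. trace (Z b ** b') = (if b = b' then 1 else 0))"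

definition normal :: "real \<Rightarrow> real^'n^'n \<Rightarrow> ('n gmat \<Rightarrow> 'n lmat) \<Rightarrow> bool" where
  "normal c I \<alpha> \<longleftrightarrow>
     (\<forall>B Z. dual_bases B Z \<longrightarrow>
        (\<forall>X\<in>l_alg. (\<Sum>b\<in>B. curv_lp c I \<alpha> (bracket (Z b) X) b)
                 = 2 *\<^sub>R (\<Sum>b\<in>B. bracket (Z b) (curv_lp c I \<alpha> X b))))"


section \<open>The bundle \<open>G \<times>\<^sub>i P\<close> and equivalence of extensions\<close>

text \<open>\<open>G \<times>\<^sub>i P\<close> is the quotient of \<open>G \<times> P\<close> by \<open>(g, x) \<sim> (g k, i(k)\<^sup>-\<^sup>1 x)\<close>, \<open>k \<in> K\<close>. As \<open>P\<close> is
  \<open>P_lift\<close> modulo sign, it is the quotient of \<open>G \<times> P_lift\<close> by the following relation.\<close>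

definition GP :: "real \<Rightarrow> real^'n^'n \<Rightarrow> ('n gmat \<times> 'n lmat) set" where
  "GP c I = G_grp c I \<times> P_lift"

definition bundle_rel ::
  "real \<Rightarrow> real^'n^'n \<Rightarrow> (('n gmat \<times> 'n lmat) \<times> ('n gmat \<times> 'n lmat)) set" where
  "bundle_rel c I = {((g, M), (g', M')).
     (g, M) \<in> GP c I \<and> (g', M') \<in> GP c I \<and>
     (\<exists>A\<in>form_group I. \<exists>s\<in>{1, -1}.
        g' = g ** k_elt A \<and> M' = s *\<^sub>R (matrix_inv (i_hom I A) ** M))}"

definition total_space :: "real \<Rightarrow> real^'n^'n \<Rightarrow> ('n gmat \<times> 'n lmat) set set" where
  "total_space c I = GP c I // bundle_rel c I"

definition proj ::
  "real \<Rightarrow> real^'n^'n \<Rightarrow> 'n gmat \<times> 'n lmat \<Rightarrow> ('n gmat \<times> 'n lmat) set" where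
  "proj c I x = bundle_rel c I `` {x}"

text \<open>The principal right action of \<open>P\<close>, through representatives in \<open>P_lift\<close>.\<close>

definition right_act ::
  "('n gmat \<times> 'n::finite lmat) set \<Rightarrow> 'n lmat \<Rightarrow> ('n gmat \<times> 'n lmat) set" where
  "right_act u N = (\<lambda>(g, M). (g, M ** N)) ` u"

primrec Ck_on :: "nat \<Rightarrow> 'a::real_normed_vector set \<Rightarrow> ('a \<Rightarrow> real) \<Rightarrow> bool" where
  "Ck_on 0 U f \<longleftrightarrow> continuous_on U f"
| "Ck_on (Suc k) U f \<longleftrightarrow>
     (\<exists>f'. (\<forall>x\<in>U. (f has_derivative f' x) (at x)) \<and> (\<forall>h. Ck_on k U (\<lambda>x. f' x h)))"

text \<open>Smoothness of a function on an embedded submanifold \<open>S\<close>: local extendability to smooth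
  functions on open subsets of the ambient space.\<close>

definition smooth_on_submanifold :: "'a::real_normed_vector set \<Rightarrow> ('a \<Rightarrow> real) \<Rightarrow> bool" where
  "smooth_on_submanifold S f \<longleftrightarrow>
     (\<forall>x\<in>S. \<exists>U F. open U \<and> x \<in> U \<and> (\<forall>k. Ck_on k U F) \<and> (\<forall>y\<in>U \<inter> S. F y = f y))"

text \<open>The quotient manifold structure: a function on \<open>G \<times>\<^sub>i P\<close> is smooth iff its pullback along the
  projection from \<open>G \<times> P_lift\<close> is, and a map is smooth iff it pulls back smooth functions to
  smooth functions.\<close>

definition smooth_fun ::
  "real \<Rightarrow> real^'n^'n \<Rightarrow> (('n gmat \<times> 'n lmat) set \<Rightarrow> real) \<Rightarrow> bool" where
  "smooth_fun c I f \<longleftrightarrow> smooth_on_submanifold (GP c I) (\<lambda>x. f (proj c I x))"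

text \<open>Principal bundle morphisms need not cover the identity of \<open>G/K\<close>.\<close>

definition bundle_morphism ::
  "real \<Rightarrow> real^'n^'n \<Rightarrow> (('n gmat \<times> 'n lmat) set \<Rightarrow> ('n gmat \<times> 'n lmat) set) \<Rightarrow> bool" where
  "bundle_morphism c I \<Phi> \<longleftrightarrow>
     (\<forall>u\<in>total_space c I. \<Phi> u \<in> total_space c I) \<and>
     (\<forall>u\<in>total_space c I. \<forall>N\<in>P_lift. \<Phi> (right_act u N) = right_act (\<Phi> u) N) \<and>
     (\<forall>f. smooth_fun c I f \<longrightarrow> smooth_fun c I (f \<circ> \<Phi>))"

text \<open>The Cartan connection \<open>\<omega>\<^sub>\<alpha>\<close>, pulled back to \<open>G \<times> P_lift\<close>: its value on the vector \<open>(v, w)\<close>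
  tangent at \<open>(g, M)\<close>. Reproduction of fundamental vector fields, \<open>P\<close>-equivariance and
  \<open>\<omega>\<^sub>\<alpha> = \<alpha> \<circ> \<omega>\<^sub>G\<close> on \<open>G \<times> {1}\<close> force it to be \<open>Ad(M\<^sup>-\<^sup>1)(\<alpha>(g\<^sup>-\<^sup>1 v)) + M\<^sup>-\<^sup>1 w\<close>.\<close>

definition cartan_form ::
  "('n gmat \<Rightarrow> 'n::finite lmat) \<Rightarrow> 'n gmat \<times> 'n lmat \<Rightarrow> 'n gmat \<times> 'n lmat \<Rightarrow> 'n lmat" where
  "cartan_form \<alpha> = (\<lambda>(g, M) (v, w).
     Ad (matrix_inv M) (\<alpha> (matrix_inv g ** v)) + matrix_inv M ** w)"

text \<open>Tangent vectors of \<open>G \<times>\<^sub>i P\<close> are represented by curves \<open>\<gamma>\<close> in \<open>G \<times> P_lift\<close> through time \<open>0\<close>.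
  If \<open>\<delta>\<close> lifts the image under \<open>\<Phi>\<close> of the projection of \<open>\<gamma>\<close>, then \<open>\<delta>\<close> represents the image under
  the differential of \<open>\<Phi>\<close> of the vector represented by \<open>\<gamma>\<close>. So the condition says
  \<open>\<Phi>\<^sup>*\<omega>\<^bsub>\<alpha>'\<^esub> = \<omega>\<^bsub>\<alpha>\<^esub>\<close>.\<close>

definition pulls_back ::
  "real \<Rightarrow> real^'n^'n \<Rightarrow> (('n gmat \<times> 'n lmat) set \<Rightarrow> ('n gmat \<times> 'n lmat) set) \<Rightarrow>
   ('n gmat \<Rightarrow> 'n lmat) \<Rightarrow> ('n gmat \<Rightarrow> 'n lmat) \<Rightarrow> bool" where
  "pulls_back c I \<Phi> \<alpha>' \<alpha> \<longleftrightarrow>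
     (\<forall>\<gamma> \<delta> \<gamma>' \<delta>'.
        (\<forall>\<^sub>F t in nhds 0. \<gamma> t \<in> GP c I \<and> \<delta> t \<in> GP c I \<and> \<Phi> (proj c I (\<gamma> t)) = proj c I (\<delta> t)) \<and>
        (\<gamma> has_vector_derivative \<gamma>') (at (0::real)) \<and>
        (\<delta> has_vector_derivative \<delta>') (at 0)
        \<longrightarrow> cartan_form \<alpha>' (\<delta> 0) \<delta>' = cartan_form \<alpha> (\<gamma> 0) \<gamma>')"

definition equivalent ::
  "real \<Rightarrow> real^'n^'n \<Rightarrow> ('n gmat \<Rightarrow> 'n lmat) \<Rightarrow> ('n gmat \<Rightarrow> 'n lmat) \<Rightarrow> bool" where
  "equivalent c I \<alpha> \<alpha>' \<longleftrightarrow> (\<exists>\<Phi>. bundle_morphism c I \<Phi> \<and> pulls_back c I \<Phi> \<alpha>' \<alpha>)"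

text \<open>\<open>outer X Y\<close> is the matrix \<open>X Y\<^sup>T\<close>.\<close>

definition outer :: "real^'n \<Rightarrow> real^'n \<Rightarrow> real^'n^'n" where
  "outer X Y = (\<chi> i j. X $ i * Y $ j)"

end

theory Submission
  imports Defs
begin

text \<open>The group \<open>K = O(p,q)\<close> acts on \<open>\<gg>/\<kk>\<close> as \<open>\<real> + V + V\<close> with \<open>V = \<real>\<^sup>n\<close>, and \<open>\<ll>\<close> is built from copies
of \<open>\<real>\<close>, \<open>V\<close> and \<open>V \<otimes> V\<close>. By Schur's lemma (\<open>schur\<close>, which uses reflections only and is therefore
uniform in \<open>p\<close>, \<open>q\<close>) an equivariant linear map \<open>\<gg> \<rightarrow> \<ll>\<close> with the prescribed values on \<open>\<kk>\<close> is given
by fourteen real numbers (\<open>extension_equivariant_elt\<close>). Three mechanisms reduce these to the single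
solution of the theorem.

Regularity compares the bracket \<open>\<ll>\<^sub>-\<^sub>1 \<times> \<ll>\<^sub>-\<^sub>1 \<rightarrow> \<ll>\<^sub>-\<^sub>2\<close> with that of \<open>\<gg>\<close>: it says that \<open>\<real>\<close> is mapped to
\<open>\<ll>\<^sub>-\<^sub>2\<close> with twice the determinant of the \<open>2 \<times> 2\<close> matrix \<open>T\<close> that maps \<open>V + V\<close> to \<open>\<ll>\<^sub>-\<^sub>1 = V + V\<close>, and
injectivity on \<open>\<gg>/\<kk>\<close> makes this determinant nonzero (\<open>extension_regular_invariants\<close>).

Elements \<open>h \<in> G\<close> and \<open>N \<in> P\<close> that centralize \<open>K\<close> and \<open>i(K)\<close> act on extensions by
\<open>\<beta> \<mapsto> Ad(N) \<circ> \<beta> \<circ> Ad(h)\<close>. This preserves normality (\<open>normal_transform\<close>) and gives an equivalent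
extension: the principal bundle morphism is induced by \<open>(g, M) \<mapsto> (g h, N M)\<close>, and its behaviour
under pullback follows from the product rule, since two lifts of one curve in \<open>G \<times>\<^sub>i P\<close> differ by a
curve in \<open>K\<close> and a locally constant sign (\<open>pulls_back_shift\<close>). There are enough such \<open>N\<close> to act on \<open>T\<close> by
\<open>SL(2,\<real>)\<close> and positive scalars and to remove the component of the image of \<open>\<real>\<close> along the grading
element; with \<open>h = diag(1,-1,E)\<close>, which reverses the sign of \<open>det T\<close>, one reaches \<open>T = 1\<close>.

There remain eight parameters. Their curvature is computed explicitly
(\<open>curvature_normalized_map\<close>). The codifferential does not depend on the choice of dual bases
(\<open>dual_bases_sum_eq\<close>), so that it can be evaluated on root vectors
(\<open>codifferential_normalized_map\<close>). It vanishes for exactly one choice of the parameters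
(\<open>normal_normalized_map_iff\<close>): seven of them are determined by linear equations and the last one,
the coefficient of \<open>\<real> \<rightarrow> \<ll>\<^sub>2\<close>, then by a linear equation whose right hand side is quadratic in the
others. For this choice only the part of the curvature in \<open>\<ll>\<^sub>0\<close> survives, which gives regularity and
the stated formula (\<open>curvature_alpha\<close>).\<close>

section \<open>Matrix groups preserving a bilinear form\<close>

lemma bounded_bilinear_matrix_mult:
  "bounded_bilinear ((**) :: real^'n^'m \<Rightarrow> real^'p^'n \<Rightarrow> real^'p^'m)"
proof -
  have "bilinear ((**) :: real^'n^'m \<Rightarrow> real^'p^'n \<Rightarrow> real^'p^'m)"
    unfolding bilinear_def
    by (auto intro!: linearI simp: matrix_add_ldistrib vec_eq_iff matrix_matrix_mult_def
        algebra_simps sum.distrib sum_distrib_left)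
  then show ?thesis by (simp add: bilinear_conv_bounded_bilinear)
qed

interpretation matmul: bounded_bilinear "(**) :: real^'n^'m \<Rightarrow> real^'p^'n \<Rightarrow> real^'p^'m"
  by (rule bounded_bilinear_matrix_mult)

lemma linear_bracket_left: "linear (\<lambda>X. bracket X Y)"
  by (auto intro!: linearI simp: bracket_def matmul.add_left matmul.add_right matmul.scaleR_left
      matmul.scaleR_right scaleR_diff_right)

lemma linear_bracket_right: "linear (\<lambda>Y. bracket X Y)"
  by (auto intro!: linearI simp: bracket_def matmul.add_left matmul.add_right matmul.scaleR_left
      matmul.scaleR_right scaleR_diff_right)

lemma bracket_swap: "bracket X Y = - bracket Y X"
  by (simp add: bracket_def)

lemma matrix_inv_eqI:
  fixes A B :: "real^'m^'m"
  assumes "A ** B = mat 1"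
  shows "matrix_inv A = B"
proof -
  have "B ** A = mat 1" using assms matrix_left_right_inverse by blast
  then have "A ** matrix_inv A = mat 1"
    unfolding matrix_inv_def using assms someI[of "\<lambda>A'. A ** A' = mat 1 \<and> A' ** A = mat 1" B] by blast
  then have "B ** (A ** matrix_inv A) = B" by simp
  then have "matrix_inv A = B" using \<open>B ** A = mat 1\<close> by (simp add: matrix_mul_assoc)
  then show ?thesis .
qed

lemma matrix_inv_inverse:
  fixes M N :: "real^'m^'m"
  assumes "M ** N = mat 1"
  shows "M ** matrix_inv M = mat 1" "matrix_inv M ** M = mat 1"
  unfolding matrix_inv_eqI[OF assms]
  by (rule assms, rule matrix_left_right_inverse[THEN iffD1, OF assms])

lemma matrix_inv_matrix_mult:
  fixes M N M' N' :: "real^'m^'m"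
  assumes "M ** M' = mat 1" "N ** N' = mat 1"
  shows "matrix_inv (M ** N) = matrix_inv N ** matrix_inv M"
proof (rule matrix_inv_eqI)
  have "M ** N ** (matrix_inv N ** matrix_inv M) = M ** (N ** matrix_inv N) ** matrix_inv M"
    by (simp add: matrix_mul_assoc)
  then show "M ** N ** (matrix_inv N ** matrix_inv M) = mat 1"
    using assms by (simp add: matrix_inv_inverse)
qed

text \<open>A nondegenerate bilinear form with Gram matrix \<open>J\<close>, together with the inverse \<open>Ji\<close> of \<open>J\<close>. The
equation \<open>M\<^sup>T J M = J\<close> then inverts \<open>M\<close> by a polynomial formula, so that inverses along a
differentiable curve in the group are differentiable without further argument. The orthogonal groups
and the symplectic group are the instances.\<close>

locale form =
  fixes J Ji :: "real^'m^'m"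
  assumes J_inv: "Ji ** J = mat 1"
begin

lemma inv_eq:
  assumes "M \<in> form_group J"
  shows "matrix_inv M = Ji ** transpose M ** J" "M ** matrix_inv M = mat 1" "matrix_inv M ** M = mat 1"
proof -
  have "(Ji ** transpose M ** J) ** M = Ji ** (transpose M ** J ** M)" by (simp add: matrix_mul_assoc)
  also have "\<dots> = mat 1" using assms J_inv by (simp add: form_group_def)
  finally have l: "(Ji ** transpose M ** J) ** M = mat 1" .
  then have r: "M ** (Ji ** transpose M ** J) = mat 1" using matrix_left_right_inverse by blast
  show i: "matrix_inv M = Ji ** transpose M ** J" by (rule matrix_inv_eqI[OF r])
  show "M ** matrix_inv M = mat 1" "matrix_inv M ** M = mat 1"
    unfolding i by (rule r, rule l)
qed

lemma mult_mem:
  assumes "M \<in> form_group J" "N \<in> form_group J"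
  shows "M ** N \<in> form_group J"
proof -
  have "transpose (M ** N) ** J ** (M ** N) = transpose N ** (transpose M ** J ** M) ** N"
    by (simp add: matrix_transpose_mul matrix_mul_assoc)
  then show ?thesis using assms by (simp add: form_group_def)
qed

lemma one_mem: "mat 1 \<in> form_group J"
  by (simp add: form_group_def)

lemma minus_mem: "M \<in> form_group J \<Longrightarrow> - M \<in> form_group J"
proof -
  have "transpose (- M) = - transpose M" by (simp add: transpose_def vec_eq_iff)
  then show "M \<in> form_group J \<Longrightarrow> - M \<in> form_group J"
    by (simp add: form_group_def matmul.minus_left matmul.minus_right)
qed

lemma inv_mem:
  assumes "M \<in> form_group J"
  shows "matrix_inv M \<in> form_group J"
proof -
  let ?N = "matrix_inv M"
  have "transpose ?N ** J ** ?N = transpose ?N ** (transpose M ** J ** M) ** ?N"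
    using assms by (simp add: form_group_def)
  also have "\<dots> = transpose (M ** ?N) ** J ** (M ** ?N)"
    by (simp add: matrix_transpose_mul matrix_mul_assoc)
  finally show ?thesis using inv_eq[OF assms] by (simp add: form_group_def)
qed

lemma Ad_mem:
  assumes M: "M \<in> form_group J" and X: "X \<in> form_algebra J"
  shows "Ad M X \<in> form_algebra J"
proof -
  let ?N = "matrix_inv M"
  have N: "transpose ?N ** J ** ?N = J" using inv_mem[OF M] by (simp add: form_group_def)
  have JM: "J ** M = transpose ?N ** J"
  proof -
    have "J ** M = (transpose ?N ** J ** ?N) ** M" by (simp add: N)
    then show ?thesis using inv_eq[OF M] by (simp add: matrix_mul_assoc[symmetric])
  qed
  have MJ: "transpose M ** J = J ** ?N"
  proof -
    have "transpose M ** J = transpose M ** (transpose ?N ** J ** ?N)" by (simp add: N)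
    also have "\<dots> = transpose (?N ** M) ** J ** ?N" by (simp add: matrix_transpose_mul matrix_mul_assoc)
    finally show ?thesis using inv_eq[OF M] by simp
  qed
  have "transpose (Ad M X) ** J + J ** Ad M X
      = transpose ?N ** transpose X ** (transpose M ** J) + (J ** M) ** X ** ?N"
    by (simp add: Ad_def matrix_transpose_mul matrix_mul_assoc)
  also have "\<dots> = transpose ?N ** (transpose X ** J + J ** X) ** ?N"
    unfolding JM MJ by (simp add: matmul.add_left matmul.add_right matrix_mul_assoc)
  finally show ?thesis using X by (simp add: form_algebra_def)
qed

lemma bracket_mem:
  assumes "X \<in> form_algebra J" "Y \<in> form_algebra J"
  shows "bracket X Y \<in> form_algebra J"
proof -
  have x: "transpose X ** J = - (J ** X)" and y: "transpose Y ** J = - (J ** Y)"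
    using assms by (simp_all add: form_algebra_def eq_neg_iff_add_eq_0)
  have t: "transpose (bracket X Y) = transpose Y ** transpose X - transpose X ** transpose Y"
    by (simp add: bracket_def matrix_transpose_mul[symmetric]) (simp add: transpose_def vec_eq_iff)
  have "transpose (bracket X Y) ** J = transpose Y ** (transpose X ** J) - transpose X ** (transpose Y ** J)"
    by (simp add: t matmul.diff_left matrix_mul_assoc)
  also have "\<dots> = (transpose X ** J) ** Y - (transpose Y ** J) ** X"
    unfolding x y matmul.minus_right matrix_mul_assoc unfolding x y by simp
  also have "\<dots> = - (J ** bracket X Y)"
    unfolding x y by (simp add: bracket_def matmul.minus_left matmul.diff_right matrix_mul_assoc)
  finally show ?thesis by (simp add: form_algebra_def)
qed

lemma add_mem: "X \<in> form_algebra J \<Longrightarrow> Y \<in> form_algebra J \<Longrightarrow> X + Y \<in> form_algebra J"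
proof -
  have "transpose (X + Y) = transpose X + transpose Y" by (simp add: transpose_def vec_eq_iff)
  then show "X \<in> form_algebra J \<Longrightarrow> Y \<in> form_algebra J \<Longrightarrow> X + Y \<in> form_algebra J"
    by (simp add: form_algebra_def matmul.add_left matmul.add_right eq_neg_iff_add_eq_0[symmetric])
qed

lemma scaleR_mem: "X \<in> form_algebra J \<Longrightarrow> t *\<^sub>R X \<in> form_algebra J"
  by (simp add: form_algebra_def transpose_scalar matmul.scaleR_left matmul.scaleR_right scaleR_add_right[symmetric])

lemma subspace_algebra: "subspace (form_algebra J)"
proof (rule subspaceI)
  show "0 \<in> form_algebra J"
    by (simp add: form_algebra_def transpose_def matrix_matrix_mult_def vec_eq_iff)
qed (fact add_mem scaleR_mem)+

text \<open>Differentiate the equation \<open>M\<^sup>T J M = J\<close> along the curve.\<close>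

lemma velocity_mem:
  assumes ev: "\<forall>\<^sub>F t in nhds (0::real). \<gamma> t \<in> form_group J"
    and d: "(\<gamma> has_vector_derivative \<gamma>') (at 0)"
  shows "matrix_inv (\<gamma> 0) ** \<gamma>' \<in> form_algebra J"
proof -
  let ?g = "\<gamma> 0"
  have g: "?g \<in> form_group J" using eventually_nhds_x_imp_x[OF ev] .
  have bl: "bounded_linear (transpose :: real^'m^'m \<Rightarrow> _)"
    by (auto intro!: linear_conv_bounded_linear[THEN iffD1] linearI simp: transpose_def vec_eq_iff)
  have dt: "((\<lambda>t. transpose (\<gamma> t)) has_vector_derivative transpose \<gamma>') (at 0)"
    using bounded_linear.has_vector_derivative[OF bl d] .
  have dJ: "((\<lambda>t. transpose (\<gamma> t) ** J) has_vector_derivative transpose \<gamma>' ** J) (at 0)"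
    using bounded_linear.has_vector_derivative[OF matmul.bounded_linear_left dt] .
  have d1: "((\<lambda>t. transpose (\<gamma> t) ** J ** \<gamma> t) has_vector_derivative
      (transpose ?g ** J ** \<gamma>' + transpose \<gamma>' ** J ** ?g)) (at 0)"
    using matmul.has_vector_derivative[OF dJ d] .
  have "((\<lambda>t. J) has_vector_derivative (transpose ?g ** J ** \<gamma>' + transpose \<gamma>' ** J ** ?g)) (at 0)"
  proof (subst has_vector_derivative_cong_ev)
    show "\<forall>\<^sub>F t in nhds 0. t \<in> UNIV \<longrightarrow> J = transpose (\<gamma> t) ** J ** \<gamma> t"
      using ev by eventually_elim (simp add: form_group_def)
    show "J = transpose ?g ** J ** ?g" using g by (simp add: form_group_def)
  qed (fact d1)
  then have eq: "transpose ?g ** J ** \<gamma>' + transpose \<gamma>' ** J ** ?g = 0"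
    by (rule vector_derivative_unique_at[OF _ has_vector_derivative_const])
  let ?X = "matrix_inv ?g ** \<gamma>'"
  have "?g ** ?X = \<gamma>'" using inv_eq[OF g] by (simp add: matrix_mul_assoc)
  have "(transpose ?g ** J ** ?g) ** ?X + transpose ?X ** (transpose ?g ** J ** ?g)
    = transpose ?g ** J ** (?g ** ?X) + transpose (?g ** ?X) ** J ** ?g"
    by (simp only: matrix_transpose_mul matrix_mul_assoc)
  also have "\<dots> = 0" using eq \<open>?g ** ?X = \<gamma>'\<close> by simp
  finally have "(transpose ?g ** J ** ?g) ** ?X + transpose ?X ** (transpose ?g ** J ** ?g) = 0" .
  then show ?thesis using g by (simp add: form_group_def form_algebra_def add.commute)
qed

end

section \<open>Block matrices\<close>

lemma all_lix: "(\<forall>r :: 'n lix. P r) \<longleftrightarrow>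
    P (Inl ()) \<and> (\<forall>i. P (Inr (Inl i))) \<and> (\<forall>i. P (Inr (Inr (Inl i)))) \<and> P (Inr (Inr (Inr ())))"
  by (auto simp: split_sum_all)

lemma all_gix: "(\<forall>r :: 'n gix. P r) \<longleftrightarrow> P (Inl ()) \<and> P (Inr (Inl ())) \<and> (\<forall>i. P (Inr (Inr i)))"
  by (auto simp: split_sum_all)

lemma sum_UNIV_sum:
  "(\<Sum>r\<in>(UNIV :: ('a::finite + 'b::finite) set). f r) = (\<Sum>i\<in>UNIV. f (Inl i)) + (\<Sum>j\<in>UNIV. f (Inr j))"
  unfolding UNIV_Plus_UNIV[symmetric] by (subst sum.Plus) auto

lemma sum_lix: "(\<Sum>r\<in>(UNIV :: 'n::finite lix set). f r) =
    f (Inl ()) + (\<Sum>i\<in>UNIV. f (Inr (Inl i))) + (\<Sum>i\<in>UNIV. f (Inr (Inr (Inl i)))) + f (Inr (Inr (Inr ())))"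
  by (simp add: sum_UNIV_sum UNIV_unit add.assoc)

lemma sum_gix: "(\<Sum>r\<in>(UNIV :: 'n::finite gix set). f r) =
    f (Inl ()) + f (Inr (Inl ())) + (\<Sum>i\<in>UNIV. f (Inr (Inr i)))"
  by (simp add: sum_UNIV_sum UNIV_unit add.assoc)

lemma l_block_nth [simp]:
  fixes r01 :: "real^'n" and m00 r02 m03 v10 A11 A12 v13 v20 A21 A22 v23 m30 r31 r32 m33
  defines "M \<equiv> l_block m00 r01 r02 m03 v10 A11 A12 v13 v20 A21 A22 v23 m30 r31 r32 m33"
  shows "M $ Inl u $ Inl u' = m00" "M $ Inl u $ Inr (Inl j) = r01 $ j"
    "M $ Inl u $ Inr (Inr (Inl j)) = r02 $ j" "M $ Inl u $ Inr (Inr (Inr u')) = m03"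
    "M $ Inr (Inl i) $ Inl u' = v10 $ i" "M $ Inr (Inl i) $ Inr (Inl j) = A11 $ i $ j"
    "M $ Inr (Inl i) $ Inr (Inr (Inl j)) = A12 $ i $ j" "M $ Inr (Inl i) $ Inr (Inr (Inr u')) = v13 $ i"
    "M $ Inr (Inr (Inl i)) $ Inl u' = v20 $ i" "M $ Inr (Inr (Inl i)) $ Inr (Inl j) = A21 $ i $ j"
    "M $ Inr (Inr (Inl i)) $ Inr (Inr (Inl j)) = A22 $ i $ j"
    "M $ Inr (Inr (Inl i)) $ Inr (Inr (Inr u')) = v23 $ i"
    "M $ Inr (Inr (Inr u)) $ Inl u' = m30" "M $ Inr (Inr (Inr u)) $ Inr (Inl j) = r31 $ j"
    "M $ Inr (Inr (Inr u)) $ Inr (Inr (Inl j)) = r32 $ j" "M $ Inr (Inr (Inr u)) $ Inr (Inr (Inr u')) = m33"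
  by (simp_all add: M_def l_block_def)

lemma g_block_nth [simp]:
  fixes r02 :: "real^'n" and m00 m01 m10 m11 r12 v20 v21 A22
  defines "M \<equiv> g_block m00 m01 r02 m10 m11 r12 v20 v21 A22"
  shows "M $ Inl u $ Inl u' = m00" "M $ Inl u $ Inr (Inl u') = m01" "M $ Inl u $ Inr (Inr j) = r02 $ j"
    "M $ Inr (Inl u) $ Inl u' = m10" "M $ Inr (Inl u) $ Inr (Inl u') = m11"
    "M $ Inr (Inl u) $ Inr (Inr j) = r12 $ j" "M $ Inr (Inr i) $ Inl u' = v20 $ i"
    "M $ Inr (Inr i) $ Inr (Inl u') = v21 $ i" "M $ Inr (Inr i) $ Inr (Inr j) = A22 $ i $ j"
  by (simp_all add: M_def g_block_def)

lemma lmat_eq_iff: "(M :: 'n::finite lmat) = N \<longleftrightarrow> (\<forall>r s. M $ r $ s = N $ r $ s)"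
  by (simp add: vec_eq_iff)

lemma gmat_eq_iff: "(M :: 'n::finite gmat) = N \<longleftrightarrow> (\<forall>r s. M $ r $ s = N $ r $ s)"
  by (simp add: vec_eq_iff)

lemma l_block_exhaust:
  fixes M :: "'n::finite lmat"
  obtains m00 r01 r02 m03 v10 A11 A12 v13 v20 A21 A22 v23 m30 r31 r32 m33
  where "M = l_block m00 r01 r02 m03 v10 A11 A12 v13 v20 A21 A22 v23 m30 r31 r32 m33"
proof
  let ?a = "Inl () :: 'n lix" and ?b = "\<lambda>i. Inr (Inl i) :: 'n lix" and ?c = "\<lambda>i. Inr (Inr (Inl i)) :: 'n lix"
    and ?d = "Inr (Inr (Inr ())) :: 'n lix"
  show "M = l_block (M $ ?a $ ?a) (\<chi> j. M $ ?a $ ?b j) (\<chi> j. M $ ?a $ ?c j) (M $ ?a $ ?d)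
    (\<chi> i. M $ ?b i $ ?a) (\<chi> i j. M $ ?b i $ ?b j) (\<chi> i j. M $ ?b i $ ?c j) (\<chi> i. M $ ?b i $ ?d)
    (\<chi> i. M $ ?c i $ ?a) (\<chi> i j. M $ ?c i $ ?b j) (\<chi> i j. M $ ?c i $ ?c j) (\<chi> i. M $ ?c i $ ?d)
    (M $ ?d $ ?a) (\<chi> j. M $ ?d $ ?b j) (\<chi> j. M $ ?d $ ?c j) (M $ ?d $ ?d)"
    unfolding lmat_eq_iff by (simp add: all_lix)
qed

lemma g_block_exhaust:
  fixes M :: "'n::finite gmat"
  obtains m00 m01 r02 m10 m11 r12 v20 v21 A22
  where "M = g_block m00 m01 r02 m10 m11 r12 v20 v21 A22"
proof
  let ?a = "Inl () :: 'n gix" and ?b = "Inr (Inl ()) :: 'n gix" and ?c = "\<lambda>i. Inr (Inr i) :: 'n gix"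
  show "M = g_block (M $ ?a $ ?a) (M $ ?a $ ?b) (\<chi> j. M $ ?a $ ?c j)
    (M $ ?b $ ?a) (M $ ?b $ ?b) (\<chi> j. M $ ?b $ ?c j)
    (\<chi> i. M $ ?c i $ ?a) (\<chi> i. M $ ?c i $ ?b) (\<chi> i j. M $ ?c i $ ?c j)"
    unfolding gmat_eq_iff by (simp add: all_gix)
qed

lemma l_block_eq_iff:
  "l_block m00 r01 r02 m03 v10 A11 A12 v13 v20 A21 A22 v23 m30 r31 r32 m33 =
   l_block n00 s01 s02 n03 w10 B11 B12 w13 w20 B21 B22 w23 n30 s31 s32 n33 \<longleftrightarrow>
   m00 = n00 \<and> r01 = s01 \<and> r02 = s02 \<and> m03 = n03 \<and> v10 = w10 \<and> A11 = B11 \<and> A12 = B12 \<and> v13 = w13 \<and>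
   v20 = w20 \<and> A21 = B21 \<and> A22 = B22 \<and> v23 = w23 \<and> m30 = n30 \<and> r31 = s31 \<and> r32 = s32 \<and> m33 = n33"
  unfolding lmat_eq_iff by (simp add: all_lix) (auto simp: vec_eq_iff)

lemma g_block_eq_iff:
  "g_block m00 m01 r02 m10 m11 r12 v20 v21 A22 = g_block n00 n01 s02 n10 n11 s12 w20 w21 B22 \<longleftrightarrow>
   m00 = n00 \<and> m01 = n01 \<and> r02 = s02 \<and> m10 = n10 \<and> m11 = n11 \<and> r12 = s12 \<and> v20 = w20 \<and> v21 = w21 \<and> A22 = B22"
  unfolding gmat_eq_iff by (simp add: all_gix) (auto simp: vec_eq_iff)

lemma l_block_mult:
  fixes r01 :: "real^'n"
  shows "l_block m00 r01 r02 m03 v10 A11 A12 v13 v20 A21 A22 v23 m30 r31 r32 m33 **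
   l_block n00 s01 s02 n03 w10 B11 B12 w13 w20 B21 B22 w23 n30 s31 s32 n33 =
   l_block
     (m00 * n00 + r01 \<bullet> w10 + r02 \<bullet> w20 + m03 * n30)
     (m00 *\<^sub>R s01 + r01 v* B11 + r02 v* B21 + m03 *\<^sub>R s31)
     (m00 *\<^sub>R s02 + r01 v* B12 + r02 v* B22 + m03 *\<^sub>R s32)
     (m00 * n03 + r01 \<bullet> w13 + r02 \<bullet> w23 + m03 * n33)
     (n00 *\<^sub>R v10 + A11 *v w10 + A12 *v w20 + n30 *\<^sub>R v13)
     (outer v10 s01 + A11 ** B11 + A12 ** B21 + outer v13 s31)
     (outer v10 s02 + A11 ** B12 + A12 ** B22 + outer v13 s32)
     (n03 *\<^sub>R v10 + A11 *v w13 + A12 *v w23 + n33 *\<^sub>R v13)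
     (n00 *\<^sub>R v20 + A21 *v w10 + A22 *v w20 + n30 *\<^sub>R v23)
     (outer v20 s01 + A21 ** B11 + A22 ** B21 + outer v23 s31)
     (outer v20 s02 + A21 ** B12 + A22 ** B22 + outer v23 s32)
     (n03 *\<^sub>R v20 + A21 *v w13 + A22 *v w23 + n33 *\<^sub>R v23)
     (m30 * n00 + r31 \<bullet> w10 + r32 \<bullet> w20 + m33 * n30)
     (m30 *\<^sub>R s01 + r31 v* B11 + r32 v* B21 + m33 *\<^sub>R s31)
     (m30 *\<^sub>R s02 + r31 v* B12 + r32 v* B22 + m33 *\<^sub>R s32)
     (m30 * n03 + r31 \<bullet> w13 + r32 \<bullet> w23 + m33 * n33)"
  unfolding lmat_eq_iff
  by (simp add: all_lix matrix_matrix_mult_def sum_lix outer_def matrix_vector_mult_def vector_matrix_mult_def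
      inner_vec_def mult.commute add.assoc)

lemma g_block_mult:
  fixes r02 :: "real^'n"
  shows "g_block m00 m01 r02 m10 m11 r12 v20 v21 A22 ** g_block n00 n01 s02 n10 n11 s12 w20 w21 B22 =
   g_block
     (m00 * n00 + m01 * n10 + r02 \<bullet> w20) (m00 * n01 + m01 * n11 + r02 \<bullet> w21)
     (m00 *\<^sub>R s02 + m01 *\<^sub>R s12 + r02 v* B22)
     (m10 * n00 + m11 * n10 + r12 \<bullet> w20) (m10 * n01 + m11 * n11 + r12 \<bullet> w21)
     (m10 *\<^sub>R s02 + m11 *\<^sub>R s12 + r12 v* B22)
     (n00 *\<^sub>R v20 + n10 *\<^sub>R v21 + A22 *v w20) (n01 *\<^sub>R v20 + n11 *\<^sub>R v21 + A22 *v w21)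
     (outer v20 s02 + outer v21 s12 + A22 ** B22)"
  unfolding gmat_eq_iff
  by (simp add: all_gix matrix_matrix_mult_def sum_gix outer_def matrix_vector_mult_def vector_matrix_mult_def
      inner_vec_def mult.commute add.assoc)

lemma l_block_add:
  "l_block m00 r01 r02 m03 v10 A11 A12 v13 v20 A21 A22 v23 m30 r31 r32 m33 +
   l_block n00 s01 s02 n03 w10 B11 B12 w13 w20 B21 B22 w23 n30 s31 s32 n33 =
   l_block (m00 + n00) (r01 + s01) (r02 + s02) (m03 + n03) (v10 + w10) (A11 + B11) (A12 + B12) (v13 + w13)
     (v20 + w20) (A21 + B21) (A22 + B22) (v23 + w23) (m30 + n30) (r31 + s31) (r32 + s32) (m33 + n33)"
  unfolding lmat_eq_iff by (simp add: all_lix)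

lemma l_block_diff:
  "l_block m00 r01 r02 m03 v10 A11 A12 v13 v20 A21 A22 v23 m30 r31 r32 m33 -
   l_block n00 s01 s02 n03 w10 B11 B12 w13 w20 B21 B22 w23 n30 s31 s32 n33 =
   l_block (m00 - n00) (r01 - s01) (r02 - s02) (m03 - n03) (v10 - w10) (A11 - B11) (A12 - B12) (v13 - w13)
     (v20 - w20) (A21 - B21) (A22 - B22) (v23 - w23) (m30 - n30) (r31 - s31) (r32 - s32) (m33 - n33)"
  unfolding lmat_eq_iff by (simp add: all_lix)

lemma l_block_scaleR:
  "t *\<^sub>R l_block m00 r01 r02 m03 v10 A11 A12 v13 v20 A21 A22 v23 m30 r31 r32 m33 =
   l_block (t * m00) (t *\<^sub>R r01) (t *\<^sub>R r02) (t * m03) (t *\<^sub>R v10) (t *\<^sub>R A11) (t *\<^sub>R A12) (t *\<^sub>R v13)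
     (t *\<^sub>R v20) (t *\<^sub>R A21) (t *\<^sub>R A22) (t *\<^sub>R v23) (t * m30) (t *\<^sub>R r31) (t *\<^sub>R r32) (t * m33)"
  unfolding lmat_eq_iff by (simp add: all_lix)

lemma l_block_transpose:
  "transpose (l_block m00 r01 r02 m03 v10 A11 A12 v13 v20 A21 A22 v23 m30 r31 r32 m33) =
   l_block m00 v10 v20 m30 r01 (transpose A11) (transpose A21) r31
     r02 (transpose A12) (transpose A22) r32 m03 v13 v23 m33"
  unfolding lmat_eq_iff by (simp add: all_lix transpose_def)

lemma g_block_transpose:
  "transpose (g_block m00 m01 r02 m10 m11 r12 v20 v21 A22) =
   g_block m00 m10 v20 m01 m11 v21 r02 r12 (transpose A22)"
  unfolding gmat_eq_iff by (simp add: all_gix transpose_def)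

lemma g_block_diff:
  "g_block m00 m01 r02 m10 m11 r12 v20 v21 A22 - g_block n00 n01 s02 n10 n11 s12 w20 w21 B22 =
   g_block (m00 - n00) (m01 - n01) (r02 - s02) (m10 - n10) (m11 - n11) (r12 - s12) (v20 - w20) (v21 - w21) (A22 - B22)"
  unfolding gmat_eq_iff by (simp add: all_gix)

lemma g_block_add:
  "g_block m00 m01 r02 m10 m11 r12 v20 v21 A22 + g_block n00 n01 s02 n10 n11 s12 w20 w21 B22 =
   g_block (m00 + n00) (m01 + n01) (r02 + s02) (m10 + n10) (m11 + n11) (r12 + s12) (v20 + w20) (v21 + w21) (A22 + B22)"
  unfolding gmat_eq_iff by (simp add: all_gix)

lemma l_block_one: "mat 1 = l_block 1 0 0 0 0 (mat 1) 0 0 0 0 (mat 1) 0 0 0 0 1"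
  unfolding lmat_eq_iff by (simp add: all_lix mat_def)

lemma g_block_one: "mat 1 = g_block 1 0 0 0 1 0 0 0 (mat 1)"
  unfolding gmat_eq_iff by (simp add: all_gix mat_def)

lemma l_block_zero: "0 = l_block 0 0 0 0 0 0 0 0 0 0 0 0 0 0 0 0"
  unfolding lmat_eq_iff by (simp add: all_lix)

lemma g_block_zero: "0 = g_block 0 0 0 0 0 0 0 0 0"
  unfolding gmat_eq_iff by (simp add: all_gix)

section \<open>The symplectic Lie algebra\<close>

text \<open>The ten independent blocks of a matrix in \<open>sp(2n+2,\<real>)\<close>: the grading component \<open>d\<close>, the blocks
\<open>u, v\<close> of degree 1, \<open>e\<close> of degree 2, \<open>x, y\<close> of degree -1, \<open>f\<close> of degree -2, and the part
\<open>A, B, C\<close> in \<open>sp(2n,\<real>)\<close>, where \<open>B\<close> and \<open>C\<close> have to be symmetric.\<close>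

definition l_elt :: "real \<Rightarrow> real^'n \<Rightarrow> real^'n \<Rightarrow> real \<Rightarrow> real^'n \<Rightarrow> real^'n \<Rightarrow>
    real^'n^'n \<Rightarrow> real^'n^'n \<Rightarrow> real^'n^'n \<Rightarrow> real \<Rightarrow> 'n lmat" where
  "l_elt d u v e x y A B C f =
     l_block d  u   v                e
             x  A   B                v
             y  C   (- transpose A)  (- u)
             f  y   (- x)            (- d)"

lemma l_elt_eq_iff:
  "l_elt d u v e x y A B C f = l_elt d' u' v' e' x' y' A' B' C' f' \<longleftrightarrow>
   d = d' \<and> u = u' \<and> v = v' \<and> e = e' \<and> x = x' \<and> y = y' \<and> A = A' \<and> B = B' \<and> C = C' \<and> f = f'"
  by (auto simp: l_elt_def l_block_eq_iff)

lemma transpose_arith: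
  fixes A B :: "real^'n^'m"
  shows "transpose (A + B) = transpose A + transpose B" "transpose (A - B) = transpose A - transpose B"
    "transpose (- A) = - transpose A"
  by (simp_all add: transpose_def vec_eq_iff)

lemma transpose_zero: "transpose (0 :: real^'n^'m) = 0"
  by (simp add: transpose_def vec_eq_iff)

lemma l_elt_add:
  "l_elt d u v e x y A B C f + l_elt d' u' v' e' x' y' A' B' C' f' =
   l_elt (d + d') (u + u') (v + v') (e + e') (x + x') (y + y') (A + A') (B + B') (C + C') (f + f')"
  by (simp add: l_elt_def l_block_add l_block_eq_iff transpose_arith)

lemma l_elt_diff:
  "l_elt d u v e x y A B C f - l_elt d' u' v' e' x' y' A' B' C' f' =
   l_elt (d - d') (u - u') (v - v') (e - e') (x - x') (y - y') (A - A') (B - B') (C - C') (f - f')"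
  by (simp add: l_elt_def l_block_diff l_block_eq_iff transpose_arith)

lemma l_elt_scaleR:
  "t *\<^sub>R l_elt d u v e x y A B C f =
   l_elt (t * d) (t *\<^sub>R u) (t *\<^sub>R v) (t * e) (t *\<^sub>R x) (t *\<^sub>R y) (t *\<^sub>R A) (t *\<^sub>R B) (t *\<^sub>R C) (t * f)"
  by (simp add: l_elt_def l_block_scaleR l_block_eq_iff transpose_scalar)

lemma l_elt_zero: "0 = l_elt 0 0 0 0 0 0 0 0 0 0"
  by (simp add: l_elt_def l_block_zero l_block_eq_iff transpose_zero)

lemma outer_transpose: "transpose (outer u v) = outer v u"
  by (simp add: outer_def transpose_def vec_eq_iff mult.commute)

lemma outer_arith:
  "outer (- u) v = - outer u v" "outer u (- v) = - outer u v"
  "outer (u + u') v = outer u v + outer u' v" "outer u (v + v') = outer u v + outer u v'"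
  "outer (u - u') v = outer u v - outer u' v" "outer u (v - v') = outer u v - outer u v'"
  "outer (t *\<^sub>R u) v = t *\<^sub>R outer u v" "outer u (t *\<^sub>R v) = t *\<^sub>R outer u v" "outer 0 v = 0" "outer u 0 = 0"
  by (simp_all add: outer_def vec_eq_iff algebra_simps)

lemma matrix_vector_arith:
  fixes A :: "real^'n^'m" and k :: real
  shows "(- A) *v x = - (A *v x)" "A *v (- x) = - (A *v x)" "y v* (- A) = - (y v* A)" "(- y) v* A = - (y v* A)"
    "(k *\<^sub>R A) *v x = k *\<^sub>R (A *v x)" "A *v (k *\<^sub>R x) = k *\<^sub>R (A *v x)"
    "y v* (k *\<^sub>R A) = k *\<^sub>R (y v* A)" "(k *\<^sub>R y) v* A = k *\<^sub>R (y v* A)"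
    "y v* (A + B) = y v* A + y v* B" "y v* (A - B) = y v* A - y v* B"
    "(y + z) v* A = y v* A + z v* A" "(y - z) v* A = y v* A - z v* A"
    "(A + B) *v x = A *v x + B *v x" "(A - B) *v x = A *v x - B *v x"
    "A *v (x + w) = A *v x + A *v w" "A *v (x - w) = A *v x - A *v w"
  by (simp_all add: vec_eq_iff matrix_vector_mult_def vector_matrix_mult_def sum_negf sum_distrib_left
      sum.distrib sum_subtractf algebra_simps)

lemma mem_l_alg_l_block_iff:
  "l_block m00 r01 r02 m03 v10 A11 A12 v13 v20 A21 A22 v23 m30 r31 r32 m33 \<in> l_alg \<longleftrightarrow>
   transpose A12 = A12 \<and> transpose A21 = A21 \<and>
   l_block m00 r01 r02 m03 v10 A11 A12 v13 v20 A21 A22 v23 m30 r31 r32 m33 =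
   l_elt m00 r01 r02 m03 v10 v20 A11 A12 A21 m30" (is "?M \<in> _ \<longleftrightarrow> ?r")
proof -
  have sym: "A21 = transpose A21 \<longleftrightarrow> transpose A21 = A21" by (rule eq_commute)
  show ?thesis
    unfolding l_alg_def form_algebra_def symp_form_def l_elt_def
    by (simp add: l_block_transpose l_block_mult l_block_add l_block_zero l_block_eq_iff matmul.minus_left
        matmul.minus_right matrix_vector_arith matmul.zero_left matmul.zero_right outer_arith add_eq_0_iff)
      (simp only: sym, auto simp: transpose_arith)
qed

text \<open>The symmetry of \<open>B, C, B', C'\<close> makes the lower right blocks of the commutator agree with those that
\<open>l_elt\<close> prescribes. The curvature and the codifferential are computed with this formula.\<close>

lemma bracket_l_elt:
  assumes "transpose B = B" "transpose C = C" "transpose B' = B'" "transpose C' = C'"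
  shows "bracket (l_elt d u v e x y A B C f) (l_elt d' u' v' e' x' y' A' B' C' f') =
   l_elt
    (u \<bullet> x' + v \<bullet> y' + e * f' - u' \<bullet> x - v' \<bullet> y - e' * f)
    (d *\<^sub>R u' + u v* A' + v v* C' + e *\<^sub>R y' - d' *\<^sub>R u - u' v* A - v' v* C - e' *\<^sub>R y)
    (d *\<^sub>R v' + u v* B' - A' *v v - e *\<^sub>R x' - d' *\<^sub>R v - u' v* B + A *v v' + e' *\<^sub>R x)
    (2 * (d * e' - e * d' + u \<bullet> v' - v \<bullet> u'))
    (d' *\<^sub>R x + A *v x' + B *v y' + f' *\<^sub>R v - d *\<^sub>R x' - A' *v x - B' *v y - f *\<^sub>R v')
    (d' *\<^sub>R y + C *v x' - y' v* A - f' *\<^sub>R u - d *\<^sub>R y' - C' *v x + y v* A' + f *\<^sub>R u')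
    (outer x u' + A ** A' + B ** C' + outer v y' - outer x' u - A' ** A - B' ** C - outer v' y)
    (outer x v' + A ** B' - B ** transpose A' - outer v x' - outer x' v - A' ** B + B' ** transpose A + outer v' x)
    (outer y u' + C ** A' - transpose A ** C' - outer u y' - outer y' u - C' ** A + transpose A' ** C + outer u' y)
    (2 * (f * d' - d * f' + y \<bullet> x' - x \<bullet> y'))"
proof -
  have B: "x v* B = B *v x" "x v* C = C *v x" "x v* B' = B' *v x" "x v* C' = C' *v x" for x
    by (metis assms transpose_matrix_vector)+
  show ?thesis
    unfolding l_elt_def bracket_def l_block_mult l_block_diff l_block_eq_iff
    by (simp add: matmul.minus_left
      matmul.minus_right matrix_vector_arith matmul.zero_left matmul.zero_right outer_arith transpose_arith
     matrix_transpose_mul assms outer_transpose B inner_commute algebra_simps)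
qed

lemma l_elt_mem_iff: "l_elt d u v e x y A B C f \<in> l_alg \<longleftrightarrow> transpose B = B \<and> transpose C = C"
  unfolding l_elt_def mem_l_alg_l_block_iff by simp

lemma l_algE:
  assumes "M \<in> l_alg"
  obtains d u v e x y A B C f where "M = l_elt d u v e x y A B C f" "transpose B = B" "transpose C = C"
  using assms by (cases M rule: l_block_exhaust) (metis mem_l_alg_l_block_iff)

text \<open>The symplectic form has matrix square \<open>-1\<close>, which provides its inverse.\<close>

interpretation symp: form "symp_form :: 'n::finite lmat" "- symp_form"
  by unfold_locales (simp add: symp_form_def l_block_mult l_block_one matmul.minus_left matmul.minus_right
      matmul.zero_left matmul.zero_right outer_arith l_block_eq_iff
      l_block_scaleR[where t = "-1", simplified])

lemma subspace_l_alg: "subspace (l_alg :: 'n::finite lmat set)"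
  unfolding l_alg_def by (rule symp.subspace_algebra)

lemma bracket_l_alg: "X \<in> l_alg \<Longrightarrow> Y \<in> l_alg \<Longrightarrow> bracket X Y \<in> l_alg"
  unfolding l_alg_def by (rule symp.bracket_mem)

section \<open>The contact grading\<close>

lemma block_pos_simps [simp]:
  "block_pos (Inl u) = 0" "block_pos (Inr (Inl i)) = 1" "block_pos (Inr (Inr (Inl i))) = 1"
  "block_pos (Inr (Inr (Inr u))) = 2"
  by (simp_all add: block_pos_def)

lemma l_elt_mem_p_iff:
  "l_elt d u v e x y A B C f \<in> p_alg \<longleftrightarrow> transpose B = B \<and> transpose C = C \<and> x = 0 \<and> y = 0 \<and> f = 0"
  unfolding l_filt_def mem_Collect_eq l_elt_mem_iff by (auto simp: l_elt_def all_lix vec_eq_iff)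

lemma l_elt_mem_filt_1_iff:
  "l_elt d u v e x y A B C f \<in> l_filt 1 \<longleftrightarrow> d = 0 \<and> x = 0 \<and> y = 0 \<and> A = 0 \<and> B = 0 \<and> C = 0 \<and> f = 0"
  unfolding l_filt_def mem_Collect_eq l_elt_mem_iff
  by (auto simp: l_elt_def all_lix vec_eq_iff transpose_def)

lemma l_elt_mem_deg_0_iff:
  "l_elt d u v e x y A B C f \<in> l_deg 0 \<longleftrightarrow>
     transpose B = B \<and> transpose C = C \<and> u = 0 \<and> v = 0 \<and> e = 0 \<and> x = 0 \<and> y = 0 \<and> f = 0"
  unfolding l_deg_def mem_Collect_eq l_elt_mem_iff by (auto simp: l_elt_def all_lix vec_eq_iff)

lemma l_deg_filt: "k \<le> l \<Longrightarrow> l_deg l \<subseteq> l_filt k"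
  by (auto simp: l_deg_def l_filt_def)

lemma subspace_l_filt: "subspace (l_filt k :: 'n::finite lmat set)"
proof (rule subspaceI)
  fix X Y :: "'n lmat" and t
  show "0 \<in> (l_filt k :: 'n lmat set)" by (simp add: l_filt_def subspace_0[OF subspace_l_alg])
  show "X \<in> l_filt k \<Longrightarrow> t *\<^sub>R X \<in> l_filt k"
    by (simp add: l_filt_def subspace_scale[OF subspace_l_alg])
  show "X \<in> l_filt k \<Longrightarrow> Y \<in> l_filt k \<Longrightarrow> X + Y \<in> l_filt k"
  proof -
    assume X: "X \<in> l_filt k" and Y: "Y \<in> l_filt k"
    then have "X + Y \<in> l_alg" by (simp add: l_filt_def subspace_add[OF subspace_l_alg])
    moreover have "X $ r $ s \<noteq> 0 \<or> Y $ r $ s \<noteq> 0" if "(X + Y) $ r $ s \<noteq> 0" for r s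
      using that by auto
    ultimately show "X + Y \<in> l_filt k" using X Y unfolding l_filt_def by blast
  qed
qed

lemma block_degree_mult:
  fixes M N :: "'n::finite lmat"
  assumes "\<And>r s. M $ r $ s \<noteq> 0 \<Longrightarrow> block_pos s - block_pos r \<ge> k"
    and "\<And>r s. N $ r $ s \<noteq> 0 \<Longrightarrow> block_pos s - block_pos r \<ge> l"
    and "(M ** N) $ r $ s \<noteq> 0"
  shows "block_pos s - block_pos r \<ge> k + l"
proof -
  obtain a where "M $ r $ a * N $ a $ s \<noteq> 0"
    using assms(3) unfolding matrix_matrix_mult_def by (auto elim: sum.not_neutral_contains_not_neutral)
  then have "M $ r $ a \<noteq> 0" "N $ a $ s \<noteq> 0" by auto
  with assms(1,2) show ?thesis by force
qed

lemma P_lift_degree: "N \<in> P_lift \<Longrightarrow> N $ r $ s \<noteq> 0 \<Longrightarrow> block_pos s - block_pos r \<ge> 0"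
  unfolding P_lift_def by force

lemma P_liftI:
  "N \<in> form_group symp_form \<Longrightarrow> (\<And>r s. N $ r $ s \<noteq> 0 \<Longrightarrow> block_pos s - block_pos r \<ge> 0) \<Longrightarrow> N \<in> P_lift"
  unfolding P_lift_def by force

lemma P_lift_mult:
  assumes "M \<in> P_lift" "N \<in> P_lift"
  shows "M ** N \<in> P_lift"
proof (rule P_liftI)
  show "M ** N \<in> form_group symp_form" using assms by (intro symp.mult_mem) (auto simp: P_lift_def)
  show "block_pos s - block_pos r \<ge> 0" if "(M ** N) $ r $ s \<noteq> 0" for r s
    using block_degree_mult[of M 0 N 0 r s] P_lift_degree assms that by fastforce
qed

lemma Ad_filt:
  assumes N: "N \<in> P_lift" "matrix_inv N \<in> P_lift" and X: "X \<in> l_filt k"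
  shows "Ad N X \<in> l_filt k"
proof -
  have "Ad N X \<in> l_alg"
    using N X unfolding l_alg_def by (intro symp.Ad_mem) (auto simp: P_lift_def l_filt_def l_alg_def)
  moreover have "block_pos s - block_pos r \<ge> k" if "Ad N X $ r $ s \<noteq> 0" for r s
  proof -
    have "block_pos s - block_pos r \<ge> k" if "(N ** X) $ r $ s \<noteq> 0" for r s
      using block_degree_mult[of N 0 X k r s] P_lift_degree[OF N(1)] X that by (auto simp: l_filt_def)
    then show ?thesis
      using block_degree_mult[of "N ** X" k "matrix_inv N" 0 r s] P_lift_degree[OF N(2)] that by (auto simp: Ad_def)
  qed
  ultimately show ?thesis by (simp add: l_filt_def)
qed

section \<open>Dual bases\<close>

lemma trace_l_block:
  "trace (l_block m00 r01 r02 m03 v10 A11 A12 v13 v20 A21 A22 v23 m30 r31 r32 m33) =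
     m00 + trace A11 + trace A22 + m33"
  by (simp add: trace_def sum_lix)

lemma trace_outer: "trace (outer u v) = u \<bullet> v"
  by (simp add: trace_def outer_def inner_vec_def)

text \<open>The trace form pairs \<open>\<ll>\<^sub>1 + \<ll>\<^sub>2\<close> with \<open>\<ll>/\<pp>\<close>. Each entry of degree \<open>\<plusminus>1\<close> occurs twice in a symplectic
matrix, which causes the factor 2.\<close>

lemma trace_duality:
  "trace (l_elt 0 u v e 0 0 0 0 0 0 ** l_elt d' u' v' e' x y A B C f) = 2 * (u \<bullet> x + v \<bullet> y) + e * f"
  by (simp add: l_elt_def l_block_mult trace_l_block trace_outer trace_add outer_arith matmul.zero_left
      matmul.minus_left matmul.minus_right transpose_zero)

lemma linear_trace_mult: "linear (\<lambda>Y. trace (Z ** Y :: real^'n^'n))" "linear (\<lambda>Z. trace (Z ** Y :: real^'n^'n))"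
  by (auto intro!: linearI simp: matmul.add_left matmul.add_right matmul.scaleR_left matmul.scaleR_right trace_add)
    (auto simp: trace_def sum_distrib_left)

lemma trace_filt_1_p: "Z \<in> l_filt 1 \<Longrightarrow> Y \<in> p_alg \<Longrightarrow> trace (Z ** Y) = 0"
proof -
  assume Z: "Z \<in> l_filt 1" and Y: "Y \<in> p_alg"
  then have "Z \<in> l_alg" "Y \<in> l_alg" by (auto simp: l_filt_def)
  then show "trace (Z ** Y) = 0"
    using Z Y by (elim l_algE) (auto simp: l_elt_mem_p_iff l_elt_mem_filt_1_iff trace_duality)
qed

lemma trace_nondegenerate:
  assumes Z: "Z \<in> l_filt 1" and 0: "\<And>Y. Y \<in> l_alg \<Longrightarrow> trace (Z ** Y) = 0"
  shows "Z = 0"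
proof -
  have "Z \<in> l_alg" using Z by (simp add: l_filt_def)
  then obtain d u v e x y A B C f where z: "Z = l_elt d u v e x y A B C f" by (rule l_algE)
  have Zeq: "Z = l_elt 0 u v e 0 0 0 0 0 0" using Z by (simp add: z l_elt_mem_filt_1_iff)
  have "trace (Z ** l_elt 0 0 0 0 u v 0 0 0 e) = 0" by (rule 0) (simp add: l_elt_mem_iff transpose_zero)
  then have "2 * (u \<bullet> u + v \<bullet> v) + e * e = 0" by (simp add: Zeq trace_duality)
  moreover have "a = 0 \<and> b = 0 \<and> c = 0"
    if "2 * (a + b) + c = 0" "a \<ge> 0" "b \<ge> 0" "c \<ge> 0" for a b c :: real
    using that by auto
  ultimately have "u \<bullet> u = 0 \<and> v \<bullet> v = 0 \<and> e * e = 0"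
    using inner_ge_zero[of u] inner_ge_zero[of v] zero_le_square[of e] by blast
  then show ?thesis by (simp add: Zeq l_elt_zero)
qed

text \<open>The coefficients that the definition of dual bases asserts to exist are the traces against the dual
basis, because \<open>\<ll>\<^sub>1 + \<ll>\<^sub>2\<close> is orthogonal to \<open>\<pp>\<close>.\<close>

lemma dual_bases_expand:
  assumes "dual_bases B Z" "Y \<in> l_alg"
  shows "Y - (\<Sum>b\<in>B. trace (Z b ** Y) *\<^sub>R b) \<in> p_alg"
proof -
  from assms obtain u where u: "Y - (\<Sum>b\<in>B. u b *\<^sub>R b) \<in> p_alg" unfolding dual_bases_def by blast
  have fin: "finite B" using assms by (simp add: dual_bases_def)
  have "trace (Z b ** Y) = u b" if b: "b \<in> B" for b
  proof -
    have d: "trace (Z b ** b') = (if b = b' then 1 else 0)" if "b' \<in> B" for b'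
      using assms b that by (simp add: dual_bases_def)
    have "0 = trace (Z b ** (Y - (\<Sum>b'\<in>B. u b' *\<^sub>R b')))"
      using assms b u by (intro trace_filt_1_p[symmetric]) (auto simp: dual_bases_def)
    also have "\<dots> = trace (Z b ** Y) - (\<Sum>b'\<in>B. u b' * trace (Z b ** b'))"
      by (simp add: linear_diff[OF linear_trace_mult(1)] linear_sum[OF linear_trace_mult(1)]
          linear_scale[OF linear_trace_mult(1)])
    also have "(\<Sum>b'\<in>B. u b' * trace (Z b ** b')) = (\<Sum>b'\<in>B. if b = b' then u b' else 0)"
      by (intro sum.cong) (auto simp: d)
    also have "\<dots> = u b" using fin b by simp
    finally show ?thesis by simp
  qed
  then show ?thesis using u by (simp cong: sum.cong)
qed

lemma dual_bases_expand_dual: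
  assumes B: "dual_bases B Z" and z: "z \<in> l_filt 1"
  shows "z = (\<Sum>b\<in>B. trace (z ** b) *\<^sub>R Z b)"
proof -
  let ?w = "z - (\<Sum>b\<in>B. trace (z ** b) *\<^sub>R Z b)"
  have w: "?w \<in> l_filt 1"
    using B z by (intro subspace_diff subspace_l_filt subspace_sum subspace_scale) (auto simp: dual_bases_def)
  have "trace (?w ** Y) = 0" if Y: "Y \<in> l_alg" for Y
  proof -
    have "trace (z ** (Y - (\<Sum>b\<in>B. trace (Z b ** Y) *\<^sub>R b))) = 0"
      by (intro trace_filt_1_p z dual_bases_expand[OF B Y])
    then show ?thesis
      by (simp add: linear_diff[OF linear_trace_mult(1)] linear_sum[OF linear_trace_mult(1)]
          linear_scale[OF linear_trace_mult(1)] linear_diff[OF linear_trace_mult(2)]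
          linear_sum[OF linear_trace_mult(2)] linear_scale[OF linear_trace_mult(2)] mult.commute)
  qed
  then have "?w = 0" by (rule trace_nondegenerate[OF w])
  then show ?thesis by simp
qed

text \<open>A bilinear map on \<open>(\<ll>\<^sub>1 + \<ll>\<^sub>2) \<times> \<ll>/\<pp>\<close> has a trace that does not depend on the dual bases: expand the
dual vectors of one basis in those of the other, and collect the coefficients in the second slot.\<close>

lemma dual_bases_sum_eq:
  fixes F :: "'n::finite lmat \<Rightarrow> 'n lmat \<Rightarrow> 'v::real_vector"
  assumes B: "dual_bases B Z" and B': "dual_bases B' Z'"
    and F1: "\<And>b. linear (\<lambda>z. F z b)" and F2: "\<And>z. linear (F z)"
    and Fp: "\<And>z b. b \<in> p_alg \<Longrightarrow> F z b = 0"
  shows "(\<Sum>b\<in>B. F (Z b) b) = (\<Sum>b\<in>B'. F (Z' b) b)"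
proof -
  have "F (Z b) b = (\<Sum>b'\<in>B'. trace (Z b ** b') *\<^sub>R F (Z' b') b)" if "b \<in> B" for b
  proof -
    have "Z b \<in> l_filt 1" using B that by (simp add: dual_bases_def)
    then have "F (Z b) b = F (\<Sum>b'\<in>B'. trace (Z b ** b') *\<^sub>R Z' b') b"
      by (intro arg_cong[where f = "\<lambda>z. F z b"] dual_bases_expand_dual[OF B'])
    then show ?thesis by (simp add: linear_sum[OF F1] linear_scale[OF F1])
  qed
  then have "(\<Sum>b\<in>B. F (Z b) b) = (\<Sum>b\<in>B. \<Sum>b'\<in>B'. trace (Z b ** b') *\<^sub>R F (Z' b') b)" by simp
  also have "\<dots> = (\<Sum>b'\<in>B'. \<Sum>b\<in>B. trace (Z b ** b') *\<^sub>R F (Z' b') b)" by (rule sum.swap)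
  also have "\<dots> = (\<Sum>b'\<in>B'. F (Z' b') b')"
  proof (rule sum.cong[OF refl])
    fix b' assume "b' \<in> B'"
    then have "b' \<in> l_alg" using B' by (auto simp: dual_bases_def)
    then have "F (Z' b') (b' - (\<Sum>b\<in>B. trace (Z b ** b') *\<^sub>R b)) = 0"
      by (intro Fp dual_bases_expand[OF B])
    then show "(\<Sum>b\<in>B. trace (Z b ** b') *\<^sub>R F (Z' b') b) = F (Z' b') b'"
      by (simp add: linear_diff[OF F2] linear_sum[OF F2] linear_scale[OF F2])
  qed
  finally show ?thesis .
qed

definition e_f :: "'n::finite lmat" where "e_f = l_elt 0 0 0 0 0 0 0 0 0 1"
definition e_x :: "'n \<Rightarrow> 'n::finite lmat" where "e_x i = l_elt 0 0 0 0 (axis i 1) 0 0 0 0 0"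
definition e_y :: "'n \<Rightarrow> 'n::finite lmat" where "e_y i = l_elt 0 0 0 0 0 (axis i 1) 0 0 0 0"

definition std_basis :: "'n::finite lmat set" where
  "std_basis = insert e_f (range e_x \<union> range e_y)"

text \<open>For root vectors the transpose spans the opposite root space, and the trace of \<open>b\<^sup>T b\<close> is \<open>b \<bullet> b\<close>.\<close>

definition std_dual :: "'n::finite lmat \<Rightarrow> 'n lmat" where
  "std_dual b = (1 / (b \<bullet> b)) *\<^sub>R transpose b"

lemma inner_l_block:
  "l_block m00 r01 r02 m03 v10 A11 A12 v13 v20 A21 A22 v23 m30 r31 r32 m33 \<bullet>
   l_block n00 s01 s02 n03 w10 B11 B12 w13 w20 B21 B22 w23 n30 s31 s32 n33 =
   m00 * n00 + r01 \<bullet> s01 + r02 \<bullet> s02 + m03 * n03 + v10 \<bullet> w10 + A11 \<bullet> B11 + A12 \<bullet> B12 + v13 \<bullet> w13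
   + v20 \<bullet> w20 + A21 \<bullet> B21 + A22 \<bullet> B22 + v23 \<bullet> w23 + m30 * n30 + r31 \<bullet> s31 + r32 \<bullet> s32 + m33 * n33"
  by (simp add: inner_vec_def sum_lix sum.distrib)

lemma std_dual_values:
  "std_dual e_f = l_elt 0 0 0 1 0 0 0 0 0 0"
  "std_dual (e_x i) = l_elt 0 ((1/2) *\<^sub>R axis i 1) 0 0 0 0 0 0 0 0"
  "std_dual (e_y i) = l_elt 0 0 ((1/2) *\<^sub>R axis i 1) 0 0 0 0 0 0 0"
  by (simp_all add: std_dual_def e_f_def e_x_def e_y_def l_elt_def l_block_transpose inner_l_block
      l_block_scaleR transpose_zero l_block_eq_iff transpose_arith inner_axis)

lemma sum_std_basis:
  fixes G :: "'n::finite lmat \<Rightarrow> 'v::comm_monoid_add"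
  shows "(\<Sum>b\<in>std_basis. G b) = G e_f + ((\<Sum>i\<in>UNIV. G (e_x i)) + (\<Sum>i\<in>UNIV. G (e_y i)))"
proof -
  have 1: "e_f \<notin> range e_x \<union> range e_y" "range e_x \<inter> (range e_y :: 'n lmat set) = {}"
    by (auto simp: e_f_def e_x_def e_y_def l_elt_eq_iff axis_eq_0_iff)
  have 2: "inj (e_x :: 'n \<Rightarrow> _)" "inj (e_y :: 'n \<Rightarrow> _)"
    by (auto intro!: injI simp: e_x_def e_y_def l_elt_eq_iff axis_eq_axis)
  show ?thesis unfolding std_basis_def
    by (simp add: sum.insert[OF _ 1(1)] sum.union_disjoint[OF _ _ 1(2)] sum.reindex[OF 2(1)] sum.reindex[OF 2(2)])
qed

lemma sum_axis: "(\<Sum>i\<in>UNIV. x $ i *\<^sub>R axis i (1::real)) = (x :: real^'n)"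
  by (simp add: vec_eq_iff axis_def if_distrib cong: if_cong)

lemma sum_l_elt:
  "(\<Sum>i\<in>S. l_elt (d i) (u i) (v i) (e i) (x i) (y i) (A i) (B i) (C i) (f i)) =
   l_elt (sum d S) (sum u S) (sum v S) (sum e S) (sum x S) (sum y S) (sum A S) (sum B S) (sum C S) (sum f S)"
  by (induction S rule: infinite_finite_induct) (simp_all add: l_elt_add l_elt_zero)

lemma dual_bases_std: "dual_bases (std_basis :: 'n::finite lmat set) std_dual"
proof -
  have tr: "trace (std_dual b ** b') = (if b = b' then 1 else 0)" if "b \<in> std_basis" "b' \<in> std_basis" for b b' :: "'n lmat"
    using that by (auto simp: std_basis_def std_dual_values)
     (auto simp: e_f_def e_x_def e_y_def trace_duality l_elt_eq_iff axis_eq_0_iff axis_eq_axis inner_axis_axis)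
  have filt: "std_dual b \<in> l_filt 1" if "b \<in> std_basis" for b :: "'n lmat"
    using that by (auto simp: std_basis_def std_dual_values l_elt_mem_filt_1_iff)
  have span: "\<exists>u. Y - (\<Sum>b\<in>std_basis. u b *\<^sub>R b) \<in> p_alg" if "Y \<in> l_alg" for Y :: "'n lmat"
  proof -
    obtain d u v e x y A B C f where Y: "Y = l_elt d u v e x y A B C f" "transpose B = B" "transpose C = C"
      by (rule l_algE[OF \<open>Y \<in> l_alg\<close>])
    have "(\<Sum>b\<in>std_basis. trace (std_dual b ** Y) *\<^sub>R b) = l_elt 0 0 0 0 x y 0 0 0 f"
      unfolding sum_std_basis std_dual_values Y trace_duality
      by (simp add: e_f_def e_x_def e_y_def l_elt_scaleR sum_l_elt l_elt_add inner_axis' sum_axis)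
    then show ?thesis using Y by (intro exI[of _ "\<lambda>b. trace (std_dual b ** Y)"]) (simp add: l_elt_diff l_elt_mem_p_iff)
  qed
  have sub: "std_basis \<subseteq> (l_alg :: 'n lmat set)"
    by (auto simp: std_basis_def e_f_def e_x_def e_y_def l_elt_mem_iff transpose_zero)
  have fin: "finite (std_basis :: 'n lmat set)" by (simp add: std_basis_def)
  have ind: "u b = 0" if p: "(\<Sum>b\<in>std_basis. u b *\<^sub>R b) \<in> p_alg" and b: "b \<in> std_basis" for u and b :: "'n lmat"
  proof -
    have "0 = trace (std_dual b ** (\<Sum>b'\<in>std_basis. u b' *\<^sub>R b'))"
      using trace_filt_1_p[OF filt[OF b] p] by simp
    also have "\<dots> = (\<Sum>b'\<in>std_basis. if b = b' then u b' else 0)"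
      by (auto intro!: sum.cong simp: linear_sum[OF linear_trace_mult(1)] linear_scale[OF linear_trace_mult(1)] tr b)
    also have "\<dots> = u b" using fin b by simp
    finally show ?thesis by simp
  qed
  show ?thesis unfolding dual_bases_def using tr filt span sub fin ind by blast
qed

section \<open>The pseudo-orthogonal side\<close>

locale sign_setting =
  fixes I :: "real^'n^'n" and c :: real
  assumes sgn: "\<exists>p q. sign_matrix p q I" and c: "c = 1 \<or> c = -1"
begin

definition eps :: "'n \<Rightarrow> real" where "eps i = I $ i $ i"

lemma I_nth: "I $ i $ j = (if i = j then eps i else 0)"
  using sgn by (auto simp: sign_matrix_def eps_def)

lemma eps_cases: "eps i = 1 \<or> eps i = -1"
  using sgn by (auto simp: sign_matrix_def eps_def)

lemma eps_sq [simp]: "eps i * eps i = 1" "eps i * (eps i * r) = r"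
  using eps_cases[of i] by auto

lemma eps_nz [simp]: "eps i \<noteq> 0"
  using eps_cases[of i] by auto

lemma c_sq [simp]: "c * c = 1" "c * (c * r) = r" using c by auto

lemma card_eq: "sign_matrix p q I \<Longrightarrow> CARD('n) = p + q"
proof -
  have "UNIV = {i. eps i = 1} \<union> {i. eps i = -1}" using eps_cases by auto
  then have "CARD('n) = card {i. eps i = 1} + card {i. eps i = -1}"
    by (subst card_Un_disjoint[symmetric]) auto
  then show "sign_matrix p q I \<Longrightarrow> CARD('n) = p + q" by (simp add: sign_matrix_def eps_def)
qed

lemma I_mult_nth [simp]:
  "(I *v X) $ i = eps i * X $ i" "(X v* I) $ i = eps i * X $ i"
  "(I ** A) $ i $ j = eps i * A $ i $ j" "(A ** I) $ i $ j = A $ i $ j * eps j"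
  by (simp_all add: matrix_vector_mult_def vector_matrix_mult_def matrix_matrix_mult_def
      I_nth if_distrib if_distribR mult.commute cong: if_cong)

lemma vec_mult_I [simp]: "X v* I = I *v X"
  by (simp add: vec_eq_iff)

lemma transpose_I [simp]: "transpose I = I"
  by (simp add: transpose_def vec_eq_iff I_nth)

lemma I_sq [simp]: "I ** I = mat 1" "I *v (I *v X) = X" "I ** (I ** A) = A" "A ** I ** I = A"
  by (simp_all add: vec_eq_iff mat_def I_nth)

lemma inner_I_swap: "X \<bullet> (I *v Y) = (I *v X) \<bullet> Y"
  by (simp add: inner_vec_def mult_ac)

lemma inner_I_commute: "X \<bullet> (I *v Y) = Y \<bullet> (I *v X)"
  by (simp add: inner_vec_def mult_ac)

sublocale O: form I I
  by unfold_locales simp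

definition gram_G :: "'n gmat" where "gram_G = g_block 1 0 0 0 c 0 0 0 I"

sublocale G: form gram_G gram_G
  by unfold_locales (simp add: gram_G_def g_block_mult g_block_one outer_arith)

lemma G_grp_eq: "G_grp c I = form_group gram_G"
  by (simp add: G_grp_def gram_G_def)

text \<open>On \<open>so(p,q)\<close> the lower right block \<open>IAI\<close> in the image of \<open>A\<close> is the block \<open>-A\<^sup>T\<close> of \<open>l_elt\<close>.\<close>

lemma so_transpose: "A \<in> form_algebra I \<Longrightarrow> transpose A = - (I ** A ** I)"
proof -
  assume "A \<in> form_algebra I"
  then have "transpose A ** I = - (I ** A)" by (simp add: form_algebra_def eq_neg_iff_add_eq_0)
  then have "transpose A ** I ** I = - (I ** A) ** I" by simp
  then show ?thesis by (simp add: matmul.minus_left)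
qed

lemma so_vec_mult: "A \<in> form_algebra I \<Longrightarrow> u v* A = - (I *v (A *v (I *v u)))"
proof -
  assume "A \<in> form_algebra I"
  then have "transpose A *v u = - (I *v (A *v (I *v u)))"
    by (simp add: so_transpose matrix_vector_mul_assoc matrix_mul_assoc matrix_vector_arith
        del: transpose_matrix_vector)
  then show ?thesis by simp
qed

lemma O_inv: "A \<in> form_group I \<Longrightarrow> matrix_inv A = I ** transpose A ** I"
  by (rule O.inv_eq)

lemma zero_so: "0 \<in> form_algebra I" using subspace_0[OF O.subspace_algebra] .

lemma g_elt_eq: "g_elt c I a X1 X2 A = g_block 0 a (- (I *v X1)) (- c * a) 0 (- c *\<^sub>R (I *v X2)) X1 X2 A"
  by (simp add: g_elt_def)

lemma g_elt_eq_iff: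
  "g_elt c I a X1 X2 A = g_elt c I b Y1 Y2 B \<longleftrightarrow> a = b \<and> X1 = Y1 \<and> X2 = Y2 \<and> A = B"
  by (auto simp: g_elt_def g_block_eq_iff)

lemma g_elt_add:
  "g_elt c I a X1 X2 A + g_elt c I b Y1 Y2 B = g_elt c I (a + b) (X1 + Y1) (X2 + Y2) (A + B)"
  unfolding gmat_eq_iff by (simp add: g_elt_eq all_gix algebra_simps)

lemma g_elt_scaleR:
  "t *\<^sub>R g_elt c I a X1 X2 A = g_elt c I (t * a) (t *\<^sub>R X1) (t *\<^sub>R X2) (t *\<^sub>R A)"
  unfolding gmat_eq_iff by (simp add: g_elt_eq all_gix algebra_simps)

lemma g_elt_zero: "0 = g_elt c I 0 0 0 0"
  by (simp add: g_elt_eq g_block_zero)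

lemma g_elt_mem [intro]: "A \<in> form_algebra I \<Longrightarrow> g_elt c I a X1 X2 A \<in> g_alg c I"
  unfolding g_alg_def by blast

lemma g_algE:
  assumes "x \<in> g_alg c I"
  obtains a X1 X2 A where "x = g_elt c I a X1 X2 A" "A \<in> form_algebra I"
  using assms unfolding g_alg_def by blast

lemma g_alg_eq: "g_alg c I = form_algebra gram_G"
proof -
  have "M \<in> form_algebra gram_G \<longleftrightarrow> M \<in> g_alg c I"
    if M: "M = g_block m00 m01 r02 m10 m11 r12 v20 v21 A22" for M m00 m01 r02 m10 m11 r12 v20 v21 A22
  proof -
    have "M \<in> form_algebra gram_G \<longleftrightarrow> m00 = 0 \<and> m10 = - c * m01 \<and> r02 = - (I *v v20) \<and> m11 = 0 \<and>
       r12 = - c *\<^sub>R (I *v v21) \<and> A22 \<in> form_algebra I"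
    proof -
      have 1: "r02 + I *v v20 = 0 \<longleftrightarrow> r02 = - (I *v v20)" by (rule add_eq_0_iff2)
      have 2: "c *\<^sub>R r12 + I *v v21 = 0 \<longleftrightarrow> r12 = - c *\<^sub>R (I *v v21)" using c by (auto simp: add_eq_0_iff)
      have 3: "c * m10 + m01 = 0 \<longleftrightarrow> m10 = - c * m01" using c by auto
      have 4: "I *v v20 + r02 = 0 \<longleftrightarrow> r02 + I *v v20 = 0" "I *v v21 + c *\<^sub>R r12 = 0 \<longleftrightarrow> c *\<^sub>R r12 + I *v v21 = 0"
        "m01 + c * m10 = 0 \<longleftrightarrow> c * m10 + m01 = 0"
        by (simp_all add: add.commute)
      have "M \<in> form_algebra gram_G \<longleftrightarrow> m00 + m00 = 0 \<and> c * m10 + m01 = 0 \<and> I *v v20 + r02 = 0 \<and>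
         m01 + c * m10 = 0 \<and> c * m11 + c * m11 = 0 \<and> I *v v21 + c *\<^sub>R r12 = 0 \<and>
         r02 + I *v v20 = 0 \<and> c *\<^sub>R r12 + I *v v21 = 0 \<and> transpose A22 ** I + I ** A22 = 0"
        unfolding M form_algebra_def mem_Collect_eq gram_G_def g_block_transpose g_block_mult g_block_zero
        by (simp add: g_block_add g_block_eq_iff outer_arith mult.commute)
      then show ?thesis unfolding 4 1 2 3 using c by (auto simp: form_algebra_def)
    qed
    also have "\<dots> \<longleftrightarrow> M \<in> g_alg c I"
      unfolding g_alg_def mem_Collect_eq g_elt_eq M g_block_eq_iff by auto
    finally show ?thesis .
  qed
  note * = this
  show ?thesis
  proof (rule set_eqI)
    fix M :: "'n gmat"
    show "M \<in> g_alg c I \<longleftrightarrow> M \<in> form_algebra gram_G"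
      by (cases M rule: g_block_exhaust) (rule *[symmetric])
  qed
qed

lemma subspace_g_alg: "subspace (g_alg c I)"
  unfolding g_alg_eq by (rule G.subspace_algebra)

lemma bracket_g_alg: "x \<in> g_alg c I \<Longrightarrow> y \<in> g_alg c I \<Longrightarrow> bracket x y \<in> g_alg c I"
  unfolding g_alg_eq by (rule G.bracket_mem)

lemma bracket_g_elt:
  assumes A: "A \<in> form_algebra I" and B: "B \<in> form_algebra I"
  shows "bracket (g_elt c I a X1 X2 A) (g_elt c I b Y1 Y2 B) = g_elt c I
     (X2 \<bullet> (I *v Y1) - X1 \<bullet> (I *v Y2))
     (A *v Y1 - B *v X1 + c *\<^sub>R (a *\<^sub>R Y2 - b *\<^sub>R X2))
     (A *v Y2 - B *v X2 + b *\<^sub>R X1 - a *\<^sub>R Y1)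
     (bracket A B + (outer Y1 X1 - outer X1 Y1 + c *\<^sub>R outer Y2 X2 - c *\<^sub>R outer X2 Y2) ** I)"
proof -
  have o: "outer U (I *v V) = outer U V ** I" for U V
    by (simp add: vec_eq_iff outer_def mult_ac)
  have r: "(I *v U) \<bullet> V = U \<bullet> (I *v V)" for U V by (simp add: inner_I_swap)
  show ?thesis
    unfolding bracket_def g_elt_eq g_block_mult g_block_diff g_block_eq_iff
    by (simp add: matrix_vector_arith so_vec_mult[OF A] so_vec_mult[OF B] o r outer_arith
        matmul.add_left matmul.diff_left matmul.scaleR_left matmul.minus_left
        scaleR_diff_right scaleR_add_right algebra_simps)
      (simp add: inner_I_commute[of Y1] inner_I_commute[of Y2])
qed

lemma k_elt_inv:
  assumes "A \<in> form_group I"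
  shows "matrix_inv (k_elt A) = k_elt (matrix_inv A)"
    and "k_elt A ** k_elt (matrix_inv A) = mat 1" "k_elt (matrix_inv A) ** k_elt A = mat 1"
proof -
  show 1: "k_elt A ** k_elt (matrix_inv A) = mat 1" "k_elt (matrix_inv A) ** k_elt A = mat 1"
    using O.inv_eq[OF assms] by (simp_all add: k_elt_def g_block_mult g_block_one outer_arith)
  show "matrix_inv (k_elt A) = k_elt (matrix_inv A)" by (rule matrix_inv_eqI[OF 1(1)])
qed

lemma i_hom_inv:
  assumes "A \<in> form_group I"
  shows "matrix_inv (i_hom I A) = i_hom I (matrix_inv A)"
    and "i_hom I A ** i_hom I (matrix_inv A) = mat 1" "i_hom I (matrix_inv A) ** i_hom I A = mat 1"
proof -
  have A: "A ** matrix_inv A = mat 1" "matrix_inv A ** A = mat 1" using O.inv_eq[OF assms] by auto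
  have "I ** A ** I ** (I ** matrix_inv A ** I) = I ** (A ** matrix_inv A) ** I"
    "I ** matrix_inv A ** I ** (I ** A ** I) = I ** (matrix_inv A ** A) ** I"
    by (simp_all add: matrix_mul_assoc[symmetric])
  then show 1: "i_hom I A ** i_hom I (matrix_inv A) = mat 1" "i_hom I (matrix_inv A) ** i_hom I A = mat 1"
    using A by (simp_all add: i_hom_def l_block_mult l_block_one outer_arith matmul.zero_left matmul.zero_right)
  show "matrix_inv (i_hom I A) = i_hom I (matrix_inv A)" by (rule matrix_inv_eqI[OF 1(1)])
qed

lemma Ad_k_elt:
  assumes A: "A \<in> form_group I" and B: "B \<in> form_algebra I"
  shows "Ad (k_elt A) (g_elt c I a X1 X2 B) = g_elt c I a (A *v X1) (A *v X2) (Ad A B)"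
proof -
  have 1: "(I *v X) v* (I ** transpose A ** I) = I *v (A *v X)" for X
  proof -
    have "(I *v X) v* (I ** transpose A ** I) = transpose (I ** transpose A ** I) *v (I *v X)" by simp
    also have "\<dots> = I *v (A *v X)"
      by (simp add: matrix_transpose_mul matrix_vector_mul_assoc[symmetric] del: transpose_matrix_vector)
    finally show ?thesis .
  qed
  show ?thesis unfolding Ad_def k_elt_inv[OF A] unfolding O_inv[OF A]
    by (simp add: k_elt_def g_elt_eq g_block_mult g_block_eq_iff matrix_vector_arith outer_arith 1)
qed

lemma Ad_i_hom_l_elt:
  assumes A: "A \<in> form_group I" and B: "transpose B = B" "transpose C = C"
  shows "Ad (i_hom I A) (l_elt d u v e x y D B C f) =
    l_elt d (I *v (A *v (I *v u))) (A *v v) e (A *v x) (I *v (A *v (I *v y))) (Ad A D)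
      (A ** B ** transpose A) (I ** A ** I ** C ** (I ** transpose A ** I)) f"
proof -
  have tr: "x v* M = transpose M *v x" for x :: "real^'n" and M :: "real^'n^'n" by simp
  have 1: "I ** (I ** transpose A ** I) ** I = transpose A" by (simp add: matrix_mul_assoc)
  show ?thesis unfolding Ad_def i_hom_inv[OF A] unfolding O_inv[OF A]
    by (simp add: i_hom_def l_elt_def l_block_mult l_block_eq_iff outer_arith matmul.zero_left matmul.zero_right
      matrix_vector_arith tr matrix_transpose_mul matrix_vector_mul_assoc matrix_mul_assoc transpose_arith
      matmul.minus_left matmul.minus_right transpose_zero
      del: transpose_matrix_vector)
qed

lemma i_deriv_l_elt: "A \<in> form_algebra I \<Longrightarrow> i_deriv I A = l_elt 0 0 0 0 0 0 A 0 0 0"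
  by (simp add: i_deriv_def l_elt_def so_transpose)

section \<open>Maps and elements invariant under the orthogonal group\<close>

lemma outer_mult:
  "outer a b ** M = outer a (b v* M)" "M ** outer a b = outer (M *v a) b" "outer a b *v x = (b \<bullet> x) *\<^sub>R a"
  by (simp_all add: vec_eq_iff outer_def matrix_matrix_mult_def vector_matrix_mult_def
      matrix_vector_mult_def inner_vec_def sum_distrib_left sum_distrib_right mult_ac)

definition reflection :: "real^'n \<Rightarrow> real^'n^'n" where
  "reflection v = mat 1 - (2 / (v \<bullet> (I *v v))) *\<^sub>R outer v (I *v v)"

lemma reflection_apply: "reflection v *v w = w - (2 * ((I *v v) \<bullet> w) / (v \<bullet> (I *v v))) *\<^sub>R v"
  by (simp add: reflection_def matrix_vector_arith outer_mult)

lemma reflection_mem: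
  assumes "v \<bullet> (I *v v) \<noteq> 0"
  shows "reflection v \<in> form_group I"
proof -
  define k where "k = 2 / (v \<bullet> (I *v v))"
  have k: "(I - k *\<^sub>R outer (I *v v) (I *v v)) *v v = - (I *v v)"
    using assms by (simp add: k_def matrix_vector_arith outer_mult inner_commute scaleR_2)
  show ?thesis
    unfolding form_group_def mem_Collect_eq reflection_def k_def[symmetric]
    by (simp add: transpose_arith transpose_scalar outer_transpose matmul.diff_left matmul.diff_right
      matmul.scaleR_left matmul.scaleR_right outer_mult) (simp add: k outer_arith)
qed

lemma minus_one_mem: "- mat 1 \<in> form_group I"
  by (rule O.minus_mem[OF O.one_mem])

text \<open>Schur's lemma. A reflection has a one-dimensional \<open>-1\<close>-eigenspace, so an equivariant map preserves
every anisotropic line. The lines of \<open>e\<^sub>i\<close> and of \<open>e\<^sub>i + 2 e\<^sub>j\<close> are anisotropic in every signature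
(\<open>e\<^sub>i + e\<^sub>j\<close> might be isotropic), and they force all eigenvalues to agree.\<close>

lemma schur:
  assumes lin: "linear g" and eq: "\<And>A X. A \<in> form_group I \<Longrightarrow> g (A *v X) = A *v g X"
  obtains t where "\<And>X. g X = t *\<^sub>R X"
proof -
  have line: "\<exists>t. g v = t *\<^sub>R v" if v: "v \<bullet> (I *v v) \<noteq> 0" for v
  proof -
    have "reflection v *v v = - v" using v by (simp add: reflection_apply inner_commute scaleR_2)
    then have "- g v = reflection v *v g v"
      using eq[OF reflection_mem[OF v], of v] by (simp add: linear_neg[OF lin])
    then have "- g v = g v - (2 * ((I *v v) \<bullet> g v) / (v \<bullet> (I *v v))) *\<^sub>R v" by (simp add: reflection_apply)
    then have "2 *\<^sub>R g v = (2 * ((I *v v) \<bullet> g v) / (v \<bullet> (I *v v))) *\<^sub>R v"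
      by (simp add: scaleR_2 algebra_simps)
    then have "(1/2) *\<^sub>R (2 *\<^sub>R g v) = ((I *v v) \<bullet> g v / (v \<bullet> (I *v v))) *\<^sub>R v" by simp
    then have "g v = ((I *v v) \<bullet> g v / (v \<bullet> (I *v v))) *\<^sub>R v" by simp
    then show ?thesis by blast
  qed
  let ?e = "\<lambda>i. axis i (1::real) :: real^'n"
  have "\<exists>t. g (?e i) = t *\<^sub>R ?e i" for i
    by (rule line) (simp add: inner_axis_axis inner_axis' )
  then obtain l where l: "\<And>i. g (?e i) = l i *\<^sub>R ?e i" by metis
  have "l i = l j" for i j
  proof (cases "i = j")
    case False
    \<comment> \<open>Anisotropic in both cases: its square is \<open>\<plusminus>1 \<plusminus> 4\<close>.\<close>
    let ?v = "?e i + 2 *\<^sub>R ?e j"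
    have "?v \<bullet> (I *v ?v) = eps i + 4 * eps j"
      using False by (simp add: inner_add_left inner_axis') (simp add: axis_def)
    also have "\<dots> \<noteq> 0" using eps_cases[of i] eps_cases[of j] by auto
    finally obtain t where t: "g ?v = t *\<^sub>R ?v" using line by blast
    have "l i *\<^sub>R ?e i + (2 * l j) *\<^sub>R ?e j = t *\<^sub>R ?v"
      using t by (simp add: linear_add[OF lin] linear_scale[OF lin] l)
    then have "(l i *\<^sub>R ?e i + (2 * l j) *\<^sub>R ?e j) $ k = (t *\<^sub>R ?v) $ k" for k by simp
    from this[of i] this[of j] show ?thesis using False by (simp add: axis_def)
  qed auto
  then obtain t where t: "\<And>i. l i = t" by metis
  have "g X = t *\<^sub>R X" for X
  proof -
    have "g X = g (\<Sum>i\<in>UNIV. X $ i *\<^sub>R ?e i)" by (simp add: sum_axis)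
    also have "\<dots> = t *\<^sub>R (\<Sum>i\<in>UNIV. X $ i *\<^sub>R ?e i)"
      by (simp add: linear_sum[OF lin] linear_scale[OF lin] l t scaleR_sum_right mult.commute)
    finally show ?thesis by (simp add: sum_axis)
  qed
  then show thesis by (rule that)
qed

lemma schur_matrix:
  assumes "\<And>A. A \<in> form_group I \<Longrightarrow> A ** M = M ** A"
  obtains t where "M = t *\<^sub>R mat 1"
proof -
  obtain t where "\<And>X. M *v X = t *\<^sub>R X"
    using schur[of "(*v) M"] assms matrix_vector_mul_linear by (metis matrix_vector_mul_assoc)
  then have "M = t *\<^sub>R mat 1" by (simp add: matrix_eq matrix_vector_arith)
  then show thesis by (rule that)
qed

lemma Ad_minus_one: "Ad (- mat 1) D = (D :: real^'m^'m)"
proof -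
  have "matrix_inv (- mat 1 :: real^'m^'m) = - mat 1"
    by (rule matrix_inv_eqI) (simp add: matmul.minus_left matmul.minus_right)
  then show ?thesis by (simp add: Ad_def matmul.minus_left matmul.minus_right)
qed

lemma Ad_i_hom_minus_one:
  assumes "M = l_elt d u v e x y D B C f" "transpose B = B" "transpose C = C"
  shows "Ad (i_hom I (- mat 1)) M = l_elt d (- u) (- v) e (- x) (- y) D B C f"
  using assms Ad_i_hom_l_elt[OF minus_one_mem assms(2,3)]
  by (simp add: matrix_vector_arith Ad_minus_one transpose_arith matmul.minus_left matmul.minus_right matrix_mul_assoc)

text \<open>The element \<open>-1\<close> of \<open>O(p,q)\<close> acts by \<open>-1\<close> on \<open>V\<close> and on the odd part of \<open>\<ll>\<close>, but trivially on the
even part; so only the four blocks isomorphic to \<open>V\<close> are hit, and Schur's lemma applies to each.\<close>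

lemma equivariant_vector_map:
  assumes lin: "linear f" and mem: "\<And>X. f X \<in> l_alg"
    and eq: "\<And>A X. A \<in> form_group I \<Longrightarrow> f (A *v X) = Ad (i_hom I A) (f X)"
  obtains t s p q where "\<And>X. f X = l_elt 0 (p *\<^sub>R (I *v X)) (q *\<^sub>R X) 0 (t *\<^sub>R X) (s *\<^sub>R (I *v X)) 0 0 0 0"
proof -
  define gx where "gx = (\<lambda>X. \<chi> i. f X $ Inr (Inl i) $ Inl ())"
  define gy where "gy = (\<lambda>X. I *v (\<chi> i. f X $ Inr (Inr (Inl i)) $ Inl ()))"
  define gu where "gu = (\<lambda>X. I *v (\<chi> i. f X $ Inl () $ Inr (Inl i)))"
  define gv where "gv = (\<lambda>X. \<chi> i. f X $ Inl () $ Inr (Inr (Inl i)))"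
  have f: "f X = l_elt 0 (I *v gu X) (gv X) 0 (gx X) (I *v gy X) 0 0 0 0" for X
  proof -
    obtain d u v e x y D B C g where M: "f X = l_elt d u v e x y D B C g" "transpose B = B" "transpose C = C"
      by (rule l_algE[OF mem])
    have "f (- X) = - f X" by (rule linear_neg[OF lin])
    moreover have "f (- X) = l_elt d (- u) (- v) e (- x) (- y) D B C g"
      using eq[OF minus_one_mem, of X] Ad_i_hom_minus_one[OF M] by (simp add: matrix_vector_arith)
    moreover have "- f X = l_elt (- d) (- u) (- v) (- e) (- x) (- y) (- D) (- B) (- C) (- g)"
      using l_elt_scaleR[of "-1"] by (simp add: M)
    ultimately have "d = - d \<and> e = - e \<and> D = - D \<and> B = - B \<and> C = - C \<and> g = - g" by (simp add: l_elt_eq_iff)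
    then have "d = 0 \<and> e = 0 \<and> D = 0 \<and> B = 0 \<and> C = 0 \<and> g = 0" by (auto simp: vec_eq_iff)
    then show ?thesis using M by (simp add: gx_def gy_def gu_def gv_def l_elt_def)
  qed
  have equiv: "l_elt 0 (I *v gu (A *v X)) (gv (A *v X)) 0 (gx (A *v X)) (I *v gy (A *v X)) 0 0 0 0 =
     l_elt 0 (I *v (A *v gu X)) (A *v gv X) 0 (A *v gx X) (I *v (A *v gy X)) 0 0 0 0" if "A \<in> form_group I" for A X
    using eq[OF that, of X] unfolding f[of "A *v X"] f[of X] Ad_i_hom_l_elt[OF that transpose_zero transpose_zero]
    by (simp add: l_elt_eq_iff)
  have I_inj: "I *v U = I *v V \<longleftrightarrow> U = V" for U V by (metis I_sq(2))
  have "linear gx" "linear gy" "linear gu" "linear gv"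
    by (auto intro!: linearI simp: gx_def gy_def gu_def gv_def linear_add[OF lin] linear_scale[OF lin]
        vec_eq_iff algebra_simps)
  then obtain t s p q where "\<And>X. gx X = t *\<^sub>R X" "\<And>X. gy X = s *\<^sub>R X" "\<And>X. gu X = p *\<^sub>R X" "\<And>X. gv X = q *\<^sub>R X"
    using equiv unfolding l_elt_eq_iff I_inj by (metis schur)
  then show thesis using that[of p q t s] f by (simp add: matrix_vector_arith)
qed

text \<open>Again \<open>-1\<close> kills the odd part. In the even part, with middle blocks \<open>D, B, C\<close>, invariance says
that \<open>D\<close>, \<open>BI\<close> and \<open>IC\<close> commute with \<open>O(p,q)\<close>.\<close>

lemma invariant_element:
  assumes mem: "M \<in> l_alg" and eq: "\<And>A. A \<in> form_group I \<Longrightarrow> Ad (i_hom I A) M = M"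
  obtains d e x y z f where "M = l_elt d 0 0 e 0 0 (x *\<^sub>R mat 1) (y *\<^sub>R I) (z *\<^sub>R I) f"
proof -
  obtain d u v e x y D B C g where M: "M = l_elt d u v e x y D B C g" "transpose B = B" "transpose C = C"
    by (rule l_algE[OF mem])
  have "l_elt d u v e x y D B C g = l_elt d (- u) (- v) e (- x) (- y) D B C g"
    using eq[OF minus_one_mem] Ad_i_hom_minus_one[OF M] by (simp add: M)
  then have 0: "u = 0 \<and> v = 0 \<and> x = 0 \<and> y = 0" unfolding l_elt_eq_iff by (auto simp: vec_eq_iff)
  have "Ad A D = D \<and> A ** B ** transpose A = B \<and> I ** A ** I ** C ** (I ** transpose A ** I) = C"
    if "A \<in> form_group I" for A
    using eq[OF that] unfolding M(1) Ad_i_hom_l_elt[OF that M(2,3)] by (simp add: l_elt_eq_iff)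
  note inv = this
  have comm: "A ** D = D ** A \<and> A ** (B ** I) = (B ** I) ** A \<and> A ** (I ** C) = (I ** C) ** A"
    if A: "A \<in> form_group I" for A
  proof (intro conjI)
    have tA: "transpose A ** I ** A = I" using A by (simp add: form_group_def)
    show "A ** D = D ** A"
    proof -
      have "A ** D ** (matrix_inv A ** A) = D ** A" using inv[OF A] by (simp add: Ad_def matrix_mul_assoc)
      then show ?thesis by (simp add: O.inv_eq(3)[OF A])
    qed
    show "A ** (B ** I) = (B ** I) ** A"
    proof -
      have "A ** B ** (transpose A ** I ** A) = B ** I ** A" using inv[OF A] by (simp add: matrix_mul_assoc)
      then show ?thesis by (simp add: tA matrix_mul_assoc)
    qed
    show "A ** (I ** C) = (I ** C) ** A"
    proof -
      have "I ** (I ** A ** I ** C ** (I ** transpose A ** I)) ** A = I ** C ** A" using inv[OF A] by simp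
      moreover have "I ** (I ** A ** I ** C ** (I ** transpose A ** I)) ** A
        = (I ** I) ** A ** I ** C ** I ** (transpose A ** I ** A)" by (simp only: matrix_mul_assoc)
      ultimately show ?thesis by (simp add: tA matrix_mul_assoc)
    qed
  qed
  obtain r where r: "D = r *\<^sub>R mat 1" by (rule schur_matrix[of D]) (use comm in blast)+
  obtain s where "B ** I = s *\<^sub>R mat 1" by (rule schur_matrix[of "B ** I"]) (use comm in blast)+
  then have "B ** I ** I = (s *\<^sub>R mat 1) ** I" by simp
  then have s: "B = s *\<^sub>R I" by (simp add: matmul.scaleR_left)
  obtain k where "I ** C = k *\<^sub>R mat 1" by (rule schur_matrix[of "I ** C"]) (use comm in blast)+
  then have "I ** (I ** C) = I ** (k *\<^sub>R mat 1)" by simp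
  then have k: "C = k *\<^sub>R I" by (simp add: matmul.scaleR_right)
  show thesis by (rule that[of d e r s k g]) (simp add: M(1) 0 r s k)
qed

text \<open>The general equivariant map \<open>\<gg> \<rightarrow> \<ll>\<close> with the prescribed values on \<open>\<kk>\<close>. The matrix of the \<open>t\<^sub>i\<^sub>j\<close> is the
map \<open>T\<close> between the degree -1 parts, \<open>f\<close> is the map to \<open>\<ll>\<^sub>-\<^sub>2\<close>, and the \<open>p\<^sub>i\<^sub>j\<close> and \<open>w\<close> are the maps of
\<open>V + V\<close> to \<open>\<ll>\<^sub>1\<close> and of \<open>\<real>\<close> to \<open>\<ll>\<^sub>2\<close>.\<close>

definition equivariant_elt ::
  "real \<Rightarrow> real \<Rightarrow> real \<Rightarrow> real \<Rightarrow> real \<Rightarrow> real \<Rightarrow> real \<Rightarrow> real \<Rightarrow> real \<Rightarrow> real \<Rightarrow> real \<Rightarrow> real \<Rightarrow> real \<Rightarrow> real \<Rightarrow>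
   real \<Rightarrow> real^'n \<Rightarrow> real^'n \<Rightarrow> real^'n^'n \<Rightarrow> 'n lmat" where
  "equivariant_elt d t11 t12 t21 t22 p11 p12 p21 p22 x y z w f a X1 X2 A =
     l_elt (d * a) (I *v (p11 *\<^sub>R X1 + p12 *\<^sub>R X2)) (p21 *\<^sub>R X1 + p22 *\<^sub>R X2) (w * a)
       (t11 *\<^sub>R X1 + t12 *\<^sub>R X2) (I *v (t21 *\<^sub>R X1 + t22 *\<^sub>R X2))
       (A + (x * a) *\<^sub>R mat 1) ((y * a) *\<^sub>R I) ((z * a) *\<^sub>R I) (f * a)"

lemma extension_equivariant_elt:
  assumes ext: "extension c I \<beta>"
  obtains d t11 t12 t21 t22 p11 p12 p21 p22 x y z w f where
    "\<And>a X1 X2 A. A \<in> form_algebra I \<Longrightarrow> \<beta> (g_elt c I a X1 X2 A) =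
       equivariant_elt d t11 t12 t21 t22 p11 p12 p21 p22 x y z w f a X1 X2 A"
proof -
  have mem: "\<beta> X \<in> l_alg" if "X \<in> g_alg c I" for X using ext that by (simp add: extension_def)
  have add: "\<beta> (X + Y) = \<beta> X + \<beta> Y" if "X \<in> g_alg c I" "Y \<in> g_alg c I" for X Y
    using ext that unfolding extension_def by blast
  have scale: "\<beta> (t *\<^sub>R X) = t *\<^sub>R \<beta> X" if "X \<in> g_alg c I" for X t
    using ext that unfolding extension_def by blast
  have equ: "\<beta> (Ad (k_elt A) X) = Ad (i_hom I A) (\<beta> X)" if "A \<in> form_group I" "X \<in> g_alg c I" for A X
    using ext that unfolding extension_def by blast
  have k: "\<beta> (g_elt c I 0 0 0 A) = i_deriv I A" if "A \<in> form_algebra I" for A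
    using ext that unfolding extension_def by blast
  note 0 = zero_so
  have Ad0: "Ad A 0 = (0 :: real^'n^'n)" for A by (simp add: Ad_def)
  let ?f1 = "\<lambda>X. \<beta> (g_elt c I 0 X 0 0)" and ?f2 = "\<lambda>X. \<beta> (g_elt c I 0 0 X 0)"
  have lin1: "linear ?f1"
  proof (rule linearI)
    show "?f1 (X + Y) = ?f1 X + ?f1 Y" for X Y
      using add[OF g_elt_mem[OF 0] g_elt_mem[OF 0], of 0 X 0 0 Y 0] by (simp add: g_elt_add)
    show "?f1 (t *\<^sub>R X) = t *\<^sub>R ?f1 X" for t X
      using scale[OF g_elt_mem[OF 0], of t 0 X 0] by (simp add: g_elt_scaleR)
  qed
  have eq1: "?f1 (A *v X) = Ad (i_hom I A) (?f1 X)" if "A \<in> form_group I" for A X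
    using equ[OF that g_elt_mem[OF 0], of 0 X 0] by (simp add: Ad_k_elt[OF that 0] Ad0)
  obtain t11 t21 p11 p21 where
    f1: "\<And>X. ?f1 X = l_elt 0 (p11 *\<^sub>R (I *v X)) (p21 *\<^sub>R X) 0 (t11 *\<^sub>R X) (t21 *\<^sub>R (I *v X)) 0 0 0 0"
    by (rule equivariant_vector_map[OF lin1 mem[OF g_elt_mem[OF 0]] eq1]) (assumption, rule that)
  have lin2: "linear ?f2"
  proof (rule linearI)
    show "?f2 (X + Y) = ?f2 X + ?f2 Y" for X Y
      using add[OF g_elt_mem[OF 0] g_elt_mem[OF 0], of 0 0 X 0 0 Y] by (simp add: g_elt_add)
    show "?f2 (t *\<^sub>R X) = t *\<^sub>R ?f2 X" for t X
      using scale[OF g_elt_mem[OF 0], of t 0 0 X] by (simp add: g_elt_scaleR)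
  qed
  have eq2: "?f2 (A *v X) = Ad (i_hom I A) (?f2 X)" if "A \<in> form_group I" for A X
    using equ[OF that g_elt_mem[OF 0], of 0 0 X] by (simp add: Ad_k_elt[OF that 0] Ad0)
  obtain t12 t22 p12 p22 where
    f2: "\<And>X. ?f2 X = l_elt 0 (p12 *\<^sub>R (I *v X)) (p22 *\<^sub>R X) 0 (t12 *\<^sub>R X) (t22 *\<^sub>R (I *v X)) 0 0 0 0"
    by (rule equivariant_vector_map[OF lin2 mem[OF g_elt_mem[OF 0]] eq2]) (assumption, rule that)
  have inv: "Ad (i_hom I A) (\<beta> (g_elt c I 1 0 0 0)) = \<beta> (g_elt c I 1 0 0 0)" if "A \<in> form_group I" for A
    using equ[OF that g_elt_mem[OF 0], of 1 0 0] by (simp add: Ad_k_elt[OF that 0] Ad0)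
  obtain d w x y z f where
    f0: "\<beta> (g_elt c I 1 0 0 0) = l_elt d 0 0 w 0 0 (x *\<^sub>R mat 1) (y *\<^sub>R I) (z *\<^sub>R I) f"
    by (rule invariant_element[OF mem[OF g_elt_mem[OF 0]] inv]) (assumption, rule that)
  show thesis
  proof (rule that)
    fix a X1 X2 A assume A: "A \<in> form_algebra I"
    have "g_elt c I a X1 X2 A = a *\<^sub>R g_elt c I 1 0 0 0 + (g_elt c I 0 X1 0 0 + (g_elt c I 0 0 X2 0 + g_elt c I 0 0 0 A))"
      by (simp add: g_elt_add g_elt_scaleR)
    also have "\<beta> \<dots> = a *\<^sub>R \<beta> (g_elt c I 1 0 0 0) + (?f1 X1 + (?f2 X2 + i_deriv I A))"
    proof -
      have m: "g_elt c I 0 0 X2 0 + g_elt c I 0 0 0 A \<in> g_alg c I"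
        "g_elt c I 0 X1 0 0 + (g_elt c I 0 0 X2 0 + g_elt c I 0 0 0 A) \<in> g_alg c I"
        "a *\<^sub>R g_elt c I 1 0 0 0 \<in> g_alg c I"
        using A 0 by (auto simp: g_elt_add g_elt_scaleR)
      show ?thesis
        by (simp add: add[OF m(3) m(2)] add[OF g_elt_mem[OF 0] m(1)] add[OF g_elt_mem[OF 0] g_elt_mem[OF A]]
          scale[OF g_elt_mem[OF 0]] k[OF A])
    qed
    finally show "\<beta> (g_elt c I a X1 X2 A) = equivariant_elt d t11 t12 t21 t22 p11 p12 p21 p22 x y z w f a X1 X2 A"
      by (simp add: f0 f1 f2 i_deriv_l_elt[OF A] l_elt_add l_elt_scaleR equivariant_elt_def l_elt_eq_iff
        matrix_vector_arith mult.commute)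
  qed
qed

section \<open>The curvature on the quotient\<close>

text \<open>This is the infinitesimal form of equivariance, read off from the explicit form of an extension. It is
the reason why the curvature descends to \<open>\<gg>/\<kk>\<close> and hence to \<open>\<ll>/\<pp>\<close>.\<close>

lemma curvature_k_zero:
  assumes ext: "extension c I \<beta>" and x: "x \<in> k_alg c I" and y: "y \<in> g_alg c I"
  shows "curvature \<beta> x y = 0" "curvature \<beta> y x = 0"
proof -
  obtain A where x: "x = g_elt c I 0 0 0 A" and A: "A \<in> form_algebra I" using x by (auto simp: k_alg_def)
  obtain b Y1 Y2 B where y: "y = g_elt c I b Y1 Y2 B" and B: "B \<in> form_algebra I" using y by (rule g_algE)
  obtain d t11 t12 t21 t22 p11 p12 p21 p22 r s z w f where
    \<beta>: "\<And>a X1 X2 A. A \<in> form_algebra I \<Longrightarrow> \<beta> (g_elt c I a X1 X2 A) =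
       equivariant_elt d t11 t12 t21 t22 p11 p12 p21 p22 r s z w f a X1 X2 A"
    by (rule extension_equivariant_elt[OF ext]) (rule that)
  have xy: "bracket x y = g_elt c I 0 (A *v Y1) (A *v Y2) (bracket A B)"
    unfolding x y bracket_g_elt[OF A B] by (simp add: outer_arith)
  have "A ** I + I ** transpose A = 0" by (simp add: so_transpose[OF A] matmul.minus_right matrix_mul_assoc)
  moreover have "transpose A ** I + I ** A = 0" using A by (simp add: form_algebra_def)
  ultimately have t: "I ** transpose A = - (A ** I)" "transpose A ** I = - (I ** A)"
    by (simp_all add: eq_neg_iff_add_eq_0 add.commute)
  have "bracket (\<beta> x) (\<beta> y) = \<beta> (bracket x y)"
    unfolding xy \<beta>[OF O.bracket_mem[OF A B]] unfolding x y \<beta>[OF A] \<beta>[OF B] equivariant_elt_def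
    by (subst bracket_l_elt) (simp_all add: transpose_zero transpose_scalar l_elt_eq_iff outer_arith
      so_vec_mult[OF A] matrix_vector_arith bracket_def
      t matmul.add_left matmul.add_right matmul.scaleR_left matmul.scaleR_right matmul.zero_left matmul.zero_right)
  then show "curvature \<beta> x y = 0" by (simp add: curvature_def)
  moreover have "\<beta> (- z) = - \<beta> z" if "z \<in> g_alg c I" for z
  proof -
    have "\<beta> ((-1) *\<^sub>R z) = (-1) *\<^sub>R \<beta> z" using ext that unfolding extension_def by blast
    then show ?thesis by simp
  qed
  moreover have "bracket x y \<in> g_alg c I" unfolding x y by (rule bracket_g_alg[OF g_elt_mem[OF A] g_elt_mem[OF B]])
  ultimately show "curvature \<beta> y x = 0"
    unfolding curvature_def bracket_swap[of y x] bracket_swap[of "\<beta> y" "\<beta> x"] by simp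
qed

lemma extension_diff:
  assumes ext: "extension c I \<beta>" and x: "x \<in> g_alg c I" and y: "y \<in> g_alg c I"
  shows "\<beta> (x - y) = \<beta> x - \<beta> y"
proof -
  have "\<beta> (x + (-1) *\<^sub>R y) = \<beta> x + (-1) *\<^sub>R \<beta> y"
    using ext x y subspace_scale[OF subspace_g_alg y, of "-1"] unfolding extension_def by metis
  then show ?thesis by simp
qed

lemma curvature_diff:
  assumes ext: "extension c I \<beta>" and x: "x \<in> g_alg c I" and x': "x' \<in> g_alg c I" and y: "y \<in> g_alg c I"
  shows "curvature \<beta> (x - x') y = curvature \<beta> x y - curvature \<beta> x' y"
    and "curvature \<beta> y (x - x') = curvature \<beta> y x - curvature \<beta> y x'"
  using extension_diff[OF ext x x'] extension_diff[OF ext bracket_g_alg[OF x y] bracket_g_alg[OF x' y]]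
    extension_diff[OF ext bracket_g_alg[OF y x] bracket_g_alg[OF y x']]
  by (simp_all add: curvature_def linear_diff[OF linear_bracket_left] linear_diff[OF linear_bracket_right])

lemma lift_spec:
  assumes ext: "extension c I \<beta>" and X: "X \<in> l_alg"
  shows "lift c I \<beta> X \<in> g_alg c I" "\<beta> (lift c I \<beta> X) - X \<in> p_alg"
proof -
  have "\<exists>x. x \<in> g_alg c I \<and> \<beta> x - X \<in> p_alg" using ext X unfolding extension_def by blast
  from someI_ex[OF this] show "lift c I \<beta> X \<in> g_alg c I" "\<beta> (lift c I \<beta> X) - X \<in> p_alg"
    by (auto simp: lift_def)
qed

text \<open>The representatives that \<open>curv_lp\<close> chooses can be replaced by any others: an extension is injective
modulo \<open>\<pp>\<close>, so two representatives in \<open>\<gg>\<close> differ by an element of \<open>\<kk>\<close>.\<close>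

lemma curv_lp_eq:
  assumes ext: "extension c I \<beta>"
    and x: "x \<in> g_alg c I" "\<beta> x - X \<in> p_alg" and y: "y \<in> g_alg c I" "\<beta> y - Y \<in> p_alg"
  shows "curv_lp c I \<beta> X Y = curvature \<beta> x y"
proof -
  have k: "lift c I \<beta> X - x \<in> k_alg c I \<and> lift c I \<beta> X \<in> g_alg c I"
    if x: "x \<in> g_alg c I" "\<beta> x - X \<in> p_alg" for x X
  proof -
    have "\<beta> x \<in> l_alg" using ext x by (simp add: extension_def)
    moreover have "\<beta> x - X \<in> l_alg" using x by (simp add: l_filt_def)
    ultimately have "\<beta> x - (\<beta> x - X) \<in> l_alg" by (rule subspace_diff[OF subspace_l_alg])
    then have X: "X \<in> l_alg" by simp
    note l = lift_spec[OF ext X]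
    have "\<beta> (lift c I \<beta> X - x) = (\<beta> (lift c I \<beta> X) - X) - (\<beta> x - X)"
      by (simp add: extension_diff[OF ext l(1) x(1)])
    also have "\<dots> \<in> p_alg" by (rule subspace_diff[OF subspace_l_filt l(2) x(2)])
    finally show ?thesis
      using ext subspace_diff[OF subspace_g_alg l(1) x(1)] l(1) unfolding extension_def by blast
  qed
  let ?x = "lift c I \<beta> X" and ?y = "lift c I \<beta> Y"
  have kx: "?x - x \<in> k_alg c I" "?x \<in> g_alg c I" and ky: "?y - y \<in> k_alg c I" "?y \<in> g_alg c I"
    using k[OF x] k[OF y] by auto
  have "curvature \<beta> ?x ?y - curvature \<beta> x ?y = 0"
    using curvature_k_zero(1)[OF ext kx(1) ky(2)] by (simp add: curvature_diff[OF ext kx(2) x(1) ky(2)])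
  moreover have "curvature \<beta> x ?y - curvature \<beta> x y = 0"
    using curvature_k_zero(2)[OF ext ky(1) x(1)] by (simp add: curvature_diff[OF ext ky(2) y(1) x(1)])
  ultimately show ?thesis by (simp add: curv_lp_def)
qed

section \<open>The normalized extensions and their curvature\<close>

text \<open>The equivariant maps with \<open>T = 1\<close>, \<open>f = 2\<close> and without component along the grading element. Reading the
blocks off the matrix makes this a linear map on all matrices, so that the curvature is bilinear
without reference to \<open>\<gg>\<close>.\<close>

definition normalized_map ::
  "real \<Rightarrow> real \<Rightarrow> real \<Rightarrow> real \<Rightarrow> real \<Rightarrow> real \<Rightarrow> real \<Rightarrow> real \<Rightarrow> 'n gmat \<Rightarrow> 'n lmat" where
  "normalized_map p11 p12 p21 p22 x y z w M =
     equivariant_elt 0 1 0 0 1 p11 p12 p21 p22 x y z w 2 (M $ Inl () $ Inr (Inl ()))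
       (\<chi> i. M $ Inr (Inr i) $ Inl ()) (\<chi> i. M $ Inr (Inr i) $ Inr (Inl ()))
       (\<chi> i j. M $ Inr (Inr i) $ Inr (Inr j))"

text \<open>A linear choice of representatives in \<open>\<gg>\<close> of the classes in \<open>\<ll>/\<pp>\<close>, common to all normalized maps.\<close>

definition g_rep :: "'n lmat \<Rightarrow> 'n gmat" where
  "g_rep M = g_elt c I (M $ Inr (Inr (Inr ())) $ Inl () / 2) (\<chi> i. M $ Inr (Inl i) $ Inl ())
     (I *v (\<chi> i. M $ Inr (Inr (Inl i)) $ Inl ())) 0"

lemma outer_nth [simp]: "outer u v $ i $ j = u $ i * v $ j"
  by (simp add: outer_def)

lemma normalized_map_g_elt: "normalized_map p11 p12 p21 p22 x y z w (g_elt c I a X1 X2 A) =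
    equivariant_elt 0 1 0 0 1 p11 p12 p21 p22 x y z w 2 a X1 X2 A"
  by (simp add: normalized_map_def g_elt_eq)

lemma linear_normalized_map: "linear (normalized_map p11 p12 p21 p22 x y z w)"
  by (rule linearI; unfold normalized_map_def equivariant_elt_def l_elt_add l_elt_scaleR l_elt_eq_iff; simp add: vec_eq_iff algebra_simps)

lemma g_rep_l_elt: "g_rep (l_elt d u v e x y A B C f) = g_elt c I (f / 2) x (I *v y) 0"
  by (simp add: g_rep_def l_elt_def)

lemma linear_g_rep: "linear g_rep"
  by (rule linearI; unfold g_rep_def g_elt_add g_elt_scaleR g_elt_eq_iff; simp add: vec_eq_iff algebra_simps add_divide_distrib)

lemma g_rep_mem: "g_rep X \<in> g_alg c I"
  unfolding g_rep_def using zero_so by blast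

lemma g_rep_p: "X \<in> p_alg \<Longrightarrow> g_rep X = 0"
proof -
  assume X: "X \<in> p_alg"
  then have "X \<in> l_alg" by (simp add: l_filt_def)
  then obtain d u v e x y A B C f where Xe: "X = l_elt d u v e x y A B C f" by (rule l_algE)
  show "g_rep X = 0" using X unfolding Xe l_elt_mem_p_iff by (simp add: g_rep_l_elt g_elt_zero)
qed

lemma normalized_map_g_rep: "X \<in> l_alg \<Longrightarrow> normalized_map p11 p12 p21 p22 x y z w (g_rep X) - X \<in> p_alg"
  by (erule l_algE) (simp add: g_rep_l_elt normalized_map_g_elt equivariant_elt_def l_elt_diff l_elt_mem_p_iff transpose_arith
    transpose_scalar)

lemma O_conj:
  assumes A: "A \<in> form_group I"
  shows "A ** I ** transpose A = I"
proof -
  have "A ** (I ** transpose A ** I) ** I = I" using O.inv_eq(2)[OF A] by (simp add: O_inv[OF A])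
  then show ?thesis by (simp add: matrix_mul_assoc)
qed

lemma Ad_equivariant_elt:
  assumes A: "A \<in> form_group I"
  shows "Ad (i_hom I A) (equivariant_elt d t11 t12 t21 t22 p11 p12 p21 p22 x y z w f a X1 X2 B) =
    equivariant_elt d t11 t12 t21 t22 p11 p12 p21 p22 x y z w f a (A *v X1) (A *v X2) (Ad A B)"
proof -
  have "I ** A ** (I ** transpose A ** I) = I ** (A ** I ** transpose A) ** I"
    by (simp add: matrix_mul_assoc)
  then have 1: "I ** A ** (I ** transpose A ** I) = I" by (simp add: O_conj[OF A])
  have 2: "Ad A (B + k *\<^sub>R mat 1) = Ad A B + k *\<^sub>R mat 1" for k
    using O.inv_eq[OF A] by (simp add: Ad_def matmul.add_left matmul.add_right matmul.scaleR_left matmul.scaleR_right)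
  show ?thesis unfolding equivariant_elt_def
    by (subst Ad_i_hom_l_elt[OF A])
      (simp_all add: transpose_scalar 1 2 l_elt_eq_iff matrix_vector_arith matmul.scaleR_left matmul.scaleR_right
       O_conj[OF A])
qed

lemma extension_normalized_map: "extension c I (normalized_map p11 p12 p21 p22 x y z w)" (is "extension c I ?f")
  unfolding extension_def
proof (intro conjI ballI allI impI)
  fix M N t A assume M: "M \<in> g_alg c I"
  obtain a X1 X2 B where Me: "M = g_elt c I a X1 X2 B" and B: "B \<in> form_algebra I" using M by (rule g_algE)
  show "?f M \<in> l_alg" by (simp add: Me normalized_map_g_elt equivariant_elt_def l_elt_mem_iff transpose_scalar)
  show "?f (M + N) = ?f M + ?f N" by (rule linear_add[OF linear_normalized_map])
  show "?f (t *\<^sub>R M) = t *\<^sub>R ?f M" by (rule linear_scale[OF linear_normalized_map])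
  show "?f (Ad (k_elt A) M) = Ad (i_hom I A) (?f M)" if A: "A \<in> form_group I"
    by (simp add: Me Ad_k_elt[OF A B] normalized_map_g_elt Ad_equivariant_elt[OF A])
  show "M \<in> k_alg c I" if "?f M \<in> p_alg"
  proof -
    have "X1 = 0" "I *v X2 = 0" "a = 0" using that by (auto simp: Me normalized_map_g_elt equivariant_elt_def l_elt_mem_p_iff)
    moreover from this(2) have "X2 = 0" by (metis I_sq(2) matrix_vector_mult_0_right)
    ultimately show ?thesis using B by (auto simp: Me k_alg_def)
  qed
next
  show "?f (g_elt c I 0 0 0 A) = i_deriv I A" if "A \<in> form_algebra I" for A
    by (simp add: i_deriv_l_elt[OF that] normalized_map_g_elt equivariant_elt_def)
  show "\<exists>x\<in>g_alg c I. ?f x - Y \<in> p_alg" if "Y \<in> l_alg" for Y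
    using normalized_map_g_rep[OF that] g_rep_mem by blast
qed

text \<open>The curvature of a normalized map. It depends on its arguments only through \<open>om\<close>, the bracket
\<open>\<ll>\<^sub>-\<^sub>1 \<times> \<ll>\<^sub>-\<^sub>1 \<rightarrow> \<ll>\<^sub>-\<^sub>2\<close>, through \<open>U1, U2\<close>, which pair degrees -2 and -1, and through outer products.
The last block, of degree -2, vanishes because of \<open>f = 2\<close>.\<close>

definition curvature_elt ::
  "real \<Rightarrow> real \<Rightarrow> real \<Rightarrow> real \<Rightarrow> real \<Rightarrow> real \<Rightarrow> real \<Rightarrow> real \<Rightarrow>
   real \<Rightarrow> real^'n \<Rightarrow> real^'n \<Rightarrow> real \<Rightarrow> real^'n \<Rightarrow> real^'n \<Rightarrow> 'n lmat" where
  "curvature_elt p11 p12 p21 p22 x y z w a X1 X2 b Y1 Y2 =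
    (let om = X2 \<bullet> (I *v Y1) - X1 \<bullet> (I *v Y2); U1 = a *\<^sub>R Y1 - b *\<^sub>R X1; U2 = a *\<^sub>R Y2 - b *\<^sub>R X2 in
     l_elt
      ((p12 - p21) * om)
      (- (I *v ((x * p11 + z * p21 - p12) *\<^sub>R U1 + (x * p12 + z * p22 - w + c * p11) *\<^sub>R U2)))
      (- ((y * p11 - x * p21 + w - p22) *\<^sub>R U1 + (y * p12 - x * p22 + c * p21) *\<^sub>R U2))
      (- (2 * (p11 * p22 - p12 * p21) + w) * om)
      ((x - 2 * p21) *\<^sub>R U1 + (y - 2 * p22 - c) *\<^sub>R U2)
      (I *v ((z + 2 * p11 + 1) *\<^sub>R U1 + (2 * p12 - x) *\<^sub>R U2))
      (((p11 + 1) *\<^sub>R (outer X1 Y1 - outer Y1 X1) + (p22 + c) *\<^sub>R (outer X2 Y2 - outer Y2 X2)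
        + (p12 + p21) *\<^sub>R (outer X1 Y2 - outer Y1 X2)) ** I - (x * om) *\<^sub>R mat 1)
      (p22 *\<^sub>R (outer X1 Y2 - outer X2 Y1 - outer Y1 X2 + outer Y2 X1) - (y * om) *\<^sub>R I)
      (p11 *\<^sub>R (I ** (outer X2 Y1 - outer X1 Y2 - outer Y2 X1 + outer Y1 X2) ** I) - (z * om) *\<^sub>R I)
      0)"

lemma axis_mult [simp]:
  "(axis i 1 v* M) $ j = M $ i $ j" "(M *v axis i 1) $ j = M $ j $ i" for M :: "real^'n^'n"
  by (simp_all add: vector_matrix_mult_def matrix_vector_mult_def axis_def if_distrib if_distribR cong: if_cong)

lemma mat_one_nth [simp]: "(mat 1 :: real^'n^'n) $ i $ j = (if i = j then 1 else 0)"
  by (simp add: mat_def)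

lemma curvature_normalized_map_minus:
  "curvature (normalized_map p11 p12 p21 p22 x y z w) (g_elt c I a X1 X2 0) (g_elt c I b Y1 Y2 0) =
     curvature_elt p11 p12 p21 p22 x y z w a X1 X2 b Y1 Y2"
proof -
  have ic: "(I *v U) \<bullet> V = U \<bullet> (I *v V)" for U V by (simp add: inner_I_swap)
  have sw: "Y1 \<bullet> (I *v X1) = X1 \<bullet> (I *v Y1)" "Y1 \<bullet> (I *v X2) = X2 \<bullet> (I *v Y1)"
    "Y2 \<bullet> (I *v X1) = X1 \<bullet> (I *v Y2)" "Y2 \<bullet> (I *v X2) = X2 \<bullet> (I *v Y2)"
    by (rule inner_I_commute)+
  show ?thesis
    unfolding curvature_def bracket_g_elt[OF zero_so zero_so] normalized_map_g_elt curvature_elt_def Let_def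
    unfolding equivariant_elt_def
    by (subst bracket_l_elt, simp_all add: transpose_scalar l_elt_diff l_elt_eq_iff, intro conjI,
      simp_all add: inner_add_left inner_add_right ic sw matrix_vector_arith inner_diff_left inner_diff_right,
      simp_all add: vec_eq_iff matmul.add_left matmul.diff_left matmul.scaleR_left matmul.scaleR_right
        matmul.add_right matmul.diff_right bracket_def matmul.zero_left matmul.zero_right transpose_scalar,
      simp_all add: algebra_simps)
qed

lemma curvature_normalized_map:
  assumes A: "A \<in> form_algebra I" and B: "B \<in> form_algebra I"
  shows "curvature (normalized_map p11 p12 p21 p22 x y z w) (g_elt c I a X1 X2 A) (g_elt c I b Y1 Y2 B) =
     curvature_elt p11 p12 p21 p22 x y z w a X1 X2 b Y1 Y2" (is "curvature ?f ?x ?y = _")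
proof -
  have k: "g_elt c I a X1 X2 A - g_elt c I a X1 X2 0 \<in> k_alg c I" if "A \<in> form_algebra I" for a X1 X2 A
  proof -
    have "g_elt c I a X1 X2 A = g_elt c I a X1 X2 0 + g_elt c I 0 0 0 A" by (simp add: g_elt_add)
    then show ?thesis using that by (auto simp: k_alg_def)
  qed
  note e = extension_normalized_map[of p11 p12 p21 p22 x y z w]
  note m = g_elt_mem[OF A] g_elt_mem[OF B] g_elt_mem[OF zero_so]
  have "curvature ?f ?x ?y = curvature ?f (g_elt c I a X1 X2 0) ?y"
    using curvature_k_zero(1)[OF e k[OF A] m(2)] curvature_diff(1)[OF e m(1) m(3) m(2)] by simp
  also have "\<dots> = curvature ?f (g_elt c I a X1 X2 0) (g_elt c I b Y1 Y2 0)"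
    using curvature_k_zero(2)[OF e k[OF B] m(3)] curvature_diff(2)[OF e m(2) m(3) m(3)] by simp
  finally show ?thesis by (simp add: curvature_normalized_map_minus)
qed

section \<open>The codifferential\<close>

text \<open>The summand belonging to \<open>b\<close> and its dual \<open>Z\<close> in the normality condition, written as a function that is
bilinear in \<open>(Z, b)\<close> and vanishes for \<open>b \<in> \<pp>\<close>, so that \<open>dual_bases_sum_eq\<close> applies.\<close>

definition codiff_term ::
  "('n gmat \<Rightarrow> 'n lmat) \<Rightarrow> 'n lmat \<Rightarrow> 'n lmat \<Rightarrow> 'n lmat \<Rightarrow> 'n lmat" where
  "codiff_term \<beta> X Z b = curvature \<beta> (g_rep (bracket Z X)) (g_rep b) - 2 *\<^sub>R bracket Z (curvature \<beta> (g_rep X) (g_rep b))"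

lemma linear_codiff_term:
  assumes "linear \<beta>"
  shows "linear (\<lambda>Z. codiff_term \<beta> X Z b)" "linear (codiff_term \<beta> X Z)"
proof -
  have L: "linear (\<lambda>x. curvature \<beta> x y)" "linear (\<lambda>x. curvature \<beta> y x)" for y
    by (auto intro!: linearI simp: curvature_def linear_add[OF assms] linear_scale[OF assms]
        linear_add[OF linear_bracket_left] linear_add[OF linear_bracket_right]
        linear_scale[OF linear_bracket_left] linear_scale[OF linear_bracket_right] algebra_simps)
  note l = linear_add[OF linear_g_rep] linear_scale[OF linear_g_rep]
    linear_add[OF linear_bracket_left] linear_add[OF linear_bracket_right]
    linear_scale[OF linear_bracket_left] linear_scale[OF linear_bracket_right]
    linear_add[OF L(1)] linear_add[OF L(2)] linear_scale[OF L(1)] linear_scale[OF L(2)]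
  show "linear (\<lambda>Z. codiff_term \<beta> X Z b)" "linear (codiff_term \<beta> X Z)"
    by (auto intro!: linearI simp: codiff_term_def l algebra_simps)
qed

lemma normal_iff_std_codifferential:
  "normal c I (normalized_map p11 p12 p21 p22 x y z w) \<longleftrightarrow>
    (\<forall>X\<in>l_alg. (\<Sum>b\<in>std_basis. codiff_term (normalized_map p11 p12 p21 p22 x y z w) X (std_dual b) b) = 0)"
    (is "normal c I ?f \<longleftrightarrow> ?r")
proof -
  note e = extension_normalized_map[of p11 p12 p21 p22 x y z w]
  have cl: "curv_lp c I ?f X Y = curvature ?f (g_rep X) (g_rep Y)" if "X \<in> l_alg" "Y \<in> l_alg" for X Y
    by (rule curv_lp_eq[OF e g_rep_mem normalized_map_g_rep[OF that(1)] g_rep_mem normalized_map_g_rep[OF that(2)]])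
  have "((\<Sum>b\<in>B. curv_lp c I ?f (bracket (Z b) X) b) = 2 *\<^sub>R (\<Sum>b\<in>B. bracket (Z b) (curv_lp c I ?f X b)))
     \<longleftrightarrow> (\<Sum>b\<in>std_basis. codiff_term ?f X (std_dual b) b) = 0"
    if BZ: "dual_bases B Z" and X: "X \<in> l_alg" for B Z X
  proof -
    have m: "b \<in> l_alg" "Z b \<in> l_alg" if "b \<in> B" for b
      using BZ that by (auto simp: dual_bases_def l_filt_def)
    have "(\<Sum>b\<in>B. curv_lp c I ?f (bracket (Z b) X) b) - 2 *\<^sub>R (\<Sum>b\<in>B. bracket (Z b) (curv_lp c I ?f X b))
      = (\<Sum>b\<in>B. codiff_term ?f X (Z b) b)"
      by (simp add: codiff_term_def sum_subtractf scaleR_sum_right cl m X bracket_l_alg cong: sum.cong)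
    also have "\<dots> = (\<Sum>b\<in>std_basis. codiff_term ?f X (std_dual b) b)"
    proof (rule dual_bases_sum_eq[OF BZ dual_bases_std linear_codiff_term(1,2)[OF linear_normalized_map]])
      show "codiff_term ?f X Z b = 0" if "b \<in> p_alg" for Z b
        using linear_0[OF linear_normalized_map]
        by (simp add: codiff_term_def g_rep_p[OF that] curvature_def linear_0[OF linear_bracket_right])
    qed
    finally have eq: "(\<Sum>b\<in>std_basis. codiff_term ?f X (std_dual b) b) =
       (\<Sum>b\<in>B. curv_lp c I ?f (bracket (Z b) X) b) - 2 *\<^sub>R (\<Sum>b\<in>B. bracket (Z b) (curv_lp c I ?f X b))"
      by (rule sym)
    show ?thesis unfolding eq by (rule eq_iff_diff_eq_0)
  qed
  then show ?thesis unfolding normal_def using dual_bases_std by blast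
qed

lemma curvature_elt_sym:
  assumes "curvature_elt p11 p12 p21 p22 x y z w a X1 X2 b Y1 Y2 = l_elt d u v e x' y' A B C f"
  shows "transpose B = B" "transpose C = C"
  using assms unfolding curvature_elt_def Let_def l_elt_eq_iff
  by (safe; simp add: vec_eq_iff transpose_def I_nth algebra_simps)+

lemma bracket_dual:
  assumes "transpose B = B" "transpose C = C"
  shows "bracket (l_elt 0 u v e 0 0 0 0 0 0) (l_elt d' u' v' e' x y A B C f) =
    l_elt (u \<bullet> x + v \<bullet> y + e * f) (u v* A + v v* C + e *\<^sub>R y - d' *\<^sub>R u) (u v* B - A *v v - e *\<^sub>R x - d' *\<^sub>R v)
     (2 * (u \<bullet> v' - v \<bullet> u' - e * d')) (f *\<^sub>R v) (- f *\<^sub>R u) (- outer x u + outer v y)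
     (- outer v x - outer x v) (- outer u y - outer y u) 0"
  by (subst bracket_l_elt)
    (simp_all add: assms transpose_zero l_elt_eq_iff outer_arith matmul.zero_left matmul.zero_right)

lemma l_elt_cong:
  assumes "d = d'" "u = u'" "v = v'" "e = e'" "x = x'" "y = y'" "A = A'" "B = B'" "C = C'" "f = f'"
  shows "l_elt d u v e x y A B C f = l_elt d' u' v' e' x' y' A' B' C' f'"
  using assms by simp

text \<open>The codifferential as a function of the class of its argument in \<open>\<ll>/\<pp>\<close>. In degree -1 the curvature
terms \<open>\<kappa>([Z,X],b)\<close> vanish for degree reasons and the contraction of the \<open>\<ll>\<^sub>0\<close>-part of the curvature
produces the multiples of \<open>n\<close>; in degree -2 all parts of the curvature contribute.\<close>

lemma codifferential_normalized_map:
  fixes n :: real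
  assumes n: "n = CARD('n)"
    and X: "transpose B = B" "transpose C = C"
  shows "(\<Sum>b\<in>std_basis. codiff_term (normalized_map p11 p12 p21 p22 x y z w) (l_elt d0 u0 v0 e0 X1 (I *v X2) A B C f) (std_dual b) b)
   = l_elt (- 2 * n * (p12 - p21) * f)
      (I *v ((n + p11 * (2 * n + 2)) *\<^sub>R X1 + ((n + 3) * p12 + (n - 1) * p21) *\<^sub>R X2))
      (((n - 1) * p12 + (n + 3) * p21) *\<^sub>R X1 + (p22 * (2 * n + 2) + c * n) *\<^sub>R X2)
      (n * (2 * (p11 * p22 - p12 * p21) + 3 * w + y * p11 - x * p21 - p22 - x * p12 - z * p22 - c * p11) * f)
      0 0 ((x * (n + 1) * f) *\<^sub>R mat 1) (((y * (n + 1) - c) * f) *\<^sub>R I) (((z * (n + 1) + 1) * f) *\<^sub>R I) 0"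
proof -
  let ?F = "codiff_term (normalized_map p11 p12 p21 p22 x y z w) (l_elt d0 u0 v0 e0 X1 (I *v X2) A B C f)"
  let ?K = "curvature_elt p11 p12 p21 p22 x y z w"
  let ?e = "\<lambda>i. axis i (1::real) :: real^'n"
  have br: "g_rep (bracket (l_elt 0 u v e 0 0 0 0 0 0) (l_elt d0 u0 v0 e0 X1 (I *v X2) A B C f)) =
     g_elt c I 0 (f *\<^sub>R v) (- f *\<^sub>R (I *v u)) 0" for u v e
    by (simp add: bracket_dual[OF X] g_rep_l_elt matrix_vector_arith)
  have F0: "?F (std_dual e_f) e_f = - (2 *\<^sub>R bracket (l_elt 0 0 0 1 0 0 0 0 0 0) (?K (f/2) X1 X2 (1/2) 0 0))"
    unfolding std_dual_values codiff_term_def br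
    by (simp add: e_f_def g_rep_l_elt curvature_normalized_map_minus) (simp add: curvature_elt_def Let_def l_elt_zero outer_arith transpose_zero l_elt_eq_iff)
  have Fx: "?F (std_dual (e_x i)) (e_x i) = ?K 0 0 (- (f/2) *\<^sub>R (I *v ?e i)) 0 (?e i) 0
      - 2 *\<^sub>R bracket (l_elt 0 ((1/2) *\<^sub>R ?e i) 0 0 0 0 0 0 0 0) (?K (f/2) X1 X2 0 (?e i) 0)" for i
    unfolding std_dual_values codiff_term_def br
    by (simp add: e_x_def g_rep_l_elt curvature_normalized_map_minus matrix_vector_arith)
  have Fy: "?F (std_dual (e_y i)) (e_y i) = ?K 0 ((f/2) *\<^sub>R ?e i) 0 0 0 (I *v ?e i)
      - 2 *\<^sub>R bracket (l_elt 0 0 ((1/2) *\<^sub>R ?e i) 0 0 0 0 0 0 0) (?K (f/2) X1 X2 0 0 (I *v ?e i))" for i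
    unfolding std_dual_values codiff_term_def br
    by (simp add: e_y_def g_rep_l_elt curvature_normalized_map_minus matrix_vector_arith)
  note bd = bracket_dual[OF curvature_elt_sym[OF curvature_elt_def[unfolded Let_def]]]
  have ip: "V \<bullet> (I *v ?e i) = eps i * V $ i" "(I *v ?e i) \<bullet> V = eps i * V $ i"
    "V \<bullet> ?e i = V $ i" "?e i \<bullet> V = V $ i" for V i
    by (simp_all add: inner_axis' inner_axis inner_I_swap[of V]) (simp add: inner_I_swap[symmetric] inner_axis')
  have ax: "?e i $ j = (if i = j then 1 else 0)" for i j by (simp add: axis_def)
  \<comment> \<open>The summands are independent of the summation index except where it meets the index of the entry.\<close>
  have s: "(\<Sum>k\<in>UNIV. if k = i then g k else h k) = g i - h i + sum h UNIV"
    "(\<Sum>k\<in>UNIV. if i = k then g k else h k) = g i - h i + sum h UNIV" for g h :: "'n \<Rightarrow> real" and i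
  proof -
    have "(if k = i then g k else h k) = h k + (if k = i then g k - h k else 0)" for k by simp
    then show "(\<Sum>k\<in>UNIV. if k = i then g k else h k) = g i - h i + sum h UNIV"
      by (simp add: sum.distrib)
    then show "(\<Sum>k\<in>UNIV. if i = k then g k else h k) = g i - h i + sum h UNIV"
      by (simp add: eq_commute[of i])
  qed
  note arith = vec_eq_iff sum_component ip matrix_vector_arith inner_add_left inner_add_right inner_diff_left
    inner_diff_right n[symmetric] outer_arith
  show ?thesis
    unfolding sum_std_basis F0 Fx Fy
    unfolding curvature_elt_def Let_def
    by (simp only: bd l_elt_scaleR l_elt_diff sum_l_elt l_elt_add l_elt_scaleR[of "-1", simplified],
      rule l_elt_cong, simp_all add: arith, simp_all add: ax I_nth,
      simp_all add: algebra_simps sum.distrib sum_subtractf if_distrib if_distribR s n[symmetric] cong: if_cong,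
      simp_all add: field_simps s n[symmetric])
qed

text \<open>The two equations for \<open>p12, p21\<close> have the determinant \<open>(n+3)\<^sup>2 - (n-1)\<^sup>2 = 8(n+1)\<close>, the coefficients of
\<open>p11, p22, x, y, z\<close> are multiples of \<open>n + 1\<close>, and \<open>w\<close> enters \<open>E\<close> with the coefficient 3. So the
solution is unique for every \<open>n \<ge> 1\<close>.\<close>

lemma normal_normalized_map_iff:
  assumes n: "n = real CARD('n)"
  shows "normal c I (normalized_map p11 p12 p21 p22 x y z w) \<longleftrightarrow>
    p11 = - n / (2 * (n + 1)) \<and> p12 = 0 \<and> p21 = 0 \<and> p22 = - c * n / (2 * (n + 1)) \<and>
    x = 0 \<and> y = c / (n + 1) \<and> z = - 1 / (n + 1) \<and> w = - c * n^2 / (2 * (n + 1)^2)" (is "?N \<longleftrightarrow> ?P")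
proof -
  have n0: "n > 0" by (simp add: n)
  define E where "E = 2 * (p11 * p22 - p12 * p21) + 3 * w + y * p11 - x * p21 - p22 - x * p12 - z * p22 - c * p11"
  let ?S = "\<lambda>X1 X2 f. l_elt (- 2 * n * (p12 - p21) * f)
      (I *v ((n + p11 * (2 * n + 2)) *\<^sub>R X1 + ((n + 3) * p12 + (n - 1) * p21) *\<^sub>R X2))
      (((n - 1) * p12 + (n + 3) * p21) *\<^sub>R X1 + (p22 * (2 * n + 2) + c * n) *\<^sub>R X2)
      (n * E * f)
      0 0 ((x * (n + 1) * f) *\<^sub>R mat 1) (((y * (n + 1) - c) * f) *\<^sub>R I) (((z * (n + 1) + 1) * f) *\<^sub>R I) 0"
  have S: "(\<Sum>b\<in>std_basis. codiff_term (normalized_map p11 p12 p21 p22 x y z w) (l_elt d u v e X1 (I *v X2) A B C f) (std_dual b) b)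
      = ?S X1 X2 f" if "transpose B = B" "transpose C = C" for d u v e X1 X2 A B C f
    unfolding codifferential_normalized_map[OF n that] E_def ..
  have "?N \<longleftrightarrow> (\<forall>X1 X2 f. ?S X1 X2 f = 0)"
  proof
    assume N: "?N"
    show "\<forall>X1 X2 f. ?S X1 X2 f = 0"
    proof (intro allI)
      fix X1 X2 f
      have "l_elt 0 0 0 0 X1 (I *v X2) 0 0 0 f \<in> l_alg" by (simp add: l_elt_mem_iff transpose_zero)
      then show "?S X1 X2 f = 0"
        using N unfolding normal_iff_std_codifferential by (subst S[OF transpose_zero transpose_zero, symmetric]) blast
    qed
  next
    assume 0: "\<forall>X1 X2 f. ?S X1 X2 f = 0"
    show "?N" unfolding normal_iff_std_codifferential
    proof
      fix X :: "'n lmat" assume "X \<in> l_alg"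
      then obtain d u v e X1 X2 A B C f where "X = l_elt d u v e X1 X2 A B C f" "transpose B = B" "transpose C = C"
        by (rule l_algE)
      then show "(\<Sum>b\<in>std_basis. codiff_term (normalized_map p11 p12 p21 p22 x y z w) X (std_dual b) b) = 0"
        using S[of B C d u v e X1 "I *v X2" A f] 0 by simp
    qed
  qed
  also have "\<dots> \<longleftrightarrow> n + p11 * (2 * n + 2) = 0 \<and> (n + 3) * p12 + (n - 1) * p21 = 0 \<and> (n - 1) * p12 + (n + 3) * p21 = 0 \<and>
     p22 * (2 * n + 2) + c * n = 0 \<and> p12 - p21 = 0 \<and> E = 0 \<and> x = 0 \<and> y * (n + 1) - c = 0 \<and> z * (n + 1) + 1 = 0"
    (is "?L \<longleftrightarrow> ?R")
  proof
    assume L: ?L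
    fix i :: 'n
    let ?e = "axis i (1::real) :: real^'n"
    have 1: "?S ?e 0 0 = 0" and 2: "?S 0 ?e 0 = 0" and 3: "?S 0 0 1 = 0" using L by blast+
    have nz: "M \<noteq> 0" if "M $ i $ i \<noteq> 0" for M :: "real^'n^'n" using that by auto
    have "I \<noteq> 0" "(mat 1 :: real^'n^'n) \<noteq> 0" by (rule nz, simp add: I_nth)+
    moreover have "I *v ?e \<noteq> 0"
    proof
      assume "I *v ?e = 0"
      then have "(I *v ?e) $ i = 0" by simp
      then show False by (simp add: axis_def)
    qed
    ultimately show ?R
      using 1 2 3 n0
      unfolding l_elt_zero l_elt_eq_iff
      by (auto simp: matrix_vector_arith axis_eq_0_iff)
  next
    assume R: ?R
    then have "p12 = p21" by simp
    moreover have "(n + 3) * p12 + (n - 1) * p21 = 0" using R by blast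
    ultimately have "(2 * n + 2) * p12 = 0" by (simp add: algebra_simps)
    moreover note \<open>p12 = p21\<close>
    ultimately have "p12 = 0" "p21 = 0" using n0 by auto
    then show ?L using R by (simp add: l_elt_zero l_elt_eq_iff)
  qed
  also have "\<dots> \<longleftrightarrow> ?P"
  proof -
  \<comment> \<open>In terms of \<open>r\<close> all identities follow from \<open>n r = n\<^sup>2 r\<^sup>2 + n r\<^sup>2\<close>.\<close>
  define r where "r = 1 / (n + 1)"
  have "r * (n + 1) = 1" using n0 by (simp add: r_def)
  then have "n * r * (r * (n + 1)) = n * r" by simp
  then have nr: "n * r = n^2 * r^2 + n * r^2" by (simp add: algebra_simps power2_eq_square)
  have quadratic: "2 * p11 * p22 + y * p11 - p22 - z * p22 - c * p11 = 3 / 2 * c * n^2 * r^2"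
    if "p11 = - n * r / 2" "p22 = - c * n * r / 2" "y = c * r" "z = - r"
  proof -
    have "2 * p11 * p22 + y * p11 - p22 - z * p22 - c * p11 = c * (n^2 * r^2 / 2 - n * r^2 + n * r)"
      unfolding that by (simp add: algebra_simps power2_eq_square)
    then show ?thesis unfolding nr by (simp add: algebra_simps)
  qed
  show ?thesis
  proof
    assume R: ?R
    then have "p12 = p21" by simp
    moreover have "(n + 3) * p12 + (n - 1) * p21 = 0" using R by blast
    ultimately have "(2 * n + 2) * p12 = 0" by (simp add: algebra_simps)
    moreover note \<open>p12 = p21\<close>
    ultimately have 1: "p12 = 0" "p21 = 0" using n0 by auto
    have 2: "p11 = - n * r / 2" "p22 = - c * n * r / 2" "y = c * r" "z = - r"
      using R n0 by (simp_all add: r_def field_simps)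
    have "3 * w = - (2 * p11 * p22 + y * p11 - p22 - z * p22 - c * p11)" using R by (simp add: E_def 1)
    also have "\<dots> = - (3 / 2 * c * n^2 * r^2)" by (simp only: quadratic[OF 2])
    finally have "w = - c * n^2 * r^2 / 2" by simp
    then show ?P using R 1 2 by (simp add: r_def power_divide)
  next
    assume P: ?P
    then have 2: "p11 = - n * r / 2" "p22 = - c * n * r / 2" "y = c * r" "z = - r" "w = - c * n^2 * r^2 / 2"
      by (simp_all add: r_def power_divide)
    have "E = (2 * p11 * p22 + y * p11 - p22 - z * p22 - c * p11) + 3 * w" using P by (simp add: E_def)
    also have "\<dots> = 0" unfolding quadratic[OF 2(1-4)] by (simp add: 2)
    finally have "E = 0" .
    then show ?R using P n0 by (simp add: field_simps)
  qed
  qed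
  finally show ?thesis .
qed

section \<open>The normal extension\<close>

definition alpha :: "'n gmat \<Rightarrow> 'n lmat" where
  "alpha = (let n = real CARD('n) in
     normalized_map (- n / (2 * (n + 1))) 0 0 (- c * n / (2 * (n + 1))) 0 (c / (n + 1)) (- 1 / (n + 1))
       (- c * n^2 / (2 * (n + 1)^2)))"

lemma extension_alpha: "extension c I alpha"
  by (simp add: alpha_def Let_def extension_normalized_map)

lemma normal_alpha: "normal c I alpha"
  unfolding alpha_def Let_def normal_normalized_map_iff[OF refl] by simp

lemma curvature_alpha:
  assumes n: "n = real CARD('n)" and A: "A \<in> form_algebra I" and B: "B \<in> form_algebra I"
  shows "curvature alpha (g_elt c I a X1 X2 A) (g_elt c I b Y1 Y2 B) =
    (let om = X2 \<bullet> (I *v Y1) - X1 \<bullet> (I *v Y2) in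
     l_elt 0 0 0 0 0 0
       (((n + 2) / (2 * (n + 1))) *\<^sub>R ((outer X1 Y1 - outer Y1 X1 + c *\<^sub>R outer X2 Y2 - c *\<^sub>R outer Y2 X2) ** I))
       (- (c * n / (2 * (n + 1))) *\<^sub>R (outer X1 Y2 - outer X2 Y1 - outer Y1 X2 + outer Y2 X1) - (c / (n + 1) * om) *\<^sub>R I)
       ((n / (2 * (n + 1))) *\<^sub>R (I ** (outer X1 Y2 - outer X2 Y1 + outer Y2 X1 - outer Y1 X2) ** I) + (1 / (n + 1) * om) *\<^sub>R I)
       0)"
proof -
  have n0: "n > 0" by (simp add: n)
  define r p11 p22 y z w where d: "r = 1 / (n + 1)" "p11 = - n / (2 * (n + 1))" "p22 = - c * n / (2 * (n + 1))"
    "y = c / (n + 1)" "z = - 1 / (n + 1)" "w = - c * n^2 / (2 * (n + 1)^2)"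
  have p: "p11 = - n * r / 2" "p22 = - c * n * r / 2" "y = c * r" "z = - r" "w = - c * n^2 * r^2 / 2"
    by (simp_all add: d power_divide)
  have "r * (n + 1) = 1" using n0 by (simp add: d)
  then have "n * r * (r * (n + 1)) = n * r" by simp
  then have nr: "n * r = n^2 * r^2 + n * r^2" by (simp add: algebra_simps power2_eq_square)
  have "z * p22 - w + c * p11 = c / 2 * (n * r^2 + n^2 * r^2 - n * r)"
    "y * p11 + w - p22 = - c / 2 * (n * r^2 + n^2 * r^2 - n * r)"
    by (simp_all add: p algebra_simps power2_eq_square)
  then have k: "z * p22 - w + c * p11 = 0" "y * p11 + w - p22 = 0" by (simp_all add: nr)
  have k': "2 * (p11 * p22) + w = 0" by (simp add: p algebra_simps power2_eq_square)
  have nr': "n * r = 1 - r" using \<open>r * (n + 1) = 1\<close> by (simp add: algebra_simps)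
  have q: "(n + 2) / (2 * (n + 1)) = (n * r + 2 * r) / 2" by (simp add: d(1) add_divide_distrib algebra_simps)
  have cn: "c * n * r = c * (1 - r)" using nr' by (metis mult.assoc)
  have k'': "y - 2 * p22 - c = 0" "z + 2 * p11 + 1 = 0" "p11 + 1 = (n + 2) / (2 * (n + 1))"
    "p22 + c = (n + 2) / (2 * (n + 1)) * c"
    unfolding q using nr' cn by (simp_all add: p field_simps)
  have cv: "curvature_elt p11 0 0 p22 0 y z w a X1 X2 b Y1 Y2 =
    (let om = X2 \<bullet> (I *v Y1) - X1 \<bullet> (I *v Y2) in
     l_elt 0 0 0 0 0 0
       ((p11 + 1) *\<^sub>R (outer X1 Y1 - outer Y1 X1) ** I + (p22 + c) *\<^sub>R (outer X2 Y2 - outer Y2 X2) ** I)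
       (p22 *\<^sub>R (outer X1 Y2 - outer X2 Y1 - outer Y1 X2 + outer Y2 X1) - (y * om) *\<^sub>R I)
       (p11 *\<^sub>R (I ** (outer X2 Y1 - outer X1 Y2 - outer Y2 X1 + outer Y1 X2) ** I) - (z * om) *\<^sub>R I)
       0)"
    unfolding curvature_elt_def Let_def l_elt_eq_iff
    using k k' k''(1,2) by (simp add: matmul.add_left)
  have "alpha = normalized_map p11 0 0 p22 0 y z w" by (simp add: alpha_def n[symmetric] d)
  then have "curvature alpha (g_elt c I a X1 X2 A) (g_elt c I b Y1 Y2 B) = curvature_elt p11 0 0 p22 0 y z w a X1 X2 b Y1 Y2"
    by (simp add: curvature_normalized_map[OF A B])
  also have "\<dots> = (let om = X2 \<bullet> (I *v Y1) - X1 \<bullet> (I *v Y2) in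
     l_elt 0 0 0 0 0 0
       (((n + 2) / (2 * (n + 1))) *\<^sub>R ((outer X1 Y1 - outer Y1 X1 + c *\<^sub>R outer X2 Y2 - c *\<^sub>R outer Y2 X2) ** I))
       (- (c * n / (2 * (n + 1))) *\<^sub>R (outer X1 Y2 - outer X2 Y1 - outer Y1 X2 + outer Y2 X1) - (c / (n + 1) * om) *\<^sub>R I)
       ((n / (2 * (n + 1))) *\<^sub>R (I ** (outer X1 Y2 - outer X2 Y1 + outer Y2 X1 - outer Y1 X2) ** I) + (1 / (n + 1) * om) *\<^sub>R I)
       0)"
    unfolding cv Let_def l_elt_eq_iff k''
    by (intro conjI) (simp_all add: d(2-6) vec_eq_iff algebra_simps)
  finally show ?thesis .
qed

text \<open>The curvature of \<open>alpha\<close> has values in \<open>\<ll>\<^sub>0\<close>, which has higher degree than regularity demands.\<close>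

lemma regular_alpha: "regular c I alpha"
  unfolding regular_def
proof (intro allI impI ballI)
  fix i j :: int and X Y :: "'n lmat"
  assume ij: "i < 0 \<and> j < 0" and "X \<in> l_deg i" "Y \<in> l_deg j"
  then have X: "X \<in> l_alg" and Y: "Y \<in> l_alg" by (auto simp: l_deg_def)
  have "alpha (g_rep X) - X \<in> p_alg" "alpha (g_rep Y) - Y \<in> p_alg"
    using normalized_map_g_rep[OF X] normalized_map_g_rep[OF Y] by (simp_all add: alpha_def Let_def)
  then have "curv_lp c I alpha X Y = curvature alpha (g_rep X) (g_rep Y)"
    using curv_lp_eq[OF extension_alpha g_rep_mem _ g_rep_mem] by blast
  also have "\<dots> \<in> l_deg 0"
    unfolding g_rep_def curvature_alpha[OF refl zero_so zero_so] Let_def l_elt_mem_deg_0_iff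
    by (auto simp: transpose_def vec_eq_iff I_nth algebra_simps)
  also have "l_deg 0 \<subseteq> (l_filt (i + j + 1) :: 'n lmat set)" using ij by (intro l_deg_filt) simp
  finally show "curv_lp c I alpha X Y \<in> l_filt (i + j + 1)" .
qed

section \<open>Gauge transformations\<close>

lemma Ad_add: "Ad M (X + Y) = Ad M X + Ad M Y"
  by (simp add: Ad_def matmul.add_left matmul.add_right)

lemma Ad_scaleR: "Ad M (t *\<^sub>R X) = t *\<^sub>R Ad M X"
  by (simp add: Ad_def matmul.scaleR_left matmul.scaleR_right)

lemma Ad_diff: "Ad M (X - Y) = Ad M X - Ad M Y"
  by (simp add: Ad_def matmul.diff_left matmul.diff_right)

lemma linear_Ad: "linear (Ad M)"
  by (rule linearI) (simp_all add: Ad_add Ad_scaleR)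

end

lemma Ad_mult:
  fixes M N :: "real^'m^'m"
  assumes "M ** M' = mat 1" "N ** N' = mat 1"
  shows "Ad (M ** N) X = Ad M (Ad N X)"
  by (simp add: Ad_def matrix_inv_matrix_mult[OF assms] matrix_mul_assoc)

lemma Ad_one: "Ad (mat 1) X = (X :: real^'m^'m)"
  using matrix_inv_eqI[of "mat 1" "mat 1 :: real^'m^'m"] by (simp add: Ad_def)

lemma Ad_commute:
  fixes M N :: "real^'m^'m"
  assumes "M ** M' = mat 1" "M ** N = N ** M"
  shows "Ad M N = N"
proof -
  have "Ad M N = N ** (M ** matrix_inv M)" by (simp add: Ad_def assms(2) matrix_mul_assoc)
  then show ?thesis by (simp add: matrix_inv_inverse[OF assms(1)])
qed

lemma Ad_bracket:
  fixes M :: "real^'m^'m"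
  assumes "M ** M' = mat 1"
  shows "Ad M (bracket X Y) = bracket (Ad M X) (Ad M Y)"
proof -
  have "Ad M X ** Ad M Y = M ** X ** (matrix_inv M ** M) ** Y ** matrix_inv M" for X Y
    by (simp add: Ad_def matrix_mul_assoc)
  then have *: "Ad M X ** Ad M Y = M ** (X ** Y) ** matrix_inv M" for X Y
    by (simp add: matrix_inv_inverse[OF assms] matrix_mul_assoc)
  show ?thesis unfolding bracket_def * by (simp add: Ad_def matmul.diff_left matmul.diff_right)
qed

lemma commute_inverse:
  fixes M :: "real^'m^'m"
  assumes "M ** M' = mat 1" "M' ** M = mat 1" "M ** K = K ** M"
  shows "M' ** K = K ** M'"
proof -
  have "M' ** (M ** K) ** M' = M' ** (K ** M) ** M'" by (simp add: assms)
  then have "(M' ** M) ** K ** M' = M' ** K ** (M ** M')" by (simp add: matrix_mul_assoc)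
  then show ?thesis by (simp add: assms)
qed

lemma trace_Ad:
  fixes M :: "real^'m^'m"
  assumes "M ** M' = mat 1"
  shows "trace (Ad M X ** Ad M Y) = trace (X ** Y)"
proof -
  have "Ad M X ** Ad M Y = M ** X ** (matrix_inv M ** M) ** Y ** matrix_inv M"
    by (simp add: Ad_def matrix_mul_assoc)
  then have "trace (Ad M X ** Ad M Y) = trace (M ** (X ** Y ** matrix_inv M))"
    by (simp add: matrix_inv_inverse[OF assms] matrix_mul_assoc)
  also have "\<dots> = trace (X ** Y ** (matrix_inv M ** M))" by (subst trace_mul_sym) (simp add: matrix_mul_assoc)
  finally show ?thesis by (simp add: matrix_inv_inverse[OF assms])
qed

text \<open>The elements of \<open>G\<close> and \<open>P\<close> that centralize \<open>K\<close> and \<open>i(K)\<close>. It is convenient to require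
commutation with \<open>k_elt A\<close> and \<open>i_hom I A\<close> for all matrices \<open>A\<close>: as these are affine in \<open>A\<close>,
differences of them give commutation with \<open>\<kk>\<close> and its image.\<close>

locale gauge = sign_setting I c for I :: "real^'n^'n" and c +
  fixes h :: "'n gmat" and N :: "'n lmat"
  assumes h: "h \<in> form_group gram_G" and N: "N \<in> P_lift" and N': "matrix_inv N \<in> P_lift"
    and h_comm: "\<And>A. h ** k_elt A = k_elt A ** h" and N_comm: "\<And>A. N ** i_hom I A = i_hom I A ** N"
begin

abbreviation "hi \<equiv> matrix_inv h"
abbreviation "Ni \<equiv> matrix_inv N"

lemma h_inv: "h ** hi = mat 1" "hi ** h = mat 1" using G.inv_eq[OF h] by auto
lemma N_inv: "N ** Ni = mat 1" "Ni ** N = mat 1"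
  using symp.inv_eq[of N] N by (auto simp: P_lift_def)

lemma Ad_cancel: "Ad h (Ad hi x) = x" "Ad hi (Ad h x) = x" "Ad N (Ad Ni X) = X" "Ad Ni (Ad N X) = X"
  using Ad_mult[OF h_inv] Ad_mult[OF h_inv(2,1)] Ad_mult[OF N_inv] Ad_mult[OF N_inv(2,1)]
  by (simp_all add: h_inv N_inv Ad_one flip: Ad_mult)

lemma gauge_inverse: "gauge I c hi Ni"
proof unfold_locales
  show "hi \<in> form_group gram_G" by (rule G.inv_mem[OF h])
  have "matrix_inv Ni = N" by (rule matrix_inv_eqI[OF N_inv(2)])
  then show "matrix_inv Ni \<in> P_lift" using N by simp
  show "hi ** k_elt A = k_elt A ** hi" for A by (rule commute_inverse[OF h_inv h_comm])
  show "Ni ** i_hom I A = i_hom I A ** Ni" for A by (rule commute_inverse[OF N_inv N_comm])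
qed (fact N')

lemma Ad_g_alg: "x \<in> g_alg c I \<Longrightarrow> Ad h x \<in> g_alg c I"
  unfolding g_alg_eq by (rule G.Ad_mem[OF h])

lemma Ad_l_alg: "X \<in> l_alg \<Longrightarrow> Ad N X \<in> l_alg"
  using N unfolding l_alg_def P_lift_def by (intro symp.Ad_mem) auto

lemma Ad_l_filt: "X \<in> l_filt k \<Longrightarrow> Ad N X \<in> l_filt k"
  by (rule Ad_filt[OF N N'])

lemma Ad_k_fixed: "Ad h (g_elt c I 0 0 0 A) = g_elt c I 0 0 0 A"
proof (rule Ad_commute[OF h_inv(1)])
  have "g_elt c I 0 0 0 A = k_elt A - k_elt 0" by (simp add: g_elt_eq k_elt_def g_block_diff)
  then show "h ** g_elt c I 0 0 0 A = g_elt c I 0 0 0 A ** h"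
    by (simp add: matmul.diff_left matmul.diff_right h_comm)
qed

lemma Ad_i_fixed: "Ad N (i_deriv I A) = i_deriv I A"
proof (rule Ad_commute[OF N_inv(1)])
  have "i_deriv I A = i_hom I A - i_hom I 0" by (simp add: i_deriv_def i_hom_def l_block_diff)
  then show "N ** i_deriv I A = i_deriv I A ** N"
    by (simp add: matmul.diff_left matmul.diff_right N_comm)
qed

definition transform :: "('n gmat \<Rightarrow> 'n lmat) \<Rightarrow> 'n gmat \<Rightarrow> 'n lmat" where
  "transform \<beta> x = Ad N (\<beta> (Ad h x))"

lemma extension_transform:
  assumes ext: "extension c I \<beta>"
  shows "extension c I (transform \<beta>)"
proof -
  interpret inv: gauge I c hi Ni by (rule gauge_inverse)
  have mem: "\<beta> X \<in> l_alg" if "X \<in> g_alg c I" for X using ext that by (simp add: extension_def)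
  have add: "\<beta> (X + Y) = \<beta> X + \<beta> Y" if "X \<in> g_alg c I" "Y \<in> g_alg c I" for X Y
    using ext that unfolding extension_def by blast
  have scale: "\<beta> (t *\<^sub>R X) = t *\<^sub>R \<beta> X" if "X \<in> g_alg c I" for X t
    using ext that unfolding extension_def by blast
  have equ: "\<beta> (Ad (k_elt A) X) = Ad (i_hom I A) (\<beta> X)" if "A \<in> form_group I" "X \<in> g_alg c I" for A X
    using ext that unfolding extension_def by blast
  have k: "\<beta> (g_elt c I 0 0 0 A) = i_deriv I A" if "A \<in> form_algebra I" for A
    using ext that unfolding extension_def by blast
  have inj: "x \<in> k_alg c I" if "x \<in> g_alg c I" "\<beta> x \<in> p_alg" for x
    using ext that unfolding extension_def by blast
  have sur: "\<exists>x\<in>g_alg c I. \<beta> x - Y \<in> p_alg" if "Y \<in> l_alg" for Y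
    using ext that unfolding extension_def by blast
  show ?thesis
    unfolding extension_def
  proof (intro conjI ballI allI impI)
    fix x y t assume x: "x \<in> g_alg c I"
    show "transform \<beta> x \<in> l_alg" unfolding transform_def by (intro Ad_l_alg mem Ad_g_alg x)
    show "transform \<beta> (x + y) = transform \<beta> x + transform \<beta> y" if y: "y \<in> g_alg c I"
      by (simp add: transform_def Ad_add add[OF Ad_g_alg[OF x] Ad_g_alg[OF y]])
    show "transform \<beta> (t *\<^sub>R x) = t *\<^sub>R transform \<beta> x"
      by (simp add: transform_def Ad_scaleR scale[OF Ad_g_alg[OF x]])
    show "transform \<beta> (Ad (k_elt A) x) = Ad (i_hom I A) (transform \<beta> x)" if A: "A \<in> form_group I" for A
    proof -
      note ki = k_elt_inv(2)[OF A] and ii = i_hom_inv(2)[OF A]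
      have "Ad h (Ad (k_elt A) x) = Ad (k_elt A) (Ad h x)"
        unfolding Ad_mult[OF h_inv(1) ki, symmetric] Ad_mult[OF ki h_inv(1), symmetric] h_comm ..
      moreover have "Ad N (Ad (i_hom I A) Y) = Ad (i_hom I A) (Ad N Y)" for Y
        unfolding Ad_mult[OF N_inv(1) ii, symmetric] Ad_mult[OF ii N_inv(1), symmetric] N_comm ..
      ultimately show ?thesis by (simp add: transform_def equ[OF A Ad_g_alg[OF x]])
    qed
    show "x \<in> k_alg c I" if "transform \<beta> x \<in> p_alg"
    proof -
      have "Ad Ni (transform \<beta> x) \<in> p_alg" by (rule inv.Ad_l_filt[OF that])
      then have "Ad h x \<in> k_alg c I" by (intro inj Ad_g_alg x) (simp add: transform_def Ad_cancel)
      then obtain A where "Ad h x = g_elt c I 0 0 0 A" "A \<in> form_algebra I" by (auto simp: k_alg_def)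
      moreover from this(1) have "x = g_elt c I 0 0 0 A"
        using Ad_cancel(2)[of x] inv.Ad_k_fixed[of A] by simp
      ultimately show ?thesis by (auto simp: k_alg_def)
    qed
  next
    show "transform \<beta> (g_elt c I 0 0 0 A) = i_deriv I A" if "A \<in> form_algebra I" for A
      by (simp add: transform_def Ad_k_fixed k[OF that] Ad_i_fixed)
    fix Y :: "'n lmat" assume "Y \<in> l_alg"
    then obtain x where x: "x \<in> g_alg c I" "\<beta> x - Ad Ni Y \<in> p_alg" using sur inv.Ad_l_alg by blast
    have "transform \<beta> (Ad hi x) - Y = Ad N (\<beta> x - Ad Ni Y)"
      by (simp add: transform_def Ad_cancel Ad_diff)
    then show "\<exists>x\<in>g_alg c I. transform \<beta> x - Y \<in> p_alg"
      using Ad_l_filt[OF x(2)] inv.Ad_g_alg[OF x(1)] by metis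
  qed
qed

text \<open>An element of \<open>\<gg>\<close> representing \<open>X\<close> for the transformed extension is moved by \<open>Ad(h)\<close> to one that
represents \<open>Ad(N)\<^sup>-\<^sup>1 X\<close> for the original one.\<close>

lemma curv_lp_transform:
  assumes ext: "extension c I \<beta>" and X: "X \<in> l_alg" and Y: "Y \<in> l_alg"
  shows "curv_lp c I (transform \<beta>) X Y = Ad N (curv_lp c I \<beta> (Ad Ni X) (Ad Ni Y))"
proof -
  interpret inv: gauge I c hi Ni by (rule gauge_inverse)
  note ext' = extension_transform[OF ext]
  have L: "Ad h x \<in> g_alg c I \<and> \<beta> (Ad h x) - Ad Ni X \<in> p_alg"
    if "x \<in> g_alg c I" "transform \<beta> x - X \<in> p_alg" for x X
    using inv.Ad_l_filt[OF that(2)] Ad_g_alg[OF that(1)] by (simp add: transform_def Ad_diff Ad_cancel)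
  let ?x = "lift c I (transform \<beta>) X" and ?y = "lift c I (transform \<beta>) Y"
  note lx = lift_spec[OF ext' X] and ly = lift_spec[OF ext' Y]
  have "curv_lp c I \<beta> (Ad Ni X) (Ad Ni Y) = curvature \<beta> (Ad h ?x) (Ad h ?y)"
    using L[OF lx] L[OF ly] by (intro curv_lp_eq[OF ext]) auto
  then show ?thesis
    by (simp add: curv_lp_def[of c I "transform \<beta>"] curvature_def transform_def Ad_diff
      Ad_bracket[OF N_inv(1)] Ad_bracket[OF h_inv(1)])
qed

lemma dual_bases_transform:
  assumes BZ: "dual_bases B Z"
  shows "dual_bases (Ad Ni ` B) (\<lambda>b. Ad Ni (Z (Ad N b)))"
proof -
  interpret inv: gauge I c hi Ni by (rule gauge_inverse)
  have inj: "inj_on (Ad Ni) B" by (rule inj_on_inverseI[where g = "Ad N"]) (simp add: Ad_cancel)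
  have sum: "(\<Sum>b\<in>Ad Ni ` B. u b *\<^sub>R b) = Ad Ni (\<Sum>b\<in>B. u (Ad Ni b) *\<^sub>R b)" for u
    by (simp add: sum.reindex[OF inj] linear_sum[OF linear_Ad] Ad_scaleR)
  show ?thesis unfolding dual_bases_def
  proof (intro conjI allI ballI impI)
    show "finite (Ad Ni ` B)" "Ad Ni ` B \<subseteq> l_alg" using BZ inv.Ad_l_alg by (auto simp: dual_bases_def)
    fix Y :: "'n lmat" assume "Y \<in> l_alg"
    then obtain u where u: "Ad N Y - (\<Sum>b\<in>B. u b *\<^sub>R b) \<in> p_alg"
      using BZ Ad_l_alg unfolding dual_bases_def by blast
    have "Y - (\<Sum>b\<in>Ad Ni ` B. u (Ad N b) *\<^sub>R b) = Ad Ni (Ad N Y - (\<Sum>b\<in>B. u b *\<^sub>R b))"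
      unfolding sum by (simp add: Ad_cancel Ad_diff)
    then show "\<exists>u. Y - (\<Sum>b\<in>Ad Ni ` B. u b *\<^sub>R b) \<in> p_alg"
      using inv.Ad_l_filt[OF u] by (intro exI[of _ "\<lambda>b. u (Ad N b)"]) (simp only:)
  next
    fix u b assume u: "(\<Sum>b\<in>Ad Ni ` B. u b *\<^sub>R b) \<in> p_alg" and b: "b \<in> Ad Ni ` B"
    have "(\<Sum>b\<in>B. u (Ad Ni b) *\<^sub>R b) \<in> p_alg" using Ad_l_filt[OF u] unfolding sum by (simp add: Ad_cancel)
    moreover have "\<forall>u. (\<Sum>b\<in>B. u b *\<^sub>R b) \<in> p_alg \<longrightarrow> (\<forall>b\<in>B. u b = 0)"
      using BZ unfolding dual_bases_def by blast
    from this[rule_format, of "\<lambda>b. u (Ad Ni b)"] calculation have "\<forall>b\<in>B. u (Ad Ni b) = 0" by blast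
    then show "u b = 0" using b by auto
  next
    fix b assume "b \<in> Ad Ni ` B"
    then show "Ad Ni (Z (Ad N b)) \<in> l_filt 1" using BZ by (auto simp: Ad_cancel dual_bases_def intro!: inv.Ad_l_filt)
    fix b' assume "b' \<in> Ad Ni ` B"
    then obtain b0 b0' where 0: "b0 \<in> B" "b0' \<in> B" "b = Ad Ni b0" "b' = Ad Ni b0'" using \<open>b \<in> _\<close> by auto
    then show "trace (Ad Ni (Z (Ad N b)) ** b') = (if b = b' then 1 else 0)"
      using BZ inj_onD[OF inj, of b0 b0'] by (auto simp: Ad_cancel trace_Ad[OF N_inv(2)] dual_bases_def)
  qed
qed

text \<open>The normality condition is natural under \<open>Ad(N)\<close>: apply it to the dual bases moved by \<open>Ad(N)\<^sup>-\<^sup>1\<close>.\<close>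

lemma normal_transform:
  assumes ext: "extension c I \<beta>" and norm: "normal c I \<beta>"
  shows "normal c I (transform \<beta>)"
  unfolding normal_def
proof (intro allI impI ballI)
  interpret inv: gauge I c hi Ni by (rule gauge_inverse)
  fix B :: "'n lmat set" and Z and X :: "'n lmat" assume BZ: "dual_bases B Z" and X: "X \<in> l_alg"
  have inj: "inj_on (Ad Ni) B" by (rule inj_on_inverseI[where g = "Ad N"]) (simp add: Ad_cancel)
  have m: "b \<in> l_alg" "Z b \<in> l_alg" if "b \<in> B" for b
    using BZ that by (auto simp: dual_bases_def l_filt_def)
  let ?k = "curv_lp c I \<beta>" and ?k' = "curv_lp c I (transform \<beta>)"
  have "(\<Sum>b\<in>Ad Ni ` B. ?k (bracket (Ad Ni (Z (Ad N b))) (Ad Ni X)) b)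
      = 2 *\<^sub>R (\<Sum>b\<in>Ad Ni ` B. bracket (Ad Ni (Z (Ad N b))) (?k (Ad Ni X) b))"
    using norm dual_bases_transform[OF BZ] inv.Ad_l_alg[OF X] unfolding normal_def by blast
  then have "(\<Sum>b\<in>B. ?k (bracket (Ad Ni (Z b)) (Ad Ni X)) (Ad Ni b))
      = 2 *\<^sub>R (\<Sum>b\<in>B. bracket (Ad Ni (Z b)) (?k (Ad Ni X) (Ad Ni b)))"
    by (simp add: sum.reindex[OF inj] Ad_cancel)
  then have "Ad N (\<Sum>b\<in>B. ?k (bracket (Ad Ni (Z b)) (Ad Ni X)) (Ad Ni b))
      = Ad N (2 *\<^sub>R (\<Sum>b\<in>B. bracket (Ad Ni (Z b)) (?k (Ad Ni X) (Ad Ni b))))" by simp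
  then show "(\<Sum>b\<in>B. ?k' (bracket (Z b) X) b) = 2 *\<^sub>R (\<Sum>b\<in>B. bracket (Z b) (?k' X b))"
    by (simp add: linear_sum[OF linear_Ad] Ad_scaleR Ad_bracket[OF N_inv(1)] Ad_cancel
      curv_lp_transform[OF ext] m X bracket_l_alg Ad_bracket[OF N_inv(2), symmetric] cong: sum.cong)
qed

end

section \<open>Gauge transformations as bundle morphisms\<close>

text \<open>The smoothness of bundle morphisms reduces to this, because those constructed below are induced by
linear maps of the ambient matrix spaces.\<close>

lemma Ck_on_compose_linear:
  assumes T: "bounded_linear T"
  shows "Ck_on k U f \<Longrightarrow> Ck_on k (T -` U) (\<lambda>x. f (T x))"
proof (induction k arbitrary: f)
  case 0
  then show ?case
    using continuous_on_compose2[of U f "T -` U" T] linear_continuous_on[OF T] by auto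
next
  case (Suc k)
  then obtain f' where f': "\<And>x. x \<in> U \<Longrightarrow> (f has_derivative f' x) (at x)" "\<And>v. Ck_on k U (\<lambda>x. f' x v)"
    by auto
  have "((\<lambda>x. f (T x)) has_derivative (\<lambda>v. f' (T x) (T v))) (at x)" if "x \<in> T -` U" for x
    using has_derivative_compose[OF bounded_linear.has_derivative[OF T has_derivative_ident], of f "f' (T x)" x UNIV]
      f'(1)[of "T x"] that by simp
  moreover have "Ck_on k (T -` U) (\<lambda>x. f' (T x) (T v))" for v
    using Suc.IH[OF f'(2)[of "T v"]] by simp
  ultimately show ?case by (auto intro!: exI[of _ "\<lambda>x v. f' (T x) (T v)"])
qed

context sign_setting
begin

lemma bundle_rel_refl:
  assumes "x \<in> GP c I" shows "(x, x) \<in> bundle_rel c I"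
proof -
  have "k_elt (mat 1) = (mat 1 :: 'n gmat)" by (simp add: k_elt_def g_block_one)
  moreover have "i_hom I (mat 1) = mat 1" by (simp add: i_hom_def l_block_one)
  moreover have "matrix_inv (mat 1) = (mat 1 :: 'n lmat)" by (rule matrix_inv_eqI) simp
  ultimately show ?thesis
    using assms O.one_mem unfolding bundle_rel_def by (cases x) (auto intro!: bexI[of _ "mat 1"])
qed

lemma proj_eq_imp_rel:
  assumes "y \<in> GP c I" "proj c I x = proj c I y"
  shows "(x, y) \<in> bundle_rel c I"
  using bundle_rel_refl[OF assms(1)] assms(2) by (auto simp: proj_def)

end

context gauge
begin

definition shift :: "'n gmat \<times> 'n lmat \<Rightarrow> 'n gmat \<times> 'n lmat" where
  "shift x = (fst x ** h, N ** snd x)"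

lemma shift_GP: "x \<in> GP c I \<Longrightarrow> shift x \<in> GP c I"
  using G.mult_mem[OF _ h] P_lift_mult[OF N] by (auto simp: GP_def shift_def G_grp_eq)

lemma shift_rel:
  assumes "(x, y) \<in> bundle_rel c I"
  shows "(shift x, shift y) \<in> bundle_rel c I"
proof -
  obtain g M g' M' where xy: "x = (g, M)" "y = (g', M')" by (cases x, cases y)
  have "(g, M) \<in> GP c I \<and> (g', M') \<in> GP c I \<and> (\<exists>A\<in>form_group I. \<exists>s\<in>{1, -1}.
      g' = g ** k_elt A \<and> M' = s *\<^sub>R (matrix_inv (i_hom I A) ** M))"
    using assms unfolding xy bundle_rel_def by simp
  then obtain A s where A: "A \<in> form_group I" "s \<in> {1, -1}" "g' = g ** k_elt A"
    "M' = s *\<^sub>R (matrix_inv (i_hom I A) ** M)" and GP: "x \<in> GP c I" "y \<in> GP c I"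
    unfolding xy by blast
  have "g' ** h = (g ** h) ** k_elt A" by (simp add: A matrix_mul_assoc[symmetric] h_comm)
  moreover have "N ** M' = s *\<^sub>R (matrix_inv (i_hom I A) ** (N ** M))"
    by (simp add: A i_hom_inv[OF A(1)] matmul.scaleR_right matrix_mul_assoc N_comm)
  ultimately show ?thesis
    using shift_GP[OF GP(1)] shift_GP[OF GP(2)] A(1,2) unfolding bundle_rel_def xy shift_def by auto
qed

text \<open>Since \<open>h\<close> and \<open>N\<close> centralize \<open>K\<close> and \<open>i(K)\<close>, the map \<open>shift\<close> and its inverse both respect the
equivalence relation. Hence it maps classes onto classes.\<close>

lemma shift_proj:
  assumes "x \<in> GP c I"
  shows "shift ` proj c I x = proj c I (shift x)"
proof -
  interpret inv: gauge I c hi Ni by (rule gauge_inverse)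
  have 1: "inv.shift (shift y) = y" "shift (inv.shift y) = y" for y
    by (simp_all add: shift_def inv.shift_def matrix_mul_assoc h_inv N_inv)
     (simp_all add: matrix_mul_assoc[symmetric] h_inv N_inv)
  show ?thesis
  proof (rule subset_antisym)
    show "shift ` proj c I x \<subseteq> proj c I (shift x)" using shift_rel by (auto simp: proj_def)
    show "proj c I (shift x) \<subseteq> shift ` proj c I x"
    proof
      fix y assume "y \<in> proj c I (shift x)"
      then have "(inv.shift (shift x), inv.shift y) \<in> bundle_rel c I"
        by (intro inv.shift_rel) (simp add: proj_def)
      then have "inv.shift y \<in> proj c I x" by (simp add: 1 proj_def)
      then show "y \<in> shift ` proj c I x" using 1(2)[of y] by force
    qed
  qed
qed

lemma bounded_linear_shift: "bounded_linear shift"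
  unfolding linear_conv_bounded_linear[symmetric]
  by (auto intro!: linearI simp: shift_def matmul.add_left matmul.add_right matmul.scaleR_left matmul.scaleR_right)

lemma bundle_morphism_shift: "bundle_morphism c I ((`) shift)"
  unfolding bundle_morphism_def
proof (intro conjI ballI allI impI)
  fix u assume "u \<in> total_space c I"
  then obtain x where x: "x \<in> GP c I" "u = proj c I x"
    unfolding total_space_def proj_def by (auto elim!: quotientE)
  have "shift ` u = bundle_rel c I `` {shift x}" by (simp add: x(2) shift_proj[OF x(1)]) (simp add: proj_def)
  then show "shift ` u \<in> total_space c I" by (simp add: total_space_def quotientI shift_GP[OF x(1)])
next
  fix u and M :: "'n lmat"
  show "shift ` right_act u M = right_act (shift ` u) M"
    unfolding right_act_def image_image by (auto simp: shift_def case_prod_beta matrix_mul_assoc)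
next
  fix f assume f: "smooth_fun c I f"
  show "smooth_fun c I (f \<circ> (`) shift)"
    unfolding smooth_fun_def smooth_on_submanifold_def
  proof
    fix x assume x: "x \<in> GP c I"
    obtain U F where U: "open U" "shift x \<in> U" "\<And>k. Ck_on k U F" "\<And>y. y \<in> U \<inter> GP c I \<Longrightarrow> F y = f (proj c I y)"
      using f shift_GP[OF x] unfolding smooth_fun_def smooth_on_submanifold_def by meson
    have "open (shift -` U)"
      using U(1) by (intro open_vimage linear_continuous_on bounded_linear_shift)
    moreover have "Ck_on k (shift -` U) (\<lambda>x. F (shift x))" for k
      by (rule Ck_on_compose_linear[OF bounded_linear_shift U(3)])
    moreover have "F (shift y) = (f \<circ> (`) shift) (proj c I y)" if "y \<in> shift -` U \<inter> GP c I" for y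
      using that U(4)[of "shift y"] shift_GP[of y] by (simp add: shift_proj)
    ultimately show "\<exists>V H. open V \<and> x \<in> V \<and> (\<forall>k. Ck_on k V H) \<and>
        (\<forall>y\<in>V \<inter> GP c I. H y = (f \<circ> (`) shift) (proj c I y))"
      using U(2) by (intro exI[of _ "shift -` U"] exI[of _ "\<lambda>x. F (shift x)"]) auto
  qed
qed

lemma k_elt_affine: "k_elt A = k_elt 0 + g_elt c I 0 0 0 A"
  by (simp add: k_elt_def g_elt_eq g_block_add)

lemma i_hom_affine: "i_hom I A = i_hom I 0 + i_deriv I A"
  by (simp add: i_hom_def i_deriv_def l_block_add)

lemma bounded_linear_i_deriv: "bounded_linear (i_deriv I)"
  unfolding linear_conv_bounded_linear[symmetric]
  by (auto intro!: linearI simp: i_deriv_def l_block_add l_block_scaleR l_block_eq_iff matmul.add_left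
    matmul.add_right matmul.scaleR_left matmul.scaleR_right)

lemma bounded_linear_k_deriv: "bounded_linear (g_elt c I 0 0 0)"
  unfolding linear_conv_bounded_linear[symmetric]
  by (auto intro!: linearI simp: g_elt_add g_elt_scaleR)

text \<open>This is used for the sign by which two representatives in \<open>P_lift\<close> of a curve in \<open>P\<close> differ.\<close>

lemma eventually_const_sign:
  fixes q :: "real \<Rightarrow> real"
  assumes "isCont q 0" "\<forall>\<^sub>F t in nhds 0. q t = 1 \<or> q t = -1"
  shows "\<forall>\<^sub>F t in nhds 0. q t = q 0"
proof -
  have "(q \<longlongrightarrow> q 0) (nhds 0)" using assms(1) by (simp add: isCont_def tendsto_at_iff_tendsto_nhds)
  then have "\<forall>\<^sub>F t in nhds 0. dist (q t) (q 0) < 1" by (rule tendstoD) simp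
  then show ?thesis using assms(2)
  proof eventually_elim
    case (elim t)
    then show ?case using eventually_nhds_x_imp_x[OF assms(2)] by (auto simp: dist_real_def)
  qed
qed

text \<open>Let \<open>(g, M)\<close> be a curve in \<open>G \<times> P_lift\<close> and \<open>(g1, M1)\<close> a curve that lifts the image of its class. Then
\<open>g1 = g h k\<close> and \<open>M1 = \<plusminus> i(k)\<^sup>-\<^sup>1 N M\<close> for a curve \<open>k\<close> in \<open>K\<close>. The product rule gives
\<open>g1\<^sup>-\<^sup>1 g1' = Ad(k\<^sup>-\<^sup>1) Ad(h\<^sup>-\<^sup>1) (g\<^sup>-\<^sup>1 g') + k\<^sup>-\<^sup>1 k'\<close>. Under \<open>\<beta>\<close> the second summand becomes \<open>i(k)\<^sup>-\<^sup>1 i(k)'\<close>,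
which cancels against the derivative of \<open>i(k)\<^sup>-\<^sup>1\<close> in \<open>M1\<^sup>-\<^sup>1 M1'\<close>; by equivariance the first one
becomes \<open>Ad(N\<^sup>-\<^sup>1) \<beta> Ad(h\<^sup>-\<^sup>1)\<close> of \<open>g\<^sup>-\<^sup>1 g'\<close>, seen through \<open>M\<close>.\<close>

lemma pulls_back_shift:
  assumes ext: "extension c I \<beta>"
    and \<alpha>: "\<And>x. x \<in> g_alg c I \<Longrightarrow> \<alpha> x = Ad Ni (\<beta> (Ad hi x))"
  shows "pulls_back c I ((`) shift) \<beta> \<alpha>"
  unfolding pulls_back_def
proof (intro allI impI, elim conjE)
  fix \<gamma> \<delta> :: "real \<Rightarrow> 'n gmat \<times> 'n lmat" and \<gamma>' \<delta>'
  assume ev: "\<forall>\<^sub>F t in nhds 0. \<gamma> t \<in> GP c I \<and> \<delta> t \<in> GP c I \<and> shift ` proj c I (\<gamma> t) = proj c I (\<delta> t)"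
    and d\<gamma>: "(\<gamma> has_vector_derivative \<gamma>') (at 0)" and d\<delta>: "(\<delta> has_vector_derivative \<delta>') (at 0)"
  interpret inv: gauge I c hi Ni by (rule gauge_inverse)
  define g M g1 M1 where defs: "g = (\<lambda>t. fst (\<gamma> t))" "M = (\<lambda>t. snd (\<gamma> t))" "g1 = (\<lambda>t. fst (\<delta> t))" "M1 = (\<lambda>t. snd (\<delta> t))"
  obtain g' M' g1' M1' where pr: "\<gamma>' = (g', M')" "\<delta>' = (g1', M1')" by (cases \<gamma>', cases \<delta>')
  have dg: "(g has_vector_derivative g') (at 0)" and dM: "(M has_vector_derivative M') (at 0)"
    and dg1: "(g1 has_vector_derivative g1') (at 0)" and dM1: "(M1 has_vector_derivative M1') (at 0)"
    using bounded_linear.has_vector_derivative[OF bounded_linear_fst d\<gamma>]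
      bounded_linear.has_vector_derivative[OF bounded_linear_snd d\<gamma>]
      bounded_linear.has_vector_derivative[OF bounded_linear_fst d\<delta>]
      bounded_linear.has_vector_derivative[OF bounded_linear_snd d\<delta>]
    by (simp_all add: defs pr)
  have bl_t: "bounded_linear (transpose :: real^'m^'m \<Rightarrow> _)"
    by (auto intro!: linear_conv_bounded_linear[THEN iffD1] linearI simp: transpose_def vec_eq_iff)
  \<comment> \<open>The curve \<open>k = h\<^sup>-\<^sup>1 g\<^sup>-\<^sup>1 g1\<close> in \<open>K\<close>, written without inverses to show that it is differentiable, and the sign, which is read off as the upper left entry because that of \<open>i(k)\<close> is \<open>1\<close>.\<close>
  define A where "A = (\<lambda>t. \<chi> i j. (gram_G ** transpose (g t ** h) ** gram_G ** g1 t) $ Inr (Inr i) $ Inr (Inr j))"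
  define q where "q = (\<lambda>t. (N ** M t ** (- symp_form ** transpose (M1 t) ** symp_form)) $ Inl () $ Inl ())"
  have rel: "\<forall>\<^sub>F t in nhds 0. g t \<in> form_group gram_G \<and> g1 t \<in> form_group gram_G \<and> M t \<in> P_lift \<and> M1 t \<in> P_lift \<and>
      A t \<in> form_group I \<and> (q t = 1 \<or> q t = -1) \<and> g1 t = g t ** h ** k_elt (A t) \<and>
      N ** M t = q t *\<^sub>R (i_hom I (A t) ** M1 t)"
    using ev
  proof eventually_elim
    fix t assume t: "\<gamma> t \<in> GP c I \<and> \<delta> t \<in> GP c I \<and> shift ` proj c I (\<gamma> t) = proj c I (\<delta> t)"
    then have "(shift (\<gamma> t), \<delta> t) \<in> bundle_rel c I"
      by (intro proj_eq_imp_rel) (simp, metis shift_proj)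
    then have "\<exists>B\<in>form_group I. \<exists>s\<in>{1, -1}. g1 t = g t ** h ** k_elt B \<and>
        M1 t = s *\<^sub>R (matrix_inv (i_hom I B) ** (N ** M t))"
      unfolding bundle_rel_def shift_def by (simp add: defs case_prod_beta)
    then obtain B s where B: "B \<in> form_group I" "s = 1 \<or> s = -1" "g1 t = g t ** h ** k_elt B"
      "M1 t = s *\<^sub>R (matrix_inv (i_hom I B) ** (N ** M t))"
      by blast
    have mem: "g t \<in> form_group gram_G" "g1 t \<in> form_group gram_G" "M t \<in> P_lift" "M1 t \<in> P_lift"
      using t by (auto simp: GP_def defs G_grp_eq)
    then have gh: "g t ** h \<in> form_group gram_G" and M1: "M1 t \<in> form_group symp_form"
      using G.mult_mem h by (auto simp: P_lift_def)
    have "gram_G ** transpose (g t ** h) ** gram_G ** g1 t = matrix_inv (g t ** h) ** (g t ** h) ** k_elt B"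
      using B(3) by (simp add: G.inv_eq(1)[OF gh] matrix_mul_assoc)
    then have "gram_G ** transpose (g t ** h) ** gram_G ** g1 t = k_elt B" by (simp add: G.inv_eq(3)[OF gh])
    then have A: "A t = B" by (simp add: A_def k_elt_def vec_eq_iff)
    have "s *\<^sub>R (i_hom I B ** M1 t) = (s * s) *\<^sub>R (i_hom I B ** matrix_inv (i_hom I B) ** (N ** M t))"
      by (simp add: B(4) matmul.scaleR_right matrix_mul_assoc)
    then have NM: "N ** M t = s *\<^sub>R (i_hom I B ** M1 t)"
      using B(2) i_hom_inv[OF B(1)] by auto
    have "- symp_form ** transpose (M1 t) ** symp_form = matrix_inv (M1 t)"
      by (simp add: symp.inv_eq(1)[OF M1])
    then have "N ** M t ** (- symp_form ** transpose (M1 t) ** symp_form) = s *\<^sub>R (i_hom I B ** (M1 t ** matrix_inv (M1 t)))"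
      by (simp add: NM matmul.scaleR_left matrix_mul_assoc)
    then have "q t = s" by (simp add: q_def symp.inv_eq(2)[OF M1] i_hom_def)
    then show "g t \<in> form_group gram_G \<and> g1 t \<in> form_group gram_G \<and> M t \<in> P_lift \<and> M1 t \<in> P_lift \<and>
      A t \<in> form_group I \<and> (q t = 1 \<or> q t = -1) \<and> g1 t = g t ** h ** k_elt (A t) \<and>
      N ** M t = q t *\<^sub>R (i_hom I (A t) ** M1 t)"
      using B mem A NM by simp
  qed
  note at0 = eventually_nhds_x_imp_x[OF rel]
  have dgh: "((\<lambda>t. g t ** h) has_vector_derivative g' ** h) (at 0)"
    by (rule bounded_linear.has_vector_derivative[OF matmul.bounded_linear_left dg])
  have "((\<lambda>t. gram_G ** transpose (g t ** h) ** gram_G) has_vector_derivative gram_G ** transpose (g' ** h) ** gram_G) (at 0)"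
    using bounded_linear.has_vector_derivative[OF matmul.bounded_linear_left
      bounded_linear.has_vector_derivative[OF matmul.bounded_linear_right
        bounded_linear.has_vector_derivative[OF bl_t dgh]]] .
  note dK = matmul.has_vector_derivative[OF this dg1]
  have bl_A: "bounded_linear (\<lambda>K :: 'n gmat. \<chi> i j. K $ Inr (Inr i) $ Inr (Inr j))"
    unfolding linear_conv_bounded_linear[symmetric] by (auto intro!: linearI simp: vec_eq_iff)
  obtain A' where dA: "(A has_vector_derivative A') (at 0)"
    using bounded_linear.has_vector_derivative[OF bl_A dK] unfolding A_def by blast
  have "((\<lambda>t. - symp_form ** transpose (M1 t) ** symp_form) has_vector_derivative
      - symp_form ** transpose M1' ** symp_form) (at 0)"
    using bounded_linear.has_vector_derivative[OF matmul.bounded_linear_left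
      bounded_linear.has_vector_derivative[OF matmul.bounded_linear_right
        bounded_linear.has_vector_derivative[OF bl_t dM1]]] .
  note dQ = matmul.has_vector_derivative[OF
      bounded_linear.has_vector_derivative[OF matmul.bounded_linear_right dM] this]
  have bl_q: "bounded_linear (\<lambda>K :: 'n lmat. K $ Inl () $ Inl ())"
    unfolding linear_conv_bounded_linear[symmetric] by (auto intro!: linearI)
  have "isCont q 0"
    using has_vector_derivative_continuous[OF bounded_linear.has_vector_derivative[OF bl_q dQ[of N]]]
    unfolding q_def by simp
  moreover have "\<forall>\<^sub>F t in nhds 0. q t = 1 \<or> q t = -1" using rel by eventually_elim blast
  ultimately have q: "\<forall>\<^sub>F t in nhds 0. q t = q 0" by (rule eventually_const_sign)
  define s where "s = q 0"
  have s: "s * s = 1" using at0 by (auto simp: s_def)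
  have dk: "((\<lambda>t. k_elt (A t)) has_vector_derivative g_elt c I 0 0 0 A') (at 0)"
    unfolding k_elt_affine[of "A _"]
    using has_vector_derivative_add[OF has_vector_derivative_const
      bounded_linear.has_vector_derivative[OF bounded_linear_k_deriv dA]] by simp
  have di: "((\<lambda>t. i_hom I (A t)) has_vector_derivative i_deriv I A') (at 0)"
    unfolding i_hom_affine[of "A _"]
    using has_vector_derivative_add[OF has_vector_derivative_const
      bounded_linear.has_vector_derivative[OF bounded_linear_i_deriv dA]] by simp
  have g1': "g1' = g 0 ** h ** g_elt c I 0 0 0 A' + g' ** h ** k_elt (A 0)"
  proof (rule vector_derivative_unique_at[OF dg1])
    show "(g1 has_vector_derivative g 0 ** h ** g_elt c I 0 0 0 A' + g' ** h ** k_elt (A 0)) (at 0)"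
    proof (subst has_vector_derivative_cong_ev)
      show "\<forall>\<^sub>F t in nhds 0. t \<in> UNIV \<longrightarrow> g1 t = g t ** h ** k_elt (A t)"
        using rel by eventually_elim blast
      show "g1 0 = g 0 ** h ** k_elt (A 0)" using at0 by blast
    qed (rule matmul.has_vector_derivative[OF dgh dk])
  qed
  have NM': "N ** M' = s *\<^sub>R (i_hom I (A 0) ** M1' + i_deriv I A' ** M1 0)"
  proof (rule vector_derivative_unique_at)
    show "((\<lambda>t. N ** M t) has_vector_derivative N ** M') (at 0)"
      by (rule bounded_linear.has_vector_derivative[OF matmul.bounded_linear_right dM])
    show "((\<lambda>t. N ** M t) has_vector_derivative s *\<^sub>R (i_hom I (A 0) ** M1' + i_deriv I A' ** M1 0)) (at 0)"
    proof (subst has_vector_derivative_cong_ev)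
      show "\<forall>\<^sub>F t in nhds 0. t \<in> UNIV \<longrightarrow> N ** M t = s *\<^sub>R (i_hom I (A t) ** M1 t)"
        using rel q by eventually_elim (simp add: s_def)
      show "N ** M 0 = s *\<^sub>R (i_hom I (A 0) ** M1 0)" using at0 by (simp add: s_def)
    qed (rule bounded_linear.has_vector_derivative[OF bounded_linear_scaleR_right
        matmul.has_vector_derivative[OF di dM1]])
  qed
  have A0: "A 0 \<in> form_group I" using at0 by blast
  define Ai where "Ai = matrix_inv (A 0)"
  define k ki \<iota> \<iota>i where k: "k = k_elt (A 0)" "ki = k_elt Ai" "\<iota> = i_hom I (A 0)" "\<iota>i = i_hom I Ai"
  define gi Mi M1i where gi: "gi = matrix_inv (g 0)" "Mi = matrix_inv (M 0)" "M1i = matrix_inv (M1 0)"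
  note kk = k_elt_inv[OF A0, folded Ai_def, folded k]
  note \<iota>\<iota> = i_hom_inv[OF A0, folded Ai_def, folded k]
  have M0: "M 0 \<in> form_group symp_form" and M10: "M1 0 \<in> form_group symp_form"
    and g0: "g 0 \<in> form_group gram_G" using at0 by (auto simp: P_lift_def)
  note MM = symp.inv_eq(2,3)[OF M0, folded gi] and M1M1 = symp.inv_eq(2,3)[OF M10, folded gi]
    and gg = G.inv_eq(2,3)[OF g0, folded gi]
  have Aso: "Ai ** A' \<in> form_algebra I"
    unfolding Ai_def by (rule O.velocity_mem[OF _ dA]) (use rel in \<open>eventually_elim, blast\<close>)
  define \<xi> where "\<xi> = gi ** g'"
  have \<xi>: "\<xi> \<in> g_alg c I"
    unfolding \<xi>_def gi g_alg_eq by (rule G.velocity_mem[OF _ dg]) (use rel in \<open>eventually_elim, blast\<close>)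
  have gv: "matrix_inv (g1 0) ** g1' = Ad ki (Ad hi \<xi>) + g_elt c I 0 0 0 (Ai ** A')"
  proof -
    have "matrix_inv (g1 0) = ki ** hi ** gi"
    proof (rule matrix_inv_eqI)
      have "g1 0 = g 0 ** h ** k" using at0 by (simp add: k)
      then have "g1 0 ** (ki ** hi ** gi) = g 0 ** (h ** (k ** ki) ** hi) ** gi" by (simp add: matrix_mul_assoc)
      then show "g1 0 ** (ki ** hi ** gi) = mat 1" by (simp add: kk h_inv gg)
    qed
    then have "matrix_inv (g1 0) ** g1' = ki ** (hi ** (gi ** g 0) ** h) ** g_elt c I 0 0 0 A' + ki ** hi ** (gi ** g') ** h ** k"
      by (simp add: g1' k matmul.add_right matrix_mul_assoc)
    also have "\<dots> = ki ** g_elt c I 0 0 0 A' + ki ** (hi ** \<xi> ** h) ** k"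
      by (simp add: gg h_inv \<xi>_def matrix_mul_assoc)
    also have "ki ** g_elt c I 0 0 0 A' = g_elt c I 0 0 0 (Ai ** A')"
      by (simp add: k k_elt_def g_elt_eq g_block_mult g_block_eq_iff outer_arith)
    also have "hi ** \<xi> ** h = Ad hi \<xi>" using matrix_inv_eqI[OF h_inv(2)] by (simp add: Ad_def)
    also have "ki ** Ad hi \<xi> ** k = Ad ki (Ad hi \<xi>)"
      using matrix_inv_eqI[OF kk(3)] by (simp add: Ad_def[of ki])
    finally show ?thesis by (simp add: add.commute)
  qed
  define Y where "Y = \<beta> (Ad hi \<xi>)"
  have Ai: "Ai \<in> form_group I" unfolding Ai_def by (rule O.inv_mem[OF A0])
  have hix: "Ad hi \<xi> \<in> g_alg c I" by (rule inv.Ad_g_alg[OF \<xi>])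
  have Adk: "Ad ki (Ad hi \<xi>) \<in> g_alg c I"
  proof -
    obtain a X1 X2 B where x: "Ad hi \<xi> = g_elt c I a X1 X2 B" and B: "B \<in> form_algebra I" using hix by (rule g_algE)
    show ?thesis unfolding x k Ad_k_elt[OF Ai B] by (rule g_elt_mem[OF O.Ad_mem[OF Ai B]])
  qed
  have "\<beta> (Ad ki (Ad hi \<xi>) + g_elt c I 0 0 0 (Ai ** A')) = \<beta> (Ad ki (Ad hi \<xi>)) + \<beta> (g_elt c I 0 0 0 (Ai ** A'))"
    using ext Adk g_elt_mem[OF Aso] unfolding extension_def by blast
  moreover have "\<beta> (Ad ki (Ad hi \<xi>)) = Ad \<iota>i Y" using ext Ai hix unfolding extension_def k Y_def by blast
  moreover have "\<beta> (g_elt c I 0 0 0 (Ai ** A')) = i_deriv I (Ai ** A')" using ext Aso unfolding extension_def by blast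
  ultimately have \<beta>v: "\<beta> (matrix_inv (g1 0) ** g1') = Ad \<iota>i Y + i_deriv I (Ai ** A')" by (simp add: gv)
  define D where "D = i_deriv I A'"
  have iD: "i_deriv I (Ai ** A') = \<iota>i ** D"
    by (simp add: k D_def i_hom_def i_deriv_def l_block_mult l_block_eq_iff outer_arith matmul.zero_left
      matmul.zero_right matrix_mul_assoc[symmetric])
  have M1e: "M1 0 = s *\<^sub>R (\<iota>i ** N ** M 0)"
  proof -
    have "N ** M 0 = s *\<^sub>R (\<iota> ** M1 0)" using at0 by (simp add: s_def k)
    then have "\<iota>i ** N ** M 0 = s *\<^sub>R (\<iota>i ** \<iota> ** M1 0)" by (simp add: matrix_mul_assoc[symmetric] matmul.scaleR_right)
    then show ?thesis by (simp add: \<iota>\<iota> s)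
  qed
  have M1i: "M1i = s *\<^sub>R (Mi ** Ni ** \<iota>)"
  proof -
    have "M1 0 ** (s *\<^sub>R (Mi ** Ni ** \<iota>)) = (s * s) *\<^sub>R (\<iota>i ** (N ** (M 0 ** Mi) ** Ni) ** \<iota>)"
      by (simp add: M1e matmul.scaleR_left matmul.scaleR_right matrix_mul_assoc)
    then have "M1 0 ** (s *\<^sub>R (Mi ** Ni ** \<iota>)) = mat 1" by (simp add: s MM N_inv \<iota>\<iota>)
    then show ?thesis unfolding gi by (rule matrix_inv_eqI)
  qed
  have M1': "M1' = \<iota>i ** (s *\<^sub>R (N ** M') - D ** M1 0)"
  proof -
    have "s *\<^sub>R (N ** M') = \<iota> ** M1' + D ** M1 0" by (simp add: NM' s k D_def)
    then have "\<iota>i ** (s *\<^sub>R (N ** M') - D ** M1 0) = \<iota>i ** \<iota> ** M1'" by (simp add: matrix_mul_assoc)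
    then show ?thesis by (simp add: \<iota>\<iota>)
  qed
  have e1: "M1i ** M1' = Mi ** M' - Mi ** Ni ** D ** (\<iota>i ** N ** M 0)"
  proof -
    have "M1i ** M1' = s *\<^sub>R (Mi ** Ni ** (\<iota> ** \<iota>i) ** (s *\<^sub>R (N ** M') - D ** M1 0))"
      by (simp add: M1i M1' matmul.scaleR_left matrix_mul_assoc)
    also have "\<dots> = (s * s) *\<^sub>R (Mi ** (Ni ** N) ** M') - (s * s) *\<^sub>R (Mi ** Ni ** D ** (\<iota>i ** N ** M 0))"
      by (simp add: \<iota>\<iota> M1e matmul.diff_right matmul.scaleR_right scaleR_diff_right matrix_mul_assoc)
    finally show ?thesis by (simp add: s N_inv)
  qed
  have AdM1: "Ad M1i Z = Mi ** Ni ** \<iota> ** Z ** (\<iota>i ** N ** M 0)" for Z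
  proof -
    have "matrix_inv M1i = M1 0" by (rule matrix_inv_eqI[OF M1M1(2)])
    then have "Ad M1i Z = (s * s) *\<^sub>R (Mi ** Ni ** \<iota> ** Z ** (\<iota>i ** N ** M 0))"
      by (simp add: Ad_def M1e M1i matmul.scaleR_left matmul.scaleR_right)
    then show ?thesis by (simp add: s)
  qed
  have "Ad \<iota>i Y = \<iota>i ** Y ** \<iota>" using matrix_inv_eqI[OF \<iota>\<iota>(3)] by (simp add: Ad_def)
  then have "Ad M1i (Ad \<iota>i Y) = Mi ** Ni ** (\<iota> ** \<iota>i) ** Y ** (\<iota> ** \<iota>i) ** N ** M 0"
    by (simp add: AdM1 matrix_mul_assoc)
  also have "\<dots> = Mi ** (Ni ** Y ** N) ** M 0" by (simp add: \<iota>\<iota> matrix_mul_assoc)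
  also have "Ni ** Y ** N = \<alpha> \<xi>" using matrix_inv_eqI[OF N_inv(2)] by (simp add: \<alpha>[OF \<xi>] Y_def Ad_def[of Ni])
  also have "Mi ** \<alpha> \<xi> ** M 0 = Ad Mi (\<alpha> \<xi>)" using matrix_inv_eqI[OF MM(2)] by (simp add: Ad_def)
  finally have e2: "Ad M1i (Ad \<iota>i Y) = Ad Mi (\<alpha> \<xi>)" .
  have "Ad M1i (\<iota>i ** D) = Mi ** Ni ** (\<iota> ** \<iota>i) ** D ** (\<iota>i ** N ** M 0)" by (simp add: AdM1 matrix_mul_assoc)
  then have e3: "Ad M1i (\<iota>i ** D) = Mi ** Ni ** D ** (\<iota>i ** N ** M 0)" by (simp add: \<iota>\<iota>)
  have "\<delta> 0 = (g1 0, M1 0)" "\<gamma> 0 = (g 0, M 0)" by (simp_all add: defs)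
  then show "cartan_form \<beta> (\<delta> 0) \<delta>' = cartan_form \<alpha> (\<gamma> 0) \<gamma>'"
    by (simp add: cartan_form_def pr \<beta>v iD Ad_add e1 e2 e3 flip: gi \<xi>_def)
qed

lemma equivalent_shift:
  assumes "extension c I \<beta>" "\<And>x. x \<in> g_alg c I \<Longrightarrow> \<alpha> x = Ad Ni (\<beta> (Ad hi x))"
  shows "equivalent c I \<alpha> \<beta>"
  unfolding equivalent_def using bundle_morphism_shift pulls_back_shift[OF assms] by blast

end

context sign_setting
begin

section \<open>Uniqueness up to equivalence\<close>

text \<open>Only the values on \<open>\<gg>\<close> enter, also into the choice of representatives.\<close>

lemma normal_cong:
  assumes ext: "extension c I \<beta>" and eq: "\<And>x. x \<in> g_alg c I \<Longrightarrow> \<beta>' x = \<beta> x" and norm: "normal c I \<beta>"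
  shows "normal c I \<beta>'"
proof -
  have "lift c I \<beta>' X = lift c I \<beta> X" for X
    unfolding lift_def by (rule arg_cong[where f = Eps]) (auto simp: eq)
  then have "curv_lp c I \<beta>' X Y = curv_lp c I \<beta> X Y" if "X \<in> l_alg" "Y \<in> l_alg" for X Y
    using lift_spec(1)[OF ext that(1)] lift_spec(1)[OF ext that(2)]
    by (simp add: curv_lp_def curvature_def eq bracket_g_alg)
  note cl = this
  show ?thesis unfolding normal_def
  proof (intro allI impI ballI)
    fix B :: "'n lmat set" and Z and X :: "'n lmat" assume BZ: "dual_bases B Z" and X: "X \<in> l_alg"
    have m: "b \<in> l_alg" "Z b \<in> l_alg" if "b \<in> B" for b
      using BZ that by (auto simp: dual_bases_def l_filt_def)
    show "(\<Sum>b\<in>B. curv_lp c I \<beta>' (bracket (Z b) X) b) = 2 *\<^sub>R (\<Sum>b\<in>B. bracket (Z b) (curv_lp c I \<beta>' X b))"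
      using norm[unfolded normal_def, rule_format, OF BZ X]
      by (simp add: cl m X bracket_l_alg cong: sum.cong)
  qed
qed

definition gauge_h :: "real \<Rightarrow> 'n gmat" where
  "gauge_h s = g_block 1 0 0 0 s 0 0 0 (mat 1)"

text \<open>An \<open>SL(2,\<real>)\<close>-matrix acting on the two copies of \<open>V\<close> in \<open>\<ll>\<^sub>-\<^sub>1\<close>, a scaling by \<open>s\<close> and a unipotent part of
degree 2 with entry \<open>k\<close>. The factors \<open>I\<close> account for the second copy being embedded by \<open>X \<mapsto> IX\<close>.\<close>

definition gauge_N :: "real \<Rightarrow> real \<Rightarrow> real \<Rightarrow> real \<Rightarrow> real \<Rightarrow> real \<Rightarrow> 'n lmat" where
  "gauge_N s k a b d e = l_block s 0 0 k  0 (a *\<^sub>R mat 1) (b *\<^sub>R I) 0  0 (d *\<^sub>R I) (e *\<^sub>R mat 1) 0  0 0 0 (1 / s)"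

lemma gauge_N_inv:
  assumes "s \<noteq> 0" "a * e - b * d = 1"
  shows "gauge_N s k a b d e ** gauge_N (1 / s) (- k) e (- b) (- d) a = mat 1"
proof -
  have "a * e = 1 + b * d" "e * a = 1 + d * b" using assms(2) by (simp_all add: algebra_simps)
  then show ?thesis
    using assms(1) unfolding gauge_N_def l_block_mult l_block_one l_block_eq_iff
    by (simp add: outer_arith matmul.scaleR_left matmul.scaleR_right matmul.minus_right scaleR_add_left
      mult.commute)
qed

lemma gauge_N_mem:
  assumes "s \<noteq> 0" "a * e - b * d = 1"
  shows "gauge_N s k a b d e \<in> P_lift"
proof (rule P_liftI)
  have "a * e = 1 + b * d" "e * a = 1 + d * b" using assms(2) by (simp_all add: algebra_simps)
  then show "gauge_N s k a b d e \<in> form_group symp_form"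
    using assms(1) unfolding form_group_def mem_Collect_eq gauge_N_def symp_form_def l_block_transpose l_block_mult l_block_eq_iff
    by (simp add: outer_arith matmul.scaleR_left matmul.scaleR_right matmul.zero_left matmul.zero_right
      matmul.minus_left matmul.minus_right transpose_scalar
      scaleR_add_left mult.commute)
  fix r t :: "'n lix" show "gauge_N s k a b d e $ r $ t \<noteq> 0 \<Longrightarrow> block_pos t - block_pos r \<ge> 0"
  proof -
    have "\<forall>r t. gauge_N s k a b d e $ r $ t \<noteq> 0 \<longrightarrow> block_pos t - block_pos r \<ge> 0"
      by (simp add: all_lix gauge_N_def)
    then show "gauge_N s k a b d e $ r $ t \<noteq> 0 \<Longrightarrow> block_pos t - block_pos r \<ge> 0" by blast
  qed
qed

lemma gauge_gauge_N:
  assumes s: "s \<noteq> 0" "a * e - b * d = 1" and t: "t * t = 1"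
  shows "gauge I c (gauge_h t) (gauge_N s k a b d e)"
proof unfold_locales
  show "gauge_h t \<in> form_group gram_G"
    using t by (simp add: form_group_def gauge_h_def gram_G_def g_block_transpose g_block_mult g_block_eq_iff outer_arith mult.commute
      mult.left_commute)
  show "gauge_N s k a b d e \<in> P_lift" by (rule gauge_N_mem[OF s])
  show "matrix_inv (gauge_N s k a b d e) \<in> P_lift"
    unfolding matrix_inv_eqI[OF gauge_N_inv[OF s]] using s by (intro gauge_N_mem) (auto simp: algebra_simps)
  show "gauge_h t ** k_elt A = k_elt A ** gauge_h t" for A
    by (simp add: gauge_h_def k_elt_def g_block_mult outer_arith)
  show "gauge_N s k a b d e ** i_hom I A = i_hom I A ** gauge_N s k a b d e" for A
    by (simp add: gauge_N_def i_hom_def l_block_mult outer_arith matmul.scaleR_left matmul.scaleR_right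
      matmul.zero_left matmul.zero_right l_block_eq_iff)
      (simp add: matrix_mul_assoc)
qed

lemma Ad_gauge_h:
  assumes t: "t * t = 1"
  shows "Ad (gauge_h t) (g_elt c I a X1 X2 A) = g_elt c I (t * a) X1 (t *\<^sub>R X2) A"
proof -
  have "matrix_inv (gauge_h t) = gauge_h t"
    using t by (intro matrix_inv_eqI) (simp add: gauge_h_def g_block_mult g_block_one outer_arith)
  then show ?thesis
    using t by (simp add: Ad_def gauge_h_def g_elt_eq g_block_mult g_block_eq_iff outer_arith matrix_vector_arith mult_ac)
qed

lemma Ad_gauge_N:
  assumes s: "s \<noteq> 0" "a * e - b * d = 1"
    and eq: "Ad (gauge_N s k a b d e) (l_elt d0 u v w x y A B C f) = l_elt d1 u1 v1 w1 x1 y1 A1 B1 C1 f1"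
  shows "d1 = d0 + k * f / s" "x1 = (1 / s) *\<^sub>R (a *\<^sub>R x + b *\<^sub>R (I *v y))"
    "y1 = (1 / s) *\<^sub>R (d *\<^sub>R (I *v x) + e *\<^sub>R y)" "f1 = f / (s * s)"
proof -
  have "gauge_N s k a b d e ** l_elt d0 u v w x y A B C f ** gauge_N (1 / s) (- k) e (- b) (- d) a =
      l_elt d1 u1 v1 w1 x1 y1 A1 B1 C1 f1"
    using eq unfolding Ad_def matrix_inv_eqI[OF gauge_N_inv[OF s]] .
  then show "d1 = d0 + k * f / s" "x1 = (1 / s) *\<^sub>R (a *\<^sub>R x + b *\<^sub>R (I *v y))"
    "y1 = (1 / s) *\<^sub>R (d *\<^sub>R (I *v x) + e *\<^sub>R y)" "f1 = f / (s * s)"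
  proof -
    note e = \<open>gauge_N s k a b d e ** _ ** _ = _\<close>[unfolded gauge_N_def l_elt_def l_block_mult l_block_eq_iff]
    note e4 = e[THEN conjunct2, THEN conjunct2, THEN conjunct2, THEN conjunct2]
    note e8 = e4[THEN conjunct2, THEN conjunct2, THEN conjunct2, THEN conjunct2]
    note e12 = e8[THEN conjunct2, THEN conjunct2, THEN conjunct2, THEN conjunct2]
    show "d1 = d0 + k * f / s" using e[THEN conjunct1, symmetric] s(1) by (simp add: field_simps)
    show "x1 = (1 / s) *\<^sub>R (a *\<^sub>R x + b *\<^sub>R (I *v y))"
      using e4[THEN conjunct1, symmetric] by (simp add: matrix_vector_arith)
    show "y1 = (1 / s) *\<^sub>R (d *\<^sub>R (I *v x) + e *\<^sub>R y)"
      using e8[THEN conjunct1, symmetric] by (simp add: matrix_vector_arith)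
    show "f1 = f / (s * s)" using e12[THEN conjunct1, symmetric] by simp
  qed
qed

text \<open>The component of degree -2 of the curvature at two parallel vectors \<open>e\<^sub>i\<close>, one in each copy of \<open>V\<close>,
is \<open>\<plusminus>(f - 2 det T)\<close>. If \<open>f\<close> were \<open>0\<close>, the element with \<open>a = 1\<close> would be mapped to \<open>\<pp>\<close>.\<close>

lemma extension_regular_invariants:
  assumes ext: "extension c I \<beta>" and reg: "regular c I \<beta>"
    and \<beta>: "\<And>a X1 X2 A. A \<in> form_algebra I \<Longrightarrow> \<beta> (g_elt c I a X1 X2 A) =
       equivariant_elt d t11 t12 t21 t22 p11 p12 p21 p22 x y z w f a X1 X2 A"
  shows "f = 2 * (t11 * t22 - t12 * t21)" "f \<noteq> 0"
proof -
  fix i :: 'n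
  let ?e = "axis i (1::real) :: real^'n"
  let ?x = "g_elt c I 0 ?e 0 0" and ?y = "g_elt c I 0 0 ?e 0"
  let ?X = "l_elt 0 0 0 0 (t11 *\<^sub>R ?e) (I *v (t21 *\<^sub>R ?e)) 0 0 0 0 :: 'n lmat"
  let ?Y = "l_elt 0 0 0 0 (t12 *\<^sub>R ?e) (I *v (t22 *\<^sub>R ?e)) 0 0 0 0 :: 'n lmat"
  have deg: "l_elt 0 0 0 0 u v 0 0 0 0 \<in> l_deg (-1)" for u v :: "real^'n"
    unfolding l_deg_def mem_Collect_eq l_elt_mem_iff by (simp add: transpose_zero) (simp add: l_elt_def all_lix transpose_zero)
  have xy: "\<beta> ?x - ?X \<in> p_alg" "\<beta> ?y - ?Y \<in> p_alg"
    by (simp_all add: \<beta>[OF zero_so] equivariant_elt_def l_elt_diff l_elt_mem_p_iff transpose_zero)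
  have "curv_lp c I \<beta> ?X ?Y \<in> l_filt (-1 + -1 + 1)"
    using reg deg unfolding regular_def by (metis neg_less_0_iff_less zero_less_one)
  then have "curvature \<beta> ?x ?y \<in> l_filt (-1)"
    using curv_lp_eq[OF ext g_elt_mem[OF zero_so] xy(1) g_elt_mem[OF zero_so] xy(2)] by simp
  then have 0: "curvature \<beta> ?x ?y $ Inr (Inr (Inr ())) $ Inl () = 0"
    unfolding l_filt_def by force
  have b: "bracket ?x ?y = g_elt c I (- eps i) 0 0 ((outer 0 ?e - outer ?e 0 + c *\<^sub>R outer ?e 0 - c *\<^sub>R outer 0 ?e) ** I)"
    unfolding bracket_g_elt[OF zero_so zero_so] by (simp add: inner_axis' bracket_def I_nth)
  have so: "(outer 0 ?e - outer ?e 0 + c *\<^sub>R outer ?e 0 - c *\<^sub>R outer 0 ?e) ** I \<in> form_algebra I"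
    using zero_so by (simp add: outer_arith)
  have "curvature \<beta> ?x ?y $ Inr (Inr (Inr ())) $ Inl () = 2 * (t12 * t21 - t11 * t22) * eps i + f * eps i"
    unfolding curvature_def b \<beta>[OF so] unfolding \<beta>[OF zero_so] equivariant_elt_def
    by (subst bracket_l_elt)
      (simp_all add: transpose_zero l_elt_diff, simp add: l_elt_def inner_axis inner_axis' matrix_vector_arith algebra_simps,
       simp add: axis_def I_nth)
  then have "(2 * (t12 * t21 - t11 * t22) + f) * eps i = 0" using 0 by (simp add: algebra_simps)
  then have "2 * (t12 * t21 - t11 * t22) + f = 0" using eps_nz[of i] by (simp only: mult_eq_0_iff) blast
  then show "f = 2 * (t11 * t22 - t12 * t21)" by (simp add: algebra_simps)
  show "f \<noteq> 0"
  proof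
    assume "f = 0"
    then have "\<beta> (g_elt c I 1 0 0 0) \<in> p_alg"
      by (simp add: \<beta>[OF zero_so] equivariant_elt_def l_elt_mem_p_iff transpose_scalar)
    then have "g_elt c I 1 0 0 0 \<in> k_alg c I" using ext g_elt_mem[OF zero_so] unfolding extension_def by blast
    then show False by (auto simp: k_alg_def g_elt_eq_iff)
  qed
qed

text \<open>Regularity makes \<open>T\<close> invertible, so a gauge transformation brings it to \<open>T = 1\<close> and removes the
component along the grading element. The result is one of the normalized maps, on which normality
leaves no freedom.\<close>

lemma gauge_to_alpha:
  assumes ext: "extension c I \<beta>" and reg: "regular c I \<beta>" and norm: "normal c I \<beta>"
  obtains h N where "gauge I c h N" "\<And>x. x \<in> g_alg c I \<Longrightarrow> alpha x = Ad N (\<beta> (Ad h x))"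
proof -
  obtain d t11 t12 t21 t22 p11 p12 p21 p22 x y z w f where
    \<beta>: "\<And>a X1 X2 A. A \<in> form_algebra I \<Longrightarrow> \<beta> (g_elt c I a X1 X2 A) =
       equivariant_elt d t11 t12 t21 t22 p11 p12 p21 p22 x y z w f a X1 X2 A"
    by (rule extension_equivariant_elt[OF ext]) (rule that)
  note inv = extension_regular_invariants[OF ext reg \<beta>]
  \<comment> \<open>The reflection \<open>gauge_h t\<close> makes \<open>det T\<close> positive; \<open>s\<close> is the square root of the determinant that results.\<close>
  define t :: real where "t = (if f > 0 then 1 else -1)"
  have t: "t * t = 1" "t * f > 0" using inv(2) by (auto simp: t_def)
  define s where "s = sqrt (t * f / 2)"
  have s: "s > 0" "s * s = t * f / 2" using t by (simp_all add: s_def)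
  let ?h = "gauge_h t" and ?N = "gauge_N s (- d * s / f) (t * t22 / s) (- t * t12 / s) (- t21 / s) (t11 / s)"
  have "t * (t11 * t22 - t12 * t21) = s * s" unfolding s(2) using inv(1) by simp
  then have ss: "t * (t11 * t22 - t12 * t21) / (s * s) = 1" using s(1) by simp
  have det: "(t * t22 / s) * (t11 / s) - (- t * t12 / s) * (- t21 / s) = 1"
  proof -
    have "(t * t22 / s) * (t11 / s) - (- t * t12 / s) * (- t21 / s) = t * (t11 * t22 - t12 * t21) / (s * s)"
      by (simp add: diff_divide_distrib algebra_simps)
    also have "\<dots> = 1" by (rule ss)
    finally show ?thesis .
  qed
  note s0 = less_imp_neq[OF s(1), symmetric]
  \<comment> \<open>The middle blocks of \<open>N0\<close> are \<open>s\<close> times the inverse of \<open>T\<close> after the reflection, and the unipotent entry cancels the component \<open>d\<close> along the grading element.\<close>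
  define N0 where "N0 = ?N"
  interpret gauge I c ?h N0 unfolding N0_def by (rule gauge_gauge_N[OF s0 det t(1)])
  note ext' = extension_transform[OF ext] and norm' = normal_transform[OF ext norm]
  obtain d' t11' t12' t21' t22' p11' p12' p21' p22' x' y' z' w' f' where
    \<beta>': "\<And>a X1 X2 A. A \<in> form_algebra I \<Longrightarrow> transform \<beta> (g_elt c I a X1 X2 A) =
       equivariant_elt d' t11' t12' t21' t22' p11' p12' p21' p22' x' y' z' w' f' a X1 X2 A"
    by (rule extension_equivariant_elt[OF ext']) (rule that)
  have tr: "Ad N0 (equivariant_elt d t11 t12 t21 t22 p11 p12 p21 p22 x y z w f (t * a) X1 (t *\<^sub>R X2) 0) =
      equivariant_elt d' t11' t12' t21' t22' p11' p12' p21' p22' x' y' z' w' f' a X1 X2 0" for a X1 X2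
    using \<beta>'[OF zero_so, of a X1 X2] unfolding transform_def Ad_gauge_h[OF t(1)] \<beta>[OF zero_so] .
  note comp = Ad_gauge_N[OF s0 det tr[unfolded equivariant_elt_def N0_def]]
  fix i :: 'n
  let ?e = "axis i (1::real) :: real^'n"
  have "d' = t * d + (- d * s / f) * (f * t) / s" using comp(1)[of 1] by (simp add: mult_ac)
  then have d': "d' = 0" using s0 inv(2) by simp
  have "f' = f * t / (s * s)" using comp(4)[of 1] by simp
  moreover have "f * t = 2 * (s * s)" unfolding s(2) by simp
  ultimately have f': "f' = 2" using s0 by simp
  have c1: "t11' *\<^sub>R ?e = (t * (t11 * t22 - t12 * t21) / (s * s)) *\<^sub>R ?e"
    "t12' *\<^sub>R ?e = 0 *\<^sub>R ?e"
    using comp(2)[of ?e 0] comp(2)[of 0 ?e] s0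
    by (simp_all add: matrix_vector_arith vec_eq_iff field_simps)
  have c2: "I *v (t21' *\<^sub>R ?e) = I *v (0 *\<^sub>R ?e)" "I *v (t22' *\<^sub>R ?e) = I *v ((t * (t11 * t22 - t12 * t21) / (s * s)) *\<^sub>R ?e)"
    using comp(3)[of ?e 0] comp(3)[of 0 ?e] s0 t(1)
    by (simp_all add: matrix_vector_arith vec_eq_iff field_simps)
  have I_inj: "I *v U = I *v V \<longleftrightarrow> U = V" for U V by (metis I_sq(2))
  have T: "t11' = 1" "t12' = 0" "t21' = 0" "t22' = 1"
    using c1 c2 unfolding I_inj ss scaleR_cancel_right by (simp_all add: axis_eq_0_iff)
  have on_g: "transform \<beta> u = normalized_map p11' p12' p21' p22' x' y' z' w' u" if "u \<in> g_alg c I" for u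
    using that by (elim g_algE) (simp add: normalized_map_g_elt \<beta>' d' f' T)
  then have "normal c I (normalized_map p11' p12' p21' p22' x' y' z' w')"
    by (intro normal_cong[OF ext' _ norm']) simp
  then have "normalized_map p11' p12' p21' p22' x' y' z' w' = alpha"
    unfolding normal_normalized_map_iff[OF refl] by (simp add: alpha_def Let_def)
  then have "alpha u = Ad N0 (\<beta> (Ad ?h u))" if "u \<in> g_alg c I" for u
    using on_g[OF that] unfolding transform_def by simp
  then show thesis by (rule that[OF gauge_axioms])
qed

lemma alpha_unique_up_to_equivalence:
  assumes ext: "extension c I \<beta>" and reg: "regular c I \<beta>" and norm: "normal c I \<beta>"
  shows "equivalent c I alpha \<beta>" "equivalent c I \<beta> alpha"
proof -
  obtain h N where g: "gauge I c h N" and eq: "\<And>x. x \<in> g_alg c I \<Longrightarrow> alpha x = Ad N (\<beta> (Ad h x))"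
    by (rule gauge_to_alpha[OF ext reg norm]) (rule that)
  interpret gauge I c h N by (rule g)
  interpret inv: gauge I c hi Ni by (rule gauge_inverse)
  have "matrix_inv hi = h" "matrix_inv Ni = N" using matrix_inv_eqI h_inv(2) N_inv(2) by auto
  then show "equivalent c I alpha \<beta>" by (intro inv.equivalent_shift[OF ext]) (simp add: eq)
  have "\<beta> x = Ad Ni (alpha (Ad hi x))" if "x \<in> g_alg c I" for x
    by (simp add: eq[OF inv.Ad_g_alg[OF that]] Ad_cancel)
  then show "equivalent c I \<beta> alpha" by (rule equivalent_shift[OF extension_alpha])
qed

end

section \<open>Existence, uniqueness and curvature of the regular normal extension\<close>

theorem theorem7p4:
  fixes I :: "real^'n^'n" and p q :: nat and c n :: real
  assumes "sign_matrix p q I"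
    and "c = 1 \<or> c = -1"
    and "n = real (p + q)"
  shows "\<exists>\<alpha>. extension c I \<alpha> \<and> regular c I \<alpha> \<and> normal c I \<alpha> \<and>
    (\<forall>\<beta>. extension c I \<beta> \<and> regular c I \<beta> \<and> normal c I \<beta> \<longrightarrow>
         equivalent c I \<alpha> \<beta> \<and> equivalent c I \<beta> \<alpha>) \<and>
    (\<forall>a X1 X2. \<forall>A\<in>form_algebra I.
       \<alpha> (g_elt c I a X1 X2 A) =
         l_block
           0   ((- n / (2 * (n+1))) *\<^sub>R (X1 v* I))  ((- c * n / (2 * (n+1))) *\<^sub>R X2)  (- 2 * c * n^2 / (4 * (n+1)^2) * a)
           X1  A  ((c / (n+1) * a) *\<^sub>R I)  ((- c * n / (2 * (n+1))) *\<^sub>R X2)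
           (I *v X2)  ((- 1 / (n+1) * a) *\<^sub>R I)  (I ** A ** I)  ((n / (2 * (n+1))) *\<^sub>R (I *v X1))
           (2 * a)  (X2 v* I)  (- X1)  0) \<and>
    (\<forall>a X1 X2 b Y1 Y2. \<forall>A\<in>form_algebra I. \<forall>B\<in>form_algebra I.
       (let R1 = ((n+2) / (2 * (n+1))) *\<^sub>R
                   ((outer X1 Y1 - outer Y1 X1 + c *\<^sub>R outer X2 Y2 - c *\<^sub>R outer Y2 X2) ** I);
            R2 = 1 / (n+1) * (X2 \<bullet> (I *v Y1) - X1 \<bullet> (I *v Y2));
            R3 = (n / (2 * (n+1))) *\<^sub>R
                   ((outer X1 Y2 + outer Y2 X1 - outer X2 Y1 - outer Y1 X2) ** I)
        in curvature \<alpha> (g_elt c I a X1 X2 A) (g_elt c I b Y1 Y2 B) =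
             l_block
               0 0 0 0
               0 R1 (- c *\<^sub>R (R3 ** I) - (c * R2) *\<^sub>R I) 0
               0 (I ** R3 + R2 *\<^sub>R I) (I ** R1 ** I) 0
               0 0 0 0))"
proof -
  interpret sign_setting I c by unfold_locales (use assms in auto)
  have n: "n = real CARD('n)" using card_eq[OF assms(1)] assms(3) by simp
  show ?thesis
  proof (intro exI[of _ alpha] conjI allI ballI impI)
    fix a X1 X2 A assume A: "A \<in> form_algebra I"
    show "alpha (g_elt c I a X1 X2 A) =
         l_block
           0   ((- n / (2 * (n+1))) *\<^sub>R (X1 v* I))  ((- c * n / (2 * (n+1))) *\<^sub>R X2)  (- 2 * c * n^2 / (4 * (n+1)^2) * a)
           X1  A  ((c / (n+1) * a) *\<^sub>R I)  ((- c * n / (2 * (n+1))) *\<^sub>R X2)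
           (I *v X2)  ((- 1 / (n+1) * a) *\<^sub>R I)  (I ** A ** I)  ((n / (2 * (n+1))) *\<^sub>R (I *v X1))
           (2 * a)  (X2 v* I)  (- X1)  0"
      by (simp add: alpha_def Let_def n[symmetric] normalized_map_g_elt equivariant_elt_def l_elt_def l_block_eq_iff matrix_vector_arith
        so_transpose[OF A])
  next
    fix a X1 X2 b Y1 Y2 A B assume A: "A \<in> form_algebra I" and B: "B \<in> form_algebra I"
    show "let R1 = ((n+2) / (2 * (n+1))) *\<^sub>R
                   ((outer X1 Y1 - outer Y1 X1 + c *\<^sub>R outer X2 Y2 - c *\<^sub>R outer Y2 X2) ** I);
            R2 = 1 / (n+1) * (X2 \<bullet> (I *v Y1) - X1 \<bullet> (I *v Y2));
            R3 = (n / (2 * (n+1))) *\<^sub>R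
                   ((outer X1 Y2 + outer Y2 X1 - outer X2 Y1 - outer Y1 X2) ** I)
        in curvature alpha (g_elt c I a X1 X2 A) (g_elt c I b Y1 Y2 B) =
             l_block
               0 0 0 0
               0 R1 (- c *\<^sub>R (R3 ** I) - (c * R2) *\<^sub>R I) 0
               0 (I ** R3 + R2 *\<^sub>R I) (I ** R1 ** I) 0
               0 0 0 0"
      unfolding curvature_alpha[OF n A B] Let_def l_elt_def l_block_eq_iff
      by (intro conjI) (simp_all add: vec_eq_iff transpose_def algebra_simps)
  qed (use extension_alpha regular_alpha normal_alpha alpha_unique_up_to_equivalence in auto)
qed

end
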